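(* Let $p$ be a prime number, let $f:A\rightarrow B$ and $g:B\rightarrow C$ be $\mathbb{F}_p$-algebra maps, and let $e>0$ be an integer. Assume that $g$ is $e$-Dumitrescu, and that the image of the associated map ${}^ag:\operatorname{Spec} C\rightarrow \operatorname{Spec} B$ contains the set $\operatorname{Max} B$ of maximal ideals of $B$. If $gf:A\rightarrow C$ is $F$-finite, and $B$ and $C^{(e)}\otimes_{A^{(e)}}A$ are Noetherian rings, then $f$ is $F$-finite.
   Context: All rings are commutative with identity; $p$ is a prime number. For an $\mathbb{F}_p$-algebra $A$ and an integer $e\geq 0$, $A^{(e)}$ denotes a copy of the ring $A$, with $a\in A$ written $a^{(e)}$ when viewed in $A^{(e)}$ (so $a^{(e)}b^{(e)}=(ab)^{(e)}$ and $a^{(e)}+b^{(e)}=(a+b)^{(e)}$), and $A=A^{(0)}$ is regarded as an $A^{(e)}$-algebra through the iterated Frobenius $a^{(e)}\mapsto a^{p^e}$. An $\mathbb{F}_p$-algebra map $f:A\to B$ makes $B^{(e)}$ an $A^{(e)}$-algebra via $a^{(e)}\mapsto f(a)^{(e)}$. The relative Frobenius (Radu–André) homomorphism is the ring map $\Phi_e(A,B):B^{(e)}\otimes_{A^{(e)}}A\rightarrow B$, $b^{(e)}\otimes a\mapsto b^{p^e}a$ (where $a$ acts through $f$). The map $A\to B$ is called $F$-finite (or $B$ is $F$-finite over $A$) if $\Phi_1(A,B)$ is finite, i.e. $B$ is a finitely generated $B^{(1)}\otimes_{A^{(1)}}A$-module through $\Phi_1(A,B)$. An $R$-linear map $\varphi:M\to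 N$ is $R$-pure if $\varphi\otimes 1_L:M\otimes_R L\to N\otimes_R L$ is injective for every $R$-module $L$. For an integer $e>0$, an $\mathbb{F}_p$-algebra map $A\to B$ is $e$-Dumitrescu if $\Phi_e(A,B)$ is pure as an $A$-linear map, where $A$ acts on $B^{(e)}\otimes_{A^{(e)}}A$ through the second tensor factor. *)

theory Defs
  imports "HOL-Algebra.Free_Abelian_Groups" "HOL-Algebra.IntRing" "HOL-Algebra.Ring_Divisibility"
begin

subsection \<open>Tensor products\<close>

text \<open>
  The tensor product is the quotient of the free abelian group on \<open>carrier M \<times> carrier N\<close>
  by the subgroup generated by the bilinearity relations; its elements are cosets.
\<close>

definition tensor_relations ::
  "('r, 'u) ring_scheme \<Rightarrow> ('r, 'm, 'v) module_scheme \<Rightarrow> ('r, 'n, 'w) module_scheme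
    \<Rightarrow> (('m \<times> 'n) \<Rightarrow>\<^sub>0 int) set"
  where "tensor_relations R M N =
    {frag_of (x \<oplus>\<^bsub>M\<^esub> x', y) - frag_of (x, y) - frag_of (x', y) | x x' y.
        x \<in> carrier M \<and> x' \<in> carrier M \<and> y \<in> carrier N} \<union>
    {frag_of (x, y \<oplus>\<^bsub>N\<^esub> y') - frag_of (x, y) - frag_of (x, y') | x y y'.
        x \<in> carrier M \<and> y \<in> carrier N \<and> y' \<in> carrier N} \<union>
    {frag_of (r \<odot>\<^bsub>M\<^esub> x, y) - frag_of (x, r \<odot>\<^bsub>N\<^esub> y) | r x y.
        r \<in> carrier R \<and> x \<in> carrier M \<and> y \<in> carrier N}"

abbreviation tensor_free ::
  "('r, 'm, 'v) module_scheme \<Rightarrow> ('r, 'n, 'w) module_scheme \<Rightarrow> (('m \<times> 'n) \<Rightarrow>\<^sub>0 int) monoid"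
  where "tensor_free M N \<equiv> free_Abelian_group (carrier M \<times> carrier N)"

definition tensor_null ::
  "('r, 'u) ring_scheme \<Rightarrow> ('r, 'm, 'v) module_scheme \<Rightarrow> ('r, 'n, 'w) module_scheme
    \<Rightarrow> (('m \<times> 'n) \<Rightarrow>\<^sub>0 int) set"
  where "tensor_null R M N = generate (tensor_free M N) (tensor_relations R M N)"

definition tensor_class ::
  "('r, 'u) ring_scheme \<Rightarrow> ('r, 'm, 'v) module_scheme \<Rightarrow> ('r, 'n, 'w) module_scheme
    \<Rightarrow> (('m \<times> 'n) \<Rightarrow>\<^sub>0 int) \<Rightarrow> (('m \<times> 'n) \<Rightarrow>\<^sub>0 int) set"
  where "tensor_class R M N t = tensor_null R M N #>\<^bsub>tensor_free M N\<^esub> t"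

text \<open>
  The scalar action is induced by \<open>r(x \<otimes> y) = rx \<otimes> y\<close>. If \<open>M\<close> and \<open>N\<close> are commutative
  \<open>R\<close>-algebras, the product is induced by \<open>(x \<otimes> y)(x' \<otimes> y') = xx' \<otimes> yy'\<close>; for modules that
  are not algebras the fields \<open>mult\<close> and \<open>one\<close> of \<open>tensor R M N\<close> carry no meaning.
  As in \<open>rcoset_mult\<close>, the unions make the induced operations independent of
  representatives: all members of such a union are the same coset.
\<close>

definition tensor ::
  "('r, 'u) ring_scheme \<Rightarrow> ('r, 'm, 'v) module_scheme \<Rightarrow> ('r, 'n, 'w) module_scheme
    \<Rightarrow> ('r, (('m \<times> 'n) \<Rightarrow>\<^sub>0 int) set) module"
  where "tensor R M N =
    \<lparr>carrier = carrier (tensor_free M N Mod tensor_null R M N),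
     monoid.mult = (\<lambda>X Y. \<Union>s\<in>X. \<Union>t\<in>Y. tensor_class R M N
       (frag_extend (\<lambda>(x, y). frag_extend (\<lambda>(x', y'). frag_of (x \<otimes>\<^bsub>M\<^esub> x', y \<otimes>\<^bsub>N\<^esub> y')) t) s)),
     one = tensor_class R M N (frag_of (\<one>\<^bsub>M\<^esub>, \<one>\<^bsub>N\<^esub>)),
     zero = \<one>\<^bsub>tensor_free M N Mod tensor_null R M N\<^esub>,
     add = monoid.mult (tensor_free M N Mod tensor_null R M N),
     smult = (\<lambda>r X. \<Union>s\<in>X. tensor_class R M N
       (frag_extend (\<lambda>(x, y). frag_of (r \<odot>\<^bsub>M\<^esub> x, y)) s))\<rparr>"

definition pure_tensor ::
  "('r, 'u) ring_scheme \<Rightarrow> ('r, 'm, 'v) module_scheme \<Rightarrow> ('r, 'n, 'w) module_scheme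
    \<Rightarrow> 'm \<Rightarrow> 'n \<Rightarrow> (('m \<times> 'n) \<Rightarrow>\<^sub>0 int) set"
  where "pure_tensor R M N x y = tensor_class R M N (frag_of (x, y))"

text \<open>
  The additive map out of a tensor product with \<open>x \<otimes> y \<mapsto> \<beta> x y\<close>, for \<open>\<beta>\<close> biadditive and
  balanced: the extension of \<open>\<beta>\<close> to the free abelian group is then constant on each coset \<open>X\<close>.
\<close>

definition tensor_lift ::
  "('q, 'v) ring_scheme \<Rightarrow> ('m \<Rightarrow> 'n \<Rightarrow> 'q) \<Rightarrow> (('m \<times> 'n) \<Rightarrow>\<^sub>0 int) set \<Rightarrow> 'q"
  where "tensor_lift Q \<beta> X = the_elem
    ((\<lambda>t. \<Oplus>\<^bsub>Q\<^esub>z\<in>Poly_Mapping.keys t. [Poly_Mapping.lookup t z] \<cdot>\<^bsub>Q\<^esub> case_prod \<beta> z) ` X)"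

subsection \<open>Restriction of scalars, finiteness and purity\<close>

definition scalars_via :: "('r \<Rightarrow> 's) \<Rightarrow> ('s, 'u) ring_scheme \<Rightarrow> ('r, 's) module"
  where "scalars_via \<phi> S =
    \<lparr>carrier = carrier S, monoid.mult = (\<otimes>\<^bsub>S\<^esub>), one = \<one>\<^bsub>S\<^esub>, zero = \<zero>\<^bsub>S\<^esub>, add = (\<oplus>\<^bsub>S\<^esub>),
     smult = (\<lambda>r s. \<phi> r \<otimes>\<^bsub>S\<^esub> s)\<rparr>"

definition fin_gen_module :: "('r, 'u) ring_scheme \<Rightarrow> ('r, 'm, 'v) module_scheme \<Rightarrow> bool"
  where "fin_gen_module R M \<longleftrightarrow>
    (\<exists>X. finite X \<and> X \<subseteq> carrier M \<and>
      (\<forall>m\<in>carrier M. \<exists>c\<in>X \<rightarrow> carrier R. m = (\<Oplus>\<^bsub>M\<^esub>x\<in>X. c x \<odot>\<^bsub>M\<^esub> x)))"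

definition finite_ring_map :: "('r, 'u) ring_scheme \<Rightarrow> ('s, 'v) ring_scheme \<Rightarrow> ('r \<Rightarrow> 's) \<Rightarrow> bool"
  where "finite_ring_map R S \<phi> \<longleftrightarrow> fin_gen_module R (scalars_via \<phi> S)"

text \<open>
  Injectivity of \<open>\<phi> \<otimes> 1\<^sub>L : M \<otimes>\<^sub>R L \<rightarrow> N \<otimes>\<^sub>R L\<close> for all \<open>R\<close>-modules \<open>L\<close> with elements in \<open>'l\<close>.
\<close>

definition pure_on ::
  "'l itself \<Rightarrow> ('r, 'u) ring_scheme \<Rightarrow> ('r, 'm, 'v) module_scheme
    \<Rightarrow> ('r, 'n, 'w) module_scheme \<Rightarrow> ('m \<Rightarrow> 'n) \<Rightarrow> bool"
  where "pure_on (_ :: 'l itself) R M N \<phi> \<longleftrightarrow>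
    (\<forall>L :: ('r, 'l) module. module R L \<longrightarrow>
      inj_on (tensor_lift (tensor R N L) (\<lambda>x l. pure_tensor R N L (\<phi> x) l))
        (carrier (tensor R M L)))"

text \<open>
  Quantification over all types is not possible inside a HOL formula, so a type for \<open>L\<close> must be chosen.
  Every countably generated \<open>R\<close>-module is isomorphic to a quotient of the functions
  \<open>nat \<Rightarrow> 'r\<close> of finite support with values in \<open>carrier R\<close>, and the elements of such a quotient,
  being cosets, lie in \<open>(nat \<Rightarrow> 'r) set\<close>. This loses nothing: an element of the kernel of
  \<open>M \<otimes> L \<rightarrow> N \<otimes> L\<close> comes from the kernel of \<open>M \<otimes> L' \<rightarrow> N \<otimes> L'\<close> for some finitely generated
  submodule \<open>L'\<close> of \<open>L\<close>, so purity for modules in this type is purity for all \<open>R\<close>-modules.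
\<close>

definition pure_map ::
  "('r, 'u) ring_scheme \<Rightarrow> ('r, 'm, 'v) module_scheme
    \<Rightarrow> ('r, 'n, 'w) module_scheme \<Rightarrow> ('m \<Rightarrow> 'n) \<Rightarrow> bool"
  where "pure_map (R :: ('r, 'u) ring_scheme) M N \<phi> \<longleftrightarrow>
    pure_on TYPE((nat \<Rightarrow> 'r) set) R M N \<phi>"

subsection \<open>Relative Frobenius\<close>

text \<open>An \<open>F\<^sub>p\<close>-algebra structure on a ring is unique, so every ring map preserves it.\<close>

definition Fp_algebra :: "nat \<Rightarrow> ('a, 'u) ring_scheme \<Rightarrow> bool"
  where "Fp_algebra p A \<longleftrightarrow> cring A \<and> (\<exists>h. h \<in> ring_hom (ZFact (int p)) A)"

text \<open>
  \<open>frob_tensor p e A B f\<close> is \<open>B\<^sup>(\<^sup>e\<^sup>) \<otimes> A\<close> over \<open>A\<^sup>(\<^sup>e\<^sup>)\<close>. The copies \<open>A\<^sup>(\<^sup>e\<^sup>)\<close> and \<open>B\<^sup>(\<^sup>e\<^sup>)\<close> are \<open>A\<close> and \<open>B\<close>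
  themselves; only the base ring's action on the second factor, through the iterated
  Frobenius, depends on \<open>e\<close>.
\<close>

definition frob_factor :: "nat \<Rightarrow> nat \<Rightarrow> ('a, 'u) ring_scheme \<Rightarrow> ('a, 'a) module"
  where "frob_factor p e A = scalars_via (\<lambda>a. a [^]\<^bsub>A\<^esub> (p ^ e)) A"

definition frob_tensor ::
  "nat \<Rightarrow> nat \<Rightarrow> ('a, 'u) ring_scheme \<Rightarrow> ('b, 'v) ring_scheme \<Rightarrow> ('a \<Rightarrow> 'b)
    \<Rightarrow> ('a, (('b \<times> 'a) \<Rightarrow>\<^sub>0 int) set) module"
  where "frob_tensor p e A B f = tensor A (scalars_via f B) (frob_factor p e A)"

definition rel_frob ::
  "nat \<Rightarrow> nat \<Rightarrow> ('a, 'u) ring_scheme \<Rightarrow> ('b, 'v) ring_scheme \<Rightarrow> ('a \<Rightarrow> 'b)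
    \<Rightarrow> (('b \<times> 'a) \<Rightarrow>\<^sub>0 int) set \<Rightarrow> 'b"
  where "rel_frob p e A B f = tensor_lift B (\<lambda>b a. b [^]\<^bsub>B\<^esub> (p ^ e) \<otimes>\<^bsub>B\<^esub> f a)"

definition F_finite ::
  "nat \<Rightarrow> ('a, 'u) ring_scheme \<Rightarrow> ('b, 'v) ring_scheme \<Rightarrow> ('a \<Rightarrow> 'b) \<Rightarrow> bool"
  where "F_finite p A B f \<longleftrightarrow> finite_ring_map (frob_tensor p 1 A B f) B (rel_frob p 1 A B f)"

text \<open>
  The \<open>A\<close>-module structure on \<open>B\<^sup>(\<^sup>e\<^sup>) \<otimes> A\<close> is the one through \<open>a \<mapsto> 1 \<otimes> a\<close>, not the \<open>smult\<close> of
  \<open>frob_tensor\<close>, which is the action of the base ring \<open>A\<^sup>(\<^sup>e\<^sup>)\<close>.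
\<close>

definition Dumitrescu ::
  "nat \<Rightarrow> nat \<Rightarrow> ('a, 'u) ring_scheme \<Rightarrow> ('b, 'v) ring_scheme \<Rightarrow> ('a \<Rightarrow> 'b) \<Rightarrow> bool"
  where "Dumitrescu p e A B f \<longleftrightarrow>
    pure_map A
      (scalars_via (\<lambda>a. pure_tensor A (scalars_via f B) (frob_factor p e A) \<one>\<^bsub>B\<^esub> a)
        (frob_tensor p e A B f))
      (scalars_via f B)
      (rel_frob p e A B f)"

subsection \<open>Spectra\<close>

definition Spec :: "('a, 'u) ring_scheme \<Rightarrow> 'a set set"
  where "Spec R = {P. primeideal P R}"

definition Max_spec :: "('a, 'u) ring_scheme \<Rightarrow> 'a set set"
  where "Max_spec R = {P. maximalideal P R}"

definition Spec_map :: "('a, 'u) ring_scheme \<Rightarrow> ('a \<Rightarrow> 'b) \<Rightarrow> 'b set \<Rightarrow> 'a set"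
  where "Spec_map R g Q = {r \<in> carrier R. g r \<in> Q}"

end

theory Submission
  imports Defs
begin

text \<open>
  Put \<open>q = p\<^sup>e\<close>. The image of \<open>\<Phi>\<^sub>e(A, C)\<close> is the subring \<open>C\<^sup>q[A]\<close> of \<open>C\<close> generated by the \<open>q\<close>-th powers and
  the image of \<open>A\<close>, and \<open>F\<close>-finiteness says that \<open>C\<close> is a finitely generated module over \<open>C\<^sup>p[A]\<close>.
  Substituting such a representation into itself shows that \<open>C\<close> is finitely generated over
  \<open>C\<^sup>q[A]\<close> as well (\<open>frob_span_iterate\<close>), that is, over the Noetherian ring
  \<open>T = C\<^sup>(\<^sup>e\<^sup>) \<otimes> A\<close>. Its \<open>T\<close>-submodule \<open>C\<^sup>q[B]\<close>, the image of \<open>C\<^sup>(\<^sup>e\<^sup>) \<otimes> B\<close>, is therefore finitely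
  generated (\<open>submodule_finitely_generated\<close>), and its generators may be taken of the form \<open>g(z)\<close> with
  \<open>z\<close> in a finite set \<open>Z \<subseteq> B\<close>.

  Let \<open>N \<subseteq> B\<close> be the \<open>B\<^sup>q[A]\<close>-module generated by \<open>Z\<close>. For \<open>b \<in> B\<close>, expanding \<open>g(b)\<close> in the generators
  \<open>g(z)\<close> gives \<open>g(b) = \<Sum> c\<^sub>i\<^sup>q g(n\<^sub>i)\<close> with \<open>n\<^sub>i \<in> N\<close>. Purity of \<open>\<Phi>\<^sub>e(B, C)\<close> contains its injectivity, so
  \<open>1 \<otimes> b = \<Sum> c\<^sub>i \<otimes> n\<^sub>i\<close> already in \<open>C\<^sup>(\<^sup>e\<^sup>) \<otimes> B\<close>, the tensor product being over \<open>B\<^sup>(\<^sup>e\<^sup>)\<close>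
  (\<open>Dumitrescu_null_if_eval_zero\<close>). Hence \<open>1 \<otimes> b\<close> vanishes in \<open>C\<^sup>(\<^sup>e\<^sup>) \<otimes> B/N\<close>. If \<open>g\<close> is pure, then this
  forces \<open>b \<in> N\<close>. So \<open>B = N\<close> is finitely generated over \<open>B\<^sup>q[A]\<close>, and all the more over the larger
  ring \<open>B\<^sup>p[A]\<close>.

  It remains to see that \<open>g\<close> is pure (\<open>mem_submodule_if_tensor\<close>). Let \<open>x \<noteq> 0\<close> be an element of a
  \<open>B\<close>-module. Dividing by a submodule that is maximal among those without \<open>x\<close>, one may assume that
  every nonzero submodule contains \<open>x\<close>. Then the annihilator \<open>m\<close> of \<open>x\<close> is a maximal ideal, and as
  \<open>B\<close> is Noetherian, every element of the module is killed by a power of each \<open>t \<in> m\<close>; the module is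
  thus the union of the submodules killed by all \<open>t ^ (q ^ j)\<close> with \<open>t \<in> m\<close>, for \<open>j = 0, 1, \<dots>\<close>.
  A relation \<open>1 \<otimes> x = 0\<close> involves finitely many elements and so holds over one of these submodules, \<open>L\<close>.
  Tensoring \<open>\<Phi>\<^sub>e(B, C)\<close> with \<open>L\<close> and using purity, one finds that \<open>1 \<otimes> x = 0\<close> also holds over
  the module \<open>L\<close> on which \<open>r \<in> B\<close> acts as \<open>r\<^sup>q\<close> (\<open>Dumitrescu_reflects_null\<close>). This module is killed
  by all \<open>t ^ (q ^ (j - 1))\<close>, so after \<open>j\<close> steps \<open>x\<close> is a vector over the field \<open>B/m\<close>, and there
  \<open>1 \<otimes> x \<noteq> 0\<close> because \<open>m\<close> is the contraction of a prime ideal of \<open>C\<close>.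

  Tensors are handled as elements of a free abelian group modulo the subgroup
  \<^const>\<open>tensor_null\<close>, so that a statement about a tensor product becomes one about membership in
  that subgroup.
\<close>

section \<open>The Frobenius endomorphism\<close>

lemma (in cring) binomial_expansion:
  assumes x: "x \<in> carrier R" and y: "y \<in> carrier R"
  shows "(x \<oplus> y) [^] (n :: nat) = (\<Oplus>k\<in>{..n}. [(n choose k)] \<cdot> (x [^] k \<otimes> y [^] (n - k)))"
proof (induction n)
  case 0
  then show ?case using x y by simp
next
  case (Suc n)
  define T where "T n k = [(n choose k)] \<cdot> (x [^] k \<otimes> y [^] (n - k))" for n k
  have T [simp]: "T n k \<in> carrier R" for n k
    using x y by (simp add: T_def)
  have T0: "T (Suc n) 0 = y \<otimes> T n 0"
    using x y by (simp add: T_def m_comm)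
  have TS: "T (Suc n) (Suc k) = x \<otimes> T n k \<oplus> y \<otimes> T n (Suc k)" if "k \<in> {..n}" for k
  proof -
    have 1: "x \<otimes> T n k = [(n choose k)] \<cdot> (x [^] Suc k \<otimes> y [^] (n - k))"
      using x y by (simp add: T_def add_pow_rdistr m_ac)
    have 2: "y \<otimes> T n (Suc k) = [(n choose Suc k)] \<cdot> (x [^] Suc k \<otimes> y [^] (n - k))"
    proof (cases "k = n")
      case False
      with that have "n - k = Suc (n - Suc k)"
        by simp
      then show ?thesis
        using x y by (simp add: T_def add_pow_rdistr m_ac)
    qed (use x y in \<open>simp add: T_def binomial_eq_0\<close>)
    have "T (Suc n) (Suc k) = [((n choose k) + (n choose Suc k))] \<cdot> (x [^] Suc k \<otimes> y [^] (n - k))"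
      by (simp only: T_def binomial_Suc_Suc diff_Suc_Suc)
    also have "\<dots> = x \<otimes> T n k \<oplus> y \<otimes> T n (Suc k)"
      unfolding 1 2 by (subst add.nat_pow_mult[symmetric]) (use x y in simp_all)
    finally show ?thesis .
  qed
  have "(\<Oplus>k\<in>{..Suc n}. T (Suc n) k) = (\<Oplus>k\<in>{..n}. T (Suc n) (Suc k)) \<oplus> T (Suc n) 0"
    by (subst finsum_Suc2) auto
  also have "(\<Oplus>k\<in>{..n}. T (Suc n) (Suc k)) = (\<Oplus>k\<in>{..n}. x \<otimes> T n k \<oplus> y \<otimes> T n (Suc k))"
    by (rule finsum_cong') (use x y TS in auto)
  also have "\<dots> = x \<otimes> (\<Oplus>k\<in>{..n}. T n k) \<oplus> y \<otimes> (\<Oplus>k\<in>{..n}. T n (Suc k))"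
    using x y by (simp add: finsum_addf finsum_rdistr Pi_def)
  also have "\<dots> \<oplus> T (Suc n) 0
      = x \<otimes> (\<Oplus>k\<in>{..n}. T n k) \<oplus> y \<otimes> ((\<Oplus>k\<in>{..n}. T n (Suc k)) \<oplus> T n 0)"
    using x y by (simp add: T0 r_distr a_assoc)
  also have "(\<Oplus>k\<in>{..n}. T n (Suc k)) \<oplus> T n 0 = (\<Oplus>k\<in>{..Suc n}. T n k)"
    by (subst finsum_Suc2) auto
  also have "\<dots> = (\<Oplus>k\<in>{..n}. T n k)"
  proof -
    have "T n (Suc n) = \<zero>"
      using x y by (simp add: T_def binomial_eq_0)
    then show ?thesis by (subst finsum_Suc) auto
  qed
  finally have "(\<Oplus>k\<in>{..Suc n}. T (Suc n) k) = (x \<oplus> y) \<otimes> (\<Oplus>k\<in>{..n}. T n k)"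
    using x y by (simp add: l_distr)
  with Suc show ?case
    using x y by (simp add: T_def m_comm)
qed

text \<open>
The structure map composed with \<open>\<int> \<rightarrow> \<int>/p\<close> is a ring map \<open>\<int> \<rightarrow> A\<close>; it sends \<open>p\<close> both to \<open>p \<cdot> 1\<close>
and to \<open>0\<close>.
\<close>

lemma Fp_algebra_char:
  fixes A (structure)
  assumes "Fp_algebra p A"
  shows "[p] \<cdot> \<one> = \<zero>"
proof -
  from assms obtain h where A: "cring A" and h: "h \<in> ring_hom (ZFact (int p)) A"
    by (auto simp: Fp_algebra_def)
  interpret A: cring A by fact
  interpret I: ideal "Idl\<^bsub>\<Z>\<^esub> {int p}" \<Z>
    by (rule int.genideal_ideal) simp
  define k where "k n = h ((Idl\<^bsub>\<Z>\<^esub> {int p}) +>\<^bsub>\<Z>\<^esub> n)" for n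
  have k: "k \<in> ring_hom \<Z> A"
    using ring_hom_trans[OF I.rcos_ring_hom] h by (simp add: ZFact_def k_def[abs_def] comp_def)
  have kn: "k (int n) = [n] \<cdot> \<one>" for n
  proof (induction n)
    case 0
    then show ?case
      using ring_hom_zero[OF k] int.ring_axioms A.ring_axioms by simp
  next
    case (Suc n)
    have "k (int n \<oplus>\<^bsub>\<Z>\<^esub> 1) = k (int n) \<oplus> k 1"
      using k by (intro ring_hom_add) auto
    moreover have "k 1 = \<one>"
      using ring_hom_one[OF k] by simp
    ultimately show ?case
      using Suc by (simp add: ac_simps)
  qed
  have "k (int p) = k 0"
    using I.a_rcos_const[of "int p"] I.a_rcos_const[of 0] int.genideal_self'[of "int p"] I.zero_closed
    by (simp add: k_def)
  then show ?thesis
    using kn[of p] kn[of 0] by simp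
qed

text \<open>
The inner binomial coefficients \<open>p choose k\<close> are divisible by \<open>p\<close>, which handles \<open>e = 1\<close>; the general
case iterates this.
\<close>

lemma frobenius_add:
  fixes A (structure)
  assumes p: "Factorial_Ring.prime p" and A: "Fp_algebra p A"
    and x: "x \<in> carrier A" and y: "y \<in> carrier A"
  shows "(x \<oplus> y) [^] (p ^ e) = x [^] (p ^ e) \<oplus> y [^] (p ^ e)"
proof -
  interpret cring A using A by (simp add: Fp_algebra_def)
  have zero: "[p] \<cdot> z = \<zero>" if z: "z \<in> carrier A" for z
    using add_pow_ldistr[of \<one> z p] z by (simp add: Fp_algebra_char[OF A])
  have one: "(x \<oplus> y) [^] p = x [^] p \<oplus> y [^] p"
    if x: "x \<in> carrier A" and y: "y \<in> carrier A" for x y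
  proof -
    let ?t = "\<lambda>k. [(p choose k)] \<cdot> (x [^] k \<otimes> y [^] (p - k))"
    have p0: "p > 0" using p prime_gt_0_nat by blast
    have mid: "?t k = \<zero>" if k: "k \<in> {..p} - {0, p}" for k
    proof -
      have "p dvd (p choose k)"
        using k p by (intro dvd_choose_prime) auto
      then obtain d where "p choose k = p * d" ..
      moreover have "[(p * d)] \<cdot> (x [^] k \<otimes> y [^] (p - k)) = [d] \<cdot> ([p] \<cdot> (x [^] k \<otimes> y [^] (p - k)))"
        using x y by (simp add: add.nat_pow_pow mult.commute)
      ultimately show ?thesis
        using x y by (simp add: zero)
    qed
    have "(x \<oplus> y) [^] p = (\<Oplus>k\<in>{..p}. ?t k)"
      using x y by (rule binomial_expansion)
    also have "\<dots> = (\<Oplus>k\<in>{0, p}. ?t k)"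
      by (rule add.finprod_mono_neutral_cong_right) (use x y mid in auto)
    also have "\<dots> = x [^] p \<oplus> y [^] p"
      using x y p0 by (simp add: a_comm)
    finally show ?thesis .
  qed
  show ?thesis
  proof (induction e)
    case 0
    then show ?case using x y by simp
  next
    case (Suc e)
    have "(x \<oplus> y) [^] (p ^ Suc e) = ((x \<oplus> y) [^] (p ^ e)) [^] p"
      using x y by (simp add: nat_pow_pow mult.commute)
    also have "\<dots> = x [^] (p ^ Suc e) \<oplus> y [^] (p ^ Suc e)"
      unfolding Suc by (subst one) (use x y in \<open>simp_all add: nat_pow_pow mult.commute\<close>)
    finally show ?case .
  qed
qed

lemma frobenius_ring_hom:
  fixes A (structure)
  assumes p: "Factorial_Ring.prime p" and A: "Fp_algebra p A"
  shows "(\<lambda>x. x [^] (p ^ e)) \<in> ring_hom A A"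
proof -
  interpret cring A using A by (simp add: Fp_algebra_def)
  show ?thesis
    by (rule ring_hom_memI) (auto simp: nat_pow_distrib frobenius_add[OF p A])
qed

section \<open>Tensor products modulo null tensors\<close>

lemma frag_extend_pointwise_diff:
  fixes f g :: "'z \<Rightarrow> 'b \<Rightarrow>\<^sub>0 int"
  shows "frag_extend (\<lambda>z. f z - g z) t = frag_extend f t - frag_extend g t"
proof -
  have "frag_cmul k (a - b) = frag_cmul k a - frag_cmul k b" for k and a b :: "'b \<Rightarrow>\<^sub>0 int"
    using frag_cmul_distrib2[of k "a - b" b] by (simp add: algebra_simps)
  then show ?thesis
    by (simp add: frag_extend_def sum_subtractf)
qed

lemma frag_extend_extend:
  "frag_extend f (frag_extend g t) = frag_extend (\<lambda>z. frag_extend f (g z)) t"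
  by (rule frag_induction[of t UNIV]) (auto simp: frag_extend_diff)

lemma keys_frag_extend_subset:
  assumes "Poly_Mapping.keys t \<subseteq> S" and "\<And>z. z \<in> S \<Longrightarrow> Poly_Mapping.keys (h z) \<subseteq> T"
  shows "Poly_Mapping.keys (frag_extend h t) \<subseteq> T"
  using keys_frag_extend[of h t] assms by blast

lemma tensor_relations_in_free:
  assumes "module R M" and "module R N" and "t \<in> tensor_relations R M N"
  shows "Poly_Mapping.keys t \<subseteq> carrier M \<times> carrier N"
proof -
  interpret M: module R M by fact
  interpret N: module R N by fact
  show ?thesis
    using assms(3) unfolding tensor_relations_def
    by (fastforce dest!: subsetD[OF keys_diff] split: if_splits)
qed

context
  fixes R :: "('r, 'u) ring_scheme" and M :: "('r, 'm, 'v) module_scheme"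
    and N :: "('r, 'n, 'w) module_scheme"
  assumes M: "module R M" and N: "module R N"
begin

abbreviation (input) "free_keys t \<equiv> Poly_Mapping.keys t \<subseteq> carrier M \<times> carrier N"

interpretation M: module R M by (rule M)
interpretation N: module R N by (rule N)
interpretation F: comm_group "tensor_free M N" by (rule abelian_free_Abelian_group)

lemma tensor_null_subgroup: "subgroup (tensor_null R M N) (tensor_free M N)"
  unfolding tensor_null_def
  by (rule F.generate_is_subgroup) (use tensor_relations_in_free[OF M N] in auto)

lemma tensor_null_in_free:
  "t \<in> tensor_null R M N \<Longrightarrow> free_keys t"
  using subsetD[OF subgroup.subset[OF tensor_null_subgroup]] by (simp only: carrier_free_Abelian_group_iff)

lemma tensor_null_0: "0 \<in> tensor_null R M N"
  using subgroup.one_closed[OF tensor_null_subgroup] by simp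

lemma tensor_null_add: "s \<in> tensor_null R M N \<Longrightarrow> t \<in> tensor_null R M N \<Longrightarrow> s + t \<in> tensor_null R M N"
  using subgroup.m_closed[OF tensor_null_subgroup] by simp

lemma tensor_null_uminus: "t \<in> tensor_null R M N \<Longrightarrow> - t \<in> tensor_null R M N"
  using subgroup.m_inv_closed[OF tensor_null_subgroup, of t] by (simp add: tensor_null_in_free)

lemma tensor_null_diff: "s \<in> tensor_null R M N \<Longrightarrow> t \<in> tensor_null R M N \<Longrightarrow> s - t \<in> tensor_null R M N"
  using tensor_null_add[OF _ tensor_null_uminus] by simp

text \<open>
The induction principle behind all maps out of a tensor product: differences alone suffice,
since \<open>a + b = a - (0 - b)\<close>.
\<close>

lemma tensor_null_least:
  assumes "t \<in> tensor_null R M N" and "0 \<in> K" and "\<And>a b. a \<in> K \<Longrightarrow> b \<in> K \<Longrightarrow> a - b \<in> K"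
    and "tensor_relations R M N \<subseteq> K"
  shows "t \<in> K"
proof -
  have minus: "- a \<in> K" if "a \<in> K" for a
    using assms(3)[OF assms(2) that] by simp
  show ?thesis
    using assms(1) unfolding tensor_null_def
  proof (induction rule: generate.induct)
    case one
    then show ?case using assms(2) by simp
  next
    case (incl h)
    then show ?case using assms(4) by blast
  next
    case (inv h)
    then show ?case
      using minus assms(4) tensor_relations_in_free[OF M N, of h] by auto
  next
    case (eng a b)
    then show ?case
      using assms(3)[OF eng.IH(1) minus[OF eng.IH(2)]] by simp
  qed
qed

lemma tensor_null_add_left:
  "x \<in> carrier M \<Longrightarrow> x' \<in> carrier M \<Longrightarrow> y \<in> carrier N \<Longrightarrow>
    frag_of (x \<oplus>\<^bsub>M\<^esub> x', y) - frag_of (x, y) - frag_of (x', y) \<in> tensor_null R M N"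
  unfolding tensor_null_def by (rule generate.incl) (auto simp: tensor_relations_def)

lemma tensor_null_add_right:
  "x \<in> carrier M \<Longrightarrow> y \<in> carrier N \<Longrightarrow> y' \<in> carrier N \<Longrightarrow>
    frag_of (x, y \<oplus>\<^bsub>N\<^esub> y') - frag_of (x, y) - frag_of (x, y') \<in> tensor_null R M N"
  unfolding tensor_null_def by (rule generate.incl) (auto simp: tensor_relations_def)

lemma tensor_null_smult:
  "r \<in> carrier R \<Longrightarrow> x \<in> carrier M \<Longrightarrow> y \<in> carrier N \<Longrightarrow>
    frag_of (r \<odot>\<^bsub>M\<^esub> x, y) - frag_of (x, r \<odot>\<^bsub>N\<^esub> y) \<in> tensor_null R M N"
  unfolding tensor_null_def by (rule generate.incl) (auto simp: tensor_relations_def)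

lemma tensor_null_zero_right:
  assumes "x \<in> carrier M"
  shows "frag_of (x, \<zero>\<^bsub>N\<^esub>) \<in> tensor_null R M N"
  using tensor_null_uminus[OF tensor_null_add_right[of x "\<zero>\<^bsub>N\<^esub>" "\<zero>\<^bsub>N\<^esub>"]] assms by simp

text \<open>
A map given on pure tensors descends to the quotient by \<open>K\<close> as soon as it respects the three
defining relations modulo \<open>K\<close>.
\<close>

lemma tensor_null_extend:
  assumes t: "t \<in> tensor_null R M N"
    and K0: "0 \<in> K" and Kd: "\<And>a b. a \<in> K \<Longrightarrow> b \<in> K \<Longrightarrow> a - b \<in> K"
    and "\<And>x x' y. x \<in> carrier M \<Longrightarrow> x' \<in> carrier M \<Longrightarrow> y \<in> carrier N \<Longrightarrow>
      h (x \<oplus>\<^bsub>M\<^esub> x', y) - h (x, y) - h (x', y) \<in> K"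
    and "\<And>x y y'. x \<in> carrier M \<Longrightarrow> y \<in> carrier N \<Longrightarrow> y' \<in> carrier N \<Longrightarrow>
      h (x, y \<oplus>\<^bsub>N\<^esub> y') - h (x, y) - h (x, y') \<in> K"
    and "\<And>r x y. r \<in> carrier R \<Longrightarrow> x \<in> carrier M \<Longrightarrow> y \<in> carrier N \<Longrightarrow>
      h (r \<odot>\<^bsub>M\<^esub> x, y) - h (x, r \<odot>\<^bsub>N\<^esub> y) \<in> K"
  shows "frag_extend h t \<in> K"
proof -
  have "t \<in> {t. frag_extend h t \<in> K}"
    by (rule tensor_null_least[OF t])
       (use assms in \<open>auto simp: frag_extend_diff tensor_relations_def\<close>)
  then show ?thesis by simp
qed

lemma tensor_class_eq_iff:
  assumes "free_keys s" "free_keys t"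
  shows "tensor_class R M N s = tensor_class R M N t \<longleftrightarrow> s - t \<in> tensor_null R M N"
proof -
  have *: "tensor_class R M N u = {n + u | n. n \<in> tensor_null R M N}" for u
    by (auto simp: tensor_class_def r_coset_def)
  show ?thesis
  proof
    assume "tensor_class R M N s = tensor_class R M N t"
    moreover have "s \<in> tensor_class R M N s"
      unfolding * using tensor_null_0 by force
    ultimately show "s - t \<in> tensor_null R M N"
      unfolding * by auto
  next
    assume st: "s - t \<in> tensor_null R M N"
    have "n + s = (n + (s - t)) + t" "n + t = (n - (s - t)) + s" for n
      by simp_all
    then show "tensor_class R M N s = tensor_class R M N t"
      unfolding * using tensor_null_add[OF _ st] tensor_null_diff[OF _ st] by blast
  qed
qed

lemma mem_tensor_class:
  "s \<in> tensor_class R M N t \<longleftrightarrow> s - t \<in> tensor_null R M N"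
proof -
  have "s \<in> tensor_class R M N t \<longleftrightarrow> (\<exists>n\<in>tensor_null R M N. s = n + t)"
    by (auto simp: tensor_class_def r_coset_def)
  also have "\<dots> \<longleftrightarrow> s - t \<in> tensor_null R M N"
    by (metis add_diff_cancel_right' diff_add_cancel)
  finally show ?thesis .
qed

lemma carrier_tensor:
  "carrier (tensor R M N) = tensor_class R M N ` {t. free_keys t}"
proof -
  have "carrier (tensor_free M N) = {t. free_keys t}"
    by (simp add: free_Abelian_group_def)
  then show ?thesis
    by (simp add: tensor_def carrier_FactGroup tensor_class_def[abs_def])
qed

lemma tensor_class_closed:
  "free_keys t \<Longrightarrow> tensor_class R M N t \<in> carrier (tensor R M N)"
  by (simp add: carrier_tensor)

lemma tensor_carrierE:
  assumes "X \<in> carrier (tensor R M N)"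
  obtains t where "free_keys t" "X = tensor_class R M N t"
  using assms by (auto simp: carrier_tensor)

lemma tensor_class_rep:
  assumes "free_keys t" "s \<in> tensor_class R M N t"
  shows "free_keys s" "tensor_class R M N s = tensor_class R M N t"
proof -
  have st: "s - t \<in> tensor_null R M N"
    using assms(2) by (simp add: mem_tensor_class)
  have "s = (s - t) + t" by simp
  then show keys: "free_keys s"
    using tensor_null_in_free[OF st] assms(1) keys_add[of "s - t" t] by auto
  show "tensor_class R M N s = tensor_class R M N t"
    using st keys assms(1) by (simp add: tensor_class_eq_iff)
qed

interpretation Q: normal "tensor_null R M N" "tensor_free M N"
  by (rule F.subgroup_imp_normal[OF tensor_null_subgroup])

lemma tensor_add:
  assumes "free_keys s" "free_keys t"
  shows "tensor_class R M N s \<oplus>\<^bsub>tensor R M N\<^esub> tensor_class R M N t = tensor_class R M N (s + t)"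
  using Q.rcos_sum[of s t] assms by (simp add: tensor_def tensor_class_def)

lemma tensor_zero: "\<zero>\<^bsub>tensor R M N\<^esub> = tensor_class R M N 0"
  using F.coset_mult_one[OF subgroup.subset[OF tensor_null_subgroup]]
  by (simp add: tensor_def tensor_class_def)

lemma tensor_abelian_group: "abelian_group (tensor R M N)"
proof -
  interpret Q: comm_group "tensor_free M N Mod tensor_null R M N"
    by (rule F.abelian_FactGroup[OF tensor_null_subgroup])
  have [simp]: "carrier (tensor R M N) = carrier (tensor_free M N Mod tensor_null R M N)"
    "\<zero>\<^bsub>tensor R M N\<^esub> = \<one>\<^bsub>tensor_free M N Mod tensor_null R M N\<^esub>"
    "x \<oplus>\<^bsub>tensor R M N\<^esub> y = x \<otimes>\<^bsub>tensor_free M N Mod tensor_null R M N\<^esub> y" for x y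
    by (simp_all add: tensor_def)
  show ?thesis
    by (rule abelian_groupI)
       (use Q.l_inv_ex in \<open>auto simp del: one_FactGroup mult_FactGroup simp: Q.m_assoc Q.m_comm Q.m_lcomm\<close>)
qed

end

text \<open>
  The homomorphism out of a free abelian group with prescribed values, in the form in which it
  occurs in \<^const>\<open>tensor_lift\<close>.
\<close>

definition frag_eval :: "('q, 'v) ring_scheme \<Rightarrow> ('z \<Rightarrow> 'q) \<Rightarrow> ('z \<Rightarrow>\<^sub>0 int) \<Rightarrow> 'q"
  where "frag_eval Q h t =
    (\<Oplus>\<^bsub>Q\<^esub>z\<in>Poly_Mapping.keys t. [Poly_Mapping.lookup t z] \<cdot>\<^bsub>Q\<^esub> h z)"

context abelian_group
begin

context
  fixes h :: "'z \<Rightarrow> 'a" and S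
  assumes h: "\<And>z. z \<in> S \<Longrightarrow> h z \<in> carrier G"
begin

lemma frag_eval_superset:
  assumes "Poly_Mapping.keys t \<subseteq> I" "I \<subseteq> S" "finite I"
  shows "frag_eval G h t = (\<Oplus>z\<in>I. [Poly_Mapping.lookup t z] \<cdot> h z)"
  unfolding frag_eval_def
  by (rule add.finprod_mono_neutral_cong_left)
     (use assms h in \<open>auto simp: in_keys_iff add_pow_int_ge intro!: add.int_pow_closed\<close>)

lemma frag_eval_closed [simp]:
  assumes "Poly_Mapping.keys t \<subseteq> S"
  shows "frag_eval G h t \<in> carrier G"
  unfolding frag_eval_def by (rule finsum_closed) (use assms h in auto)

lemma frag_eval_0: "frag_eval G h 0 = \<zero>"
  by (simp add: frag_eval_def)

lemma frag_eval_of: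
  assumes "z \<in> S"
  shows "frag_eval G h (frag_of z) = h z"
  using h[OF assms] by (simp add: frag_eval_def keys_frag_of)

lemma frag_eval_add:
  assumes "Poly_Mapping.keys s \<subseteq> S" "Poly_Mapping.keys t \<subseteq> S"
  shows "frag_eval G h (s + t) = frag_eval G h s \<oplus> frag_eval G h t"
proof -
  define I where "I = Poly_Mapping.keys s \<union> Poly_Mapping.keys t"
  have I: "finite I" "I \<subseteq> S" "Poly_Mapping.keys s \<subseteq> I" "Poly_Mapping.keys t \<subseteq> I"
    "Poly_Mapping.keys (s + t) \<subseteq> I"
    using assms keys_add[of s t] by (auto simp: I_def)
  have hI: "\<And>z. z \<in> I \<Longrightarrow> h z \<in> carrier G"
    using h I by blast
  have "frag_eval G h (s + t)
      = (\<Oplus>z\<in>I. [Poly_Mapping.lookup s z] \<cdot> h z \<oplus> [Poly_Mapping.lookup t z] \<cdot> h z)"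
    unfolding frag_eval_superset[OF I(5,2,1)]
    by (rule finsum_cong') (use hI in \<open>auto simp: lookup_add add.int_pow_mult\<close>)
  also have "\<dots> = frag_eval G h s \<oplus> frag_eval G h t"
    using I hI by (simp add: frag_eval_superset[of _ I] finsum_addf Pi_def)
  finally show ?thesis .
qed

lemma frag_eval_diff:
  assumes "Poly_Mapping.keys s \<subseteq> S" "Poly_Mapping.keys t \<subseteq> S"
  shows "frag_eval G h (s - t) = frag_eval G h s \<ominus> frag_eval G h t"
proof -
  have st: "Poly_Mapping.keys (s - t) \<subseteq> S"
    using assms keys_diff[of s t] by auto
  have "frag_eval G h s = frag_eval G h (s - t) \<oplus> frag_eval G h t"
    using frag_eval_add[OF st assms(2)] by simp
  then show ?thesis
    using st assms by (simp add: a_minus_def a_assoc r_neg)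
qed

end

end

definition balanced_map ::
  "('r, 'u) ring_scheme \<Rightarrow> ('r, 'm, 'v) module_scheme \<Rightarrow> ('r, 'n, 'w) module_scheme
    \<Rightarrow> ('q, 'x) ring_scheme \<Rightarrow> ('m \<Rightarrow> 'n \<Rightarrow> 'q) \<Rightarrow> bool"
  where "balanced_map R M N Q \<beta> \<longleftrightarrow>
    (\<forall>x\<in>carrier M. \<forall>y\<in>carrier N. \<beta> x y \<in> carrier Q) \<and>
    (\<forall>x\<in>carrier M. \<forall>x'\<in>carrier M. \<forall>y\<in>carrier N. \<beta> (x \<oplus>\<^bsub>M\<^esub> x') y = \<beta> x y \<oplus>\<^bsub>Q\<^esub> \<beta> x' y) \<and>
    (\<forall>x\<in>carrier M. \<forall>y\<in>carrier N. \<forall>y'\<in>carrier N. \<beta> x (y \<oplus>\<^bsub>N\<^esub> y') = \<beta> x y \<oplus>\<^bsub>Q\<^esub> \<beta> x y') \<and>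
    (\<forall>r\<in>carrier R. \<forall>x\<in>carrier M. \<forall>y\<in>carrier N. \<beta> (r \<odot>\<^bsub>M\<^esub> x) y = \<beta> x (r \<odot>\<^bsub>N\<^esub> y))"

text \<open>
Evaluation into \<open>Q/P\<close> without forming the quotient group: a map that respects the defining relations
modulo \<open>P\<close> sends every null tensor into \<open>P\<close>.
\<close>

lemma tensor_null_eval:
  assumes M: "module R M" and N: "module R N" and Q: "abelian_group Q"
    and h: "\<And>z. z \<in> carrier M \<times> carrier N \<Longrightarrow> h z \<in> carrier Q"
    and P0: "\<zero>\<^bsub>Q\<^esub> \<in> P" and Pd: "\<And>u v. u \<in> P \<Longrightarrow> v \<in> P \<Longrightarrow> u \<ominus>\<^bsub>Q\<^esub> v \<in> P"
    and left: "\<And>x x' y. x \<in> carrier M \<Longrightarrow> x' \<in> carrier M \<Longrightarrow> y \<in> carrier N \<Longrightarrow>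
      h (x \<oplus>\<^bsub>M\<^esub> x', y) \<ominus>\<^bsub>Q\<^esub> h (x, y) \<ominus>\<^bsub>Q\<^esub> h (x', y) \<in> P"
    and right: "\<And>x y y'. x \<in> carrier M \<Longrightarrow> y \<in> carrier N \<Longrightarrow> y' \<in> carrier N \<Longrightarrow>
      h (x, y \<oplus>\<^bsub>N\<^esub> y') \<ominus>\<^bsub>Q\<^esub> h (x, y) \<ominus>\<^bsub>Q\<^esub> h (x, y') \<in> P"
    and bal: "\<And>r x y. r \<in> carrier R \<Longrightarrow> x \<in> carrier M \<Longrightarrow> y \<in> carrier N \<Longrightarrow>
      h (r \<odot>\<^bsub>M\<^esub> x, y) \<ominus>\<^bsub>Q\<^esub> h (x, r \<odot>\<^bsub>N\<^esub> y) \<in> P"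
    and t: "t \<in> tensor_null R M N"
  shows "frag_eval Q h t \<in> P"
proof -
  interpret M: module R M by fact
  interpret N: module R N by fact
  interpret Q: abelian_group Q by fact
  let ?S = "carrier M \<times> carrier N"
  note eval = Q.frag_eval_diff[where S = ?S, OF h] Q.frag_eval_of[where S = ?S, OF h]
  have aux: "frag_eval Q h (frag_of a - frag_of b - frag_of c) = h a \<ominus>\<^bsub>Q\<^esub> h b \<ominus>\<^bsub>Q\<^esub> h c"
    if "a \<in> ?S" "b \<in> ?S" "c \<in> ?S" for a b c
    using that keys_diff[of "frag_of a" "frag_of b"] by (subst eval | force simp: eval)+
  have "t \<in> {t. Poly_Mapping.keys t \<subseteq> ?S \<and> frag_eval Q h t \<in> P}"
  proof (rule tensor_null_least[OF M N t])
    show "0 \<in> {t. Poly_Mapping.keys t \<subseteq> ?S \<and> frag_eval Q h t \<in> P}"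
      using P0 by (simp add: frag_eval_def)
    show "a - b \<in> {t. Poly_Mapping.keys t \<subseteq> ?S \<and> frag_eval Q h t \<in> P}"
      if "a \<in> {t. Poly_Mapping.keys t \<subseteq> ?S \<and> frag_eval Q h t \<in> P}"
        "b \<in> {t. Poly_Mapping.keys t \<subseteq> ?S \<and> frag_eval Q h t \<in> P}" for a b
      using that keys_diff[of a b] Pd by (auto simp: eval)
    show "tensor_relations R M N \<subseteq> {t. Poly_Mapping.keys t \<subseteq> ?S \<and> frag_eval Q h t \<in> P}"
    proof
      fix t assume t: "t \<in> tensor_relations R M N"
      then have "Poly_Mapping.keys t \<subseteq> ?S"
        by (rule tensor_relations_in_free[OF M N])
      moreover have "frag_eval Q h t \<in> P"
        using t unfolding tensor_relations_def
      proof (elim UnE CollectE exE conjE)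
        fix x x' y assume "t = frag_of (x \<oplus>\<^bsub>M\<^esub> x', y) - frag_of (x, y) - frag_of (x', y)"
          "x \<in> carrier M" "x' \<in> carrier M" "y \<in> carrier N"
        then show ?thesis using left by (simp add: aux)
      next
        fix x y y' assume "t = frag_of (x, y \<oplus>\<^bsub>N\<^esub> y') - frag_of (x, y) - frag_of (x, y')"
          "x \<in> carrier M" "y \<in> carrier N" "y' \<in> carrier N"
        then show ?thesis using right by (simp add: aux)
      next
        fix r x y assume "t = frag_of (r \<odot>\<^bsub>M\<^esub> x, y) - frag_of (x, r \<odot>\<^bsub>N\<^esub> y)"
          "r \<in> carrier R" "x \<in> carrier M" "y \<in> carrier N"
        then show ?thesis using bal by (simp add: eval)
      qed
      ultimately show "t \<in> {t. Poly_Mapping.keys t \<subseteq> ?S \<and> frag_eval Q h t \<in> P}"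
        by simp
    qed
  qed
  then show ?thesis by simp
qed

text \<open>
The elements on which the extension of \<open>\<beta>\<close> vanishes form a subgroup that contains the defining
relations, hence all null tensors. The extension is therefore constant on cosets, and the choice of a
representative hidden in \<^const>\<open>tensor_lift\<close> is harmless.
\<close>

lemma tensor_lift_class:
  assumes M: "module R M" and N: "module R N" and Q: "abelian_group Q"
    and \<beta>: "balanced_map R M N Q \<beta>"
    and t: "Poly_Mapping.keys t \<subseteq> carrier M \<times> carrier N"
  shows "tensor_lift Q \<beta> (tensor_class R M N t) = frag_eval Q (case_prod \<beta>) t"
proof -
  interpret M: module R M by fact
  interpret N: module R N by fact
  interpret Q: abelian_group Q by fact
  have h: "\<And>z. z \<in> carrier M \<times> carrier N \<Longrightarrow> case_prod \<beta> z \<in> carrier Q"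
    using \<beta> by (auto simp: balanced_map_def)
  have cancel: "a \<oplus>\<^bsub>Q\<^esub> b \<ominus>\<^bsub>Q\<^esub> a \<ominus>\<^bsub>Q\<^esub> b = \<zero>\<^bsub>Q\<^esub>" if "a \<in> carrier Q" "b \<in> carrier Q" for a b
    using that Q.r_neg[of "a \<oplus>\<^bsub>Q\<^esub> b"] by (simp add: a_minus_def Q.minus_add Q.a_assoc)
  have cancel_self: "a \<ominus>\<^bsub>Q\<^esub> a = \<zero>\<^bsub>Q\<^esub>" if "a \<in> carrier Q" for a
    using that by (simp add: a_minus_def Q.r_neg)
  have null: "frag_eval Q (case_prod \<beta>) s \<in> {\<zero>\<^bsub>Q\<^esub>}" if "s \<in> tensor_null R M N" for s
    by (rule tensor_null_eval[OF M N Q h _ _ _ _ _ that])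
       (use \<beta> in \<open>simp_all add: balanced_map_def cancel cancel_self\<close>)
  have "frag_eval Q (case_prod \<beta>) s = frag_eval Q (case_prod \<beta>) t"
    if s: "s \<in> tensor_class R M N t" for s
  proof -
    have st: "s - t \<in> tensor_null R M N"
      using s mem_tensor_class[OF M N] by blast
    have "frag_eval Q (case_prod \<beta>) ((s - t) + t)
        = frag_eval Q (case_prod \<beta>) (s - t) \<oplus>\<^bsub>Q\<^esub> frag_eval Q (case_prod \<beta>) t"
      by (rule Q.frag_eval_add[OF h tensor_null_in_free[OF M N st] t])
    then show ?thesis
      using null[OF st] Q.frag_eval_closed[OF h t] by simp
  qed
  moreover have "t \<in> tensor_class R M N t"
    using mem_tensor_class[OF M N, of t t] tensor_null_0[OF M N] by simp
  ultimately have "(\<lambda>t. frag_eval Q (case_prod \<beta>) t) ` tensor_class R M N t = {frag_eval Q (case_prod \<beta>) t}"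
    by blast
  then show ?thesis
    unfolding tensor_lift_def frag_eval_def by simp
qed

text \<open>
Functoriality, with a possible change of base ring: a scalar \<open>r\<close> of \<open>R\<close> need only correspond to some
scalar \<open>r'\<close> of \<open>R'\<close>, the same for both factors.
\<close>

lemma tensor_null_map:
  assumes M: "module R M" and N: "module R N" and M': "module R' M'" and N': "module R' N'"
    and t: "t \<in> tensor_null R M N"
    and u: "\<And>x. x \<in> carrier M \<Longrightarrow> u x \<in> carrier M'"
      "\<And>x x'. x \<in> carrier M \<Longrightarrow> x' \<in> carrier M \<Longrightarrow> u (x \<oplus>\<^bsub>M\<^esub> x') = u x \<oplus>\<^bsub>M'\<^esub> u x'"
    and v: "\<And>y. y \<in> carrier N \<Longrightarrow> v y \<in> carrier N'"
      "\<And>y y'. y \<in> carrier N \<Longrightarrow> y' \<in> carrier N \<Longrightarrow> v (y \<oplus>\<^bsub>N\<^esub> y') = v y \<oplus>\<^bsub>N'\<^esub> v y'"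
    and uv: "\<And>r. r \<in> carrier R \<Longrightarrow> \<exists>r'\<in>carrier R'.
      (\<forall>x\<in>carrier M. u (r \<odot>\<^bsub>M\<^esub> x) = r' \<odot>\<^bsub>M'\<^esub> u x) \<and> (\<forall>y\<in>carrier N. v (r \<odot>\<^bsub>N\<^esub> y) = r' \<odot>\<^bsub>N'\<^esub> v y)"
  shows "frag_extend (\<lambda>(x, y). frag_of (u x, v y)) t \<in> tensor_null R' M' N'"
proof (rule tensor_null_extend[OF M N t tensor_null_0[OF M' N'] tensor_null_diff[OF M' N']],
    simp_all only: prod.case)
  fix r x y assume "r \<in> carrier R" and xy: "x \<in> carrier M" "y \<in> carrier N"
  with uv[of r] obtain r' where "r' \<in> carrier R'" "u (r \<odot>\<^bsub>M\<^esub> x) = r' \<odot>\<^bsub>M'\<^esub> u x" "v (r \<odot>\<^bsub>N\<^esub> y) = r' \<odot>\<^bsub>N'\<^esub> v y"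
    by blast
  then show "frag_of (u (r \<odot>\<^bsub>M\<^esub> x), v y) - frag_of (u x, v (r \<odot>\<^bsub>N\<^esub> y)) \<in> tensor_null R' M' N'"
    using tensor_null_smult[OF M' N'] xy u v by simp
qed (use u v in \<open>simp_all add: tensor_null_add_left[OF M' N'] tensor_null_add_right[OF M' N']\<close>)

lemma frag_eval_tensor_class:
  assumes M: "module R M" and N: "module R N"
    and h: "\<And>z. z \<in> S \<Longrightarrow> Poly_Mapping.keys (h z) \<subseteq> carrier M \<times> carrier N"
    and t: "Poly_Mapping.keys t \<subseteq> S"
  shows "frag_eval (tensor R M N) (\<lambda>z. tensor_class R M N (h z)) t = tensor_class R M N (frag_extend h t)"
proof -
  interpret Q: abelian_group "tensor R M N" by (rule tensor_abelian_group[OF M N])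
  have h': "\<And>z. z \<in> S \<Longrightarrow> tensor_class R M N (h z) \<in> carrier (tensor R M N)"
    using h tensor_class_closed[OF M N] by blast
  have keys: "Poly_Mapping.keys (frag_extend h t) \<subseteq> carrier M \<times> carrier N"
    if "Poly_Mapping.keys t \<subseteq> S" for t
    using that h by (rule keys_frag_extend_subset)
  show ?thesis
    using t
  proof (rule free_Abelian_group_induct)
    show "frag_eval (tensor R M N) (\<lambda>z. tensor_class R M N (h z)) 0 = tensor_class R M N (frag_extend h 0)"
      by (simp add: frag_eval_def tensor_zero[OF M N])
  next
    fix z assume "z \<in> S"
    then show "frag_eval (tensor R M N) (\<lambda>z. tensor_class R M N (h z)) (frag_of z)
        = tensor_class R M N (frag_extend h (frag_of z))"
      using Q.frag_eval_of[OF h'] by simp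
  next
    fix a b
    assume a: "Poly_Mapping.keys a \<subseteq> S" and b: "Poly_Mapping.keys b \<subseteq> S"
      and IH: "frag_eval (tensor R M N) (\<lambda>z. tensor_class R M N (h z)) a = tensor_class R M N (frag_extend h a)"
        "frag_eval (tensor R M N) (\<lambda>z. tensor_class R M N (h z)) b = tensor_class R M N (frag_extend h b)"
    have ab: "Poly_Mapping.keys (a - b) \<subseteq> S"
      using a b keys_diff[of a b] by auto
    have "tensor_class R M N (frag_extend h a)
        = tensor_class R M N (frag_extend h (a - b)) \<oplus>\<^bsub>tensor R M N\<^esub> tensor_class R M N (frag_extend h b)"
      using tensor_add[OF M N keys[OF ab] keys[OF b]] by (simp add: frag_extend_diff)
    moreover have "frag_eval (tensor R M N) (\<lambda>z. tensor_class R M N (h z)) (a - b)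
        = frag_eval (tensor R M N) (\<lambda>z. tensor_class R M N (h z)) a
          \<ominus>\<^bsub>tensor R M N\<^esub> frag_eval (tensor R M N) (\<lambda>z. tensor_class R M N (h z)) b"
      by (rule Q.frag_eval_diff[OF _ a b]) (rule h')
    ultimately show "frag_eval (tensor R M N) (\<lambda>z. tensor_class R M N (h z)) (a - b)
        = tensor_class R M N (frag_extend h (a - b))"
      unfolding IH using keys[OF ab] keys[OF b]
      by (simp add: a_minus_def Q.a_assoc Q.r_neg tensor_class_closed[OF M N])
  qed
qed

lemma frag_extend_mem:
  assumes "Poly_Mapping.keys t \<subseteq> S" and "\<And>z. z \<in> S \<Longrightarrow> h z \<in> K"
    and "0 \<in> K" and "\<And>a b. a \<in> K \<Longrightarrow> b \<in> K \<Longrightarrow> a - b \<in> K"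
  shows "frag_extend h t \<in> K"
  using assms(1) by (rule free_Abelian_group_induct) (simp_all add: assms frag_extend_diff)

section \<open>Restriction of scalars\<close>

lemma scalars_via_simps [simp]:
  "carrier (scalars_via \<phi> S) = carrier S"
  "monoid.mult (scalars_via \<phi> S) = monoid.mult S"
  "one (scalars_via \<phi> S) = one S"
  "zero (scalars_via \<phi> S) = zero S"
  "add (scalars_via \<phi> S) = add S"
  "r \<odot>\<^bsub>scalars_via \<phi> S\<^esub> s = \<phi> r \<otimes>\<^bsub>S\<^esub> s"
  by (simp_all add: scalars_via_def)

lemma finsum_scalars_via: "finsum (scalars_via \<phi> S) h X = finsum S h X"
  by (simp add: finsum_def finprod_def)

lemma cring_scalars_via:
  assumes "cring S"
  shows "cring (scalars_via \<phi> S)"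
proof -
  interpret cring S by fact
  have "abelian_group (scalars_via \<phi> S)"
    by (rule abelian_groupI) (auto simp: a_ac intro: add.l_inv_ex)
  moreover have "comm_monoid (scalars_via \<phi> S)"
    by (rule comm_monoidI) (auto simp: m_ac)
  ultimately show ?thesis
    by (rule cringI) (auto simp: l_distr)
qed

lemma algebra_scalars_via:
  assumes R: "cring R" and S: "cring S" and \<phi>: "\<phi> \<in> ring_hom R S"
  shows "algebra R (scalars_via \<phi> S)"
proof -
  interpret S: cring S by fact
  note hom = ring_hom_closed[OF \<phi>] ring_hom_add[OF \<phi>] ring_hom_mult[OF \<phi>] ring_hom_one[OF \<phi>]
  show ?thesis
    by (rule algebraI[OF R cring_scalars_via[OF S]])
       (auto simp: hom S.l_distr S.r_distr S.m_assoc)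
qed

lemma module_scalars_via:
  "cring R \<Longrightarrow> cring S \<Longrightarrow> \<phi> \<in> ring_hom R S \<Longrightarrow> module R (scalars_via \<phi> S)"
  using algebra.axioms(1)[OF algebra_scalars_via] .

definition restrict_scalars ::
  "('s \<Rightarrow> 'r) \<Rightarrow> ('r, 'm) module \<Rightarrow> ('s, 'm) module"
  where "restrict_scalars \<phi> M =
    \<lparr>carrier = carrier M, monoid.mult = monoid.mult M, one = one M, zero = zero M, add = add M,
     smult = (\<lambda>s x. \<phi> s \<odot>\<^bsub>M\<^esub> x)\<rparr>"

lemma restrict_scalars_simps [simp]:
  "carrier (restrict_scalars \<phi> M) = carrier M"
  "zero (restrict_scalars \<phi> M) = zero M"
  "add (restrict_scalars \<phi> M) = add M"
  "s \<odot>\<^bsub>restrict_scalars \<phi> M\<^esub> x = \<phi> s \<odot>\<^bsub>M\<^esub> x"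
  by (simp_all add: restrict_scalars_def)

lemma module_restrict_scalars:
  assumes S: "cring S" and M: "module R M" and \<phi>: "\<phi> \<in> ring_hom S R"
  shows "module S (restrict_scalars \<phi> M)"
proof -
  interpret M: module R M by fact
  note hom = ring_hom_closed[OF \<phi>] ring_hom_add[OF \<phi>] ring_hom_mult[OF \<phi>] ring_hom_one[OF \<phi>]
  have "abelian_group (restrict_scalars \<phi> M)"
    by (rule abelian_groupI) (auto simp: M.a_ac intro: M.add.l_inv_ex)
  then show ?thesis
    by (rule moduleI[OF S]) (auto simp: hom M.smult_l_distr M.smult_r_distr M.smult_assoc1)
qed

section \<open>The tensor product of two algebras\<close>

text \<open>
The bilinear product on representatives from which the product of \<^const>\<open>tensor\<close> is induced.
\<close>

definition frag_mult ::
  "('m, 'v) monoid_scheme \<Rightarrow> ('n, 'w) monoid_scheme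
    \<Rightarrow> ('m \<times> 'n \<Rightarrow>\<^sub>0 int) \<Rightarrow> ('m \<times> 'n \<Rightarrow>\<^sub>0 int) \<Rightarrow> ('m \<times> 'n \<Rightarrow>\<^sub>0 int)"
  where "frag_mult M N s t =
    frag_extend (\<lambda>(x, y). frag_extend (\<lambda>(x', y'). frag_of (x \<otimes>\<^bsub>M\<^esub> x', y \<otimes>\<^bsub>N\<^esub> y')) t) s"

lemma frag_mult_diff_left: "frag_mult M N (s - s') t = frag_mult M N s t - frag_mult M N s' t"
  by (simp add: frag_mult_def frag_extend_diff)

lemma frag_mult_diff_right: "frag_mult M N s (t - t') = frag_mult M N s t - frag_mult M N s t'"
  by (simp add: frag_mult_def frag_extend_diff case_prod_beta' frag_extend_pointwise_diff)

lemma frag_mult_0 [simp]: "frag_mult M N 0 t = 0" "frag_mult M N s 0 = 0"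
  using frag_mult_diff_left[of M N 0 0 t] frag_mult_diff_right[of M N s 0 0] by simp_all

lemma frag_mult_of [simp]:
  "frag_mult M N (frag_of (x, y)) (frag_of (x', y')) = frag_of (x \<otimes>\<^bsub>M\<^esub> x', y \<otimes>\<^bsub>N\<^esub> y')"
  by (simp add: frag_mult_def)

text \<open>
Biadditive identities between two elements of free abelian groups need only be checked on generators.
\<close>

lemma frag_mult_induct2:
  assumes s: "Poly_Mapping.keys s \<subseteq> S" and t: "Poly_Mapping.keys t \<subseteq> T"
    and "\<And>z w. z \<in> S \<Longrightarrow> w \<in> T \<Longrightarrow> P (frag_of z) (frag_of w)"
    and 0: "\<And>a. P 0 a" "\<And>a. P a 0"
    and d: "\<And>a b c. P a c \<Longrightarrow> P b c \<Longrightarrow> P (a - b) c" "\<And>a b c. P a b \<Longrightarrow> P a c \<Longrightarrow> P a (b - c)"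
  shows "P s t"
  using s
proof (rule free_Abelian_group_induct)
  show "P (frag_of z) t" if "z \<in> S" for z
    using t by (rule free_Abelian_group_induct) (use that assms in auto)
qed (use 0 d in auto)

context
  fixes R :: "('r, 'u) ring_scheme" and M :: "('r, 'm, 'v) module_scheme"
    and N :: "('r, 'n, 'w) module_scheme"
  assumes M: "algebra R M" and N: "algebra R N"
begin

interpretation M: algebra R M by (rule M)
interpretation N: algebra R N by (rule N)

lemmas factor_modules = M.module N.module

abbreviation (input) "frag_keys t \<equiv> Poly_Mapping.keys t \<subseteq> carrier M \<times> carrier N"

lemma frag_mult_closed:
  assumes "frag_keys s" "frag_keys t"
  shows "frag_keys (frag_mult M N s t)"
proof -
  have "frag_keys (frag_extend (\<lambda>(x', y'). frag_of (x \<otimes>\<^bsub>M\<^esub> x', y \<otimes>\<^bsub>N\<^esub> y')) t)"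
    if "x \<in> carrier M" "y \<in> carrier N" for x y
    by (rule keys_frag_extend_subset[OF assms(2)]) (use that in auto)
  then show ?thesis
    unfolding frag_mult_def
    by (intro keys_frag_extend_subset[OF assms(1)]) (simp add: mem_Times_iff case_prod_beta)
qed

lemma frag_mult_comm:
  assumes "frag_keys s" "frag_keys t"
  shows "frag_mult M N s t = frag_mult M N t s"
  using assms
  by (rule frag_mult_induct2)
     (auto simp: frag_mult_diff_left frag_mult_diff_right M.m_comm N.m_comm)

lemma frag_mult_assoc:
  assumes "frag_keys s" "frag_keys t" "frag_keys u"
  shows "frag_mult M N (frag_mult M N s t) u = frag_mult M N s (frag_mult M N t u)"
  using assms(1,2)
proof (rule frag_mult_induct2)
  fix z w assume zw: "z \<in> carrier M \<times> carrier N" "w \<in> carrier M \<times> carrier N"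
  show "frag_mult M N (frag_mult M N (frag_of z) (frag_of w)) u
      = frag_mult M N (frag_of z) (frag_mult M N (frag_of w) u)"
    using assms(3)
    by (rule free_Abelian_group_induct)
       (use zw in \<open>auto simp: frag_mult_diff_right M.m_assoc N.m_assoc\<close>)
qed (simp_all add: frag_mult_diff_left frag_mult_diff_right)

lemma frag_mult_one:
  assumes "frag_keys t"
  shows "frag_mult M N (frag_of (\<one>\<^bsub>M\<^esub>, \<one>\<^bsub>N\<^esub>)) t = t"
  using assms by (rule free_Abelian_group_induct) (auto simp: frag_mult_diff_right)

text \<open>
For a generator \<open>(x, y)\<close> the product is the map induced by multiplication with \<open>x\<close> and with \<open>y\<close>; both
are linear, so null tensors are preserved by functoriality.
\<close>

lemma frag_mult_null_right:
  assumes s: "frag_keys s" and t: "t \<in> tensor_null R M N"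
  shows "frag_mult M N s t \<in> tensor_null R M N"
  using s
proof (rule free_Abelian_group_induct)
  fix z assume z: "z \<in> carrier M \<times> carrier N"
  obtain x y where [simp]: "z = (x, y)" by force
  have xy: "x \<in> carrier M" "y \<in> carrier N"
    using z by auto
  have sm: "x \<otimes>\<^bsub>M\<^esub> (r \<odot>\<^bsub>M\<^esub> x') = r \<odot>\<^bsub>M\<^esub> (x \<otimes>\<^bsub>M\<^esub> x')"
    if "r \<in> carrier R" "x' \<in> carrier M" for r x'
    using that xy M.smult_assoc2 M.m_comm M.smult_closed by metis
  have sn: "y \<otimes>\<^bsub>N\<^esub> (r \<odot>\<^bsub>N\<^esub> x') = r \<odot>\<^bsub>N\<^esub> (y \<otimes>\<^bsub>N\<^esub> x')"
    if "r \<in> carrier R" "x' \<in> carrier N" for r x'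
    using that xy N.smult_assoc2 N.m_comm N.smult_closed by metis
  have "frag_extend (\<lambda>(x', y'). frag_of (x \<otimes>\<^bsub>M\<^esub> x', y \<otimes>\<^bsub>N\<^esub> y')) t \<in> tensor_null R M N"
    by (rule tensor_null_map[OF factor_modules factor_modules t])
       (use xy sm sn in \<open>auto simp: M.r_distr N.r_distr\<close>)
  then show "frag_mult M N (frag_of z) t \<in> tensor_null R M N"
    by (simp add: frag_mult_def)
qed (auto simp: frag_mult_diff_left tensor_null_0[OF factor_modules] tensor_null_diff[OF factor_modules])

text \<open>
Null tensors form an ideal, so all pairs of representatives give the same coset and the union in the
definition of the product collapses.
\<close>

lemma tensor_mult:
  assumes s: "frag_keys s" and t: "frag_keys t"
  shows "tensor_class R M N s \<otimes>\<^bsub>tensor R M N\<^esub> tensor_class R M N t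
    = tensor_class R M N (frag_mult M N s t)"
proof -
  have "tensor_class R M N (frag_mult M N s' t') = tensor_class R M N (frag_mult M N s t)"
    if s': "s' \<in> tensor_class R M N s" and t': "t' \<in> tensor_class R M N t" for s' t'
  proof -
    note keys = tensor_class_rep(1)[OF factor_modules s s'] tensor_class_rep(1)[OF factor_modules t t']
    have "frag_mult M N s' (t' - t) \<in> tensor_null R M N"
      using t' keys mem_tensor_class[OF factor_modules] by (intro frag_mult_null_right) auto
    moreover have "frag_mult M N t (s' - s) \<in> tensor_null R M N"
      using s' t mem_tensor_class[OF factor_modules] by (intro frag_mult_null_right) auto
    ultimately have "frag_mult M N s' (t' - t) + frag_mult M N t (s' - s) \<in> tensor_null R M N"
      by (rule tensor_null_add[OF factor_modules])
    moreover have "frag_mult M N s' (t' - t) + frag_mult M N t (s' - s)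
        = frag_mult M N s' t' - frag_mult M N s t"
      using s t keys by (simp add: frag_mult_diff_right frag_mult_comm[of t])
    ultimately show ?thesis
      using s t keys by (simp add: tensor_class_eq_iff[OF factor_modules] frag_mult_closed)
  qed
  moreover have "s \<in> tensor_class R M N s" "t \<in> tensor_class R M N t"
    using mem_tensor_class[OF factor_modules] tensor_null_0[OF factor_modules] by simp_all
  ultimately have "(\<Union>s'\<in>tensor_class R M N s. \<Union>t'\<in>tensor_class R M N t.
      tensor_class R M N (frag_mult M N s' t')) = tensor_class R M N (frag_mult M N s t)"
    by blast
  then show ?thesis
    by (simp add: tensor_def frag_mult_def)
qed

lemma tensor_one: "\<one>\<^bsub>tensor R M N\<^esub> = tensor_class R M N (frag_of (\<one>\<^bsub>M\<^esub>, \<one>\<^bsub>N\<^esub>))"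
  by (simp add: tensor_def)

lemma tensor_cring: "cring (tensor R M N)"
proof (rule cringI)
  show "abelian_group (tensor R M N)"
    by (rule tensor_abelian_group[OF factor_modules])
  have keys1: "frag_keys (frag_of (\<one>\<^bsub>M\<^esub>, \<one>\<^bsub>N\<^esub>))"
    by simp
  show "comm_monoid (tensor R M N)"
  proof (rule comm_monoidI)
    show "\<one>\<^bsub>tensor R M N\<^esub> \<in> carrier (tensor R M N)"
      unfolding tensor_one by (rule tensor_class_closed[OF factor_modules keys1])
  next
    fix X Y assume "X \<in> carrier (tensor R M N)" "Y \<in> carrier (tensor R M N)"
    then obtain s t where "frag_keys s" "X = tensor_class R M N s" "frag_keys t" "Y = tensor_class R M N t"
      by (metis tensor_carrierE[OF factor_modules])
    then show "X \<otimes>\<^bsub>tensor R M N\<^esub> Y \<in> carrier (tensor R M N)"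
      and "X \<otimes>\<^bsub>tensor R M N\<^esub> Y = Y \<otimes>\<^bsub>tensor R M N\<^esub> X"
      by (simp_all add: tensor_mult tensor_class_closed[OF factor_modules] frag_mult_closed frag_mult_comm)
    fix Z assume "Z \<in> carrier (tensor R M N)"
    then obtain u where "frag_keys u" "Z = tensor_class R M N u"
      by (metis tensor_carrierE[OF factor_modules])
    with \<open>frag_keys s\<close> \<open>X = _\<close> \<open>frag_keys t\<close> \<open>Y = _\<close>
    show "X \<otimes>\<^bsub>tensor R M N\<^esub> Y \<otimes>\<^bsub>tensor R M N\<^esub> Z = X \<otimes>\<^bsub>tensor R M N\<^esub> (Y \<otimes>\<^bsub>tensor R M N\<^esub> Z)"
      by (simp add: tensor_mult frag_mult_closed frag_mult_assoc)
  next
    fix X assume "X \<in> carrier (tensor R M N)"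
    then obtain s where "frag_keys s" "X = tensor_class R M N s"
      by (metis tensor_carrierE[OF factor_modules])
    then show "\<one>\<^bsub>tensor R M N\<^esub> \<otimes>\<^bsub>tensor R M N\<^esub> X = X"
      unfolding tensor_one using keys1 by (simp only: tensor_mult frag_mult_one)
  qed
next
  fix X Y Z
  assume "X \<in> carrier (tensor R M N)" "Y \<in> carrier (tensor R M N)" "Z \<in> carrier (tensor R M N)"
  then obtain s t u where k: "frag_keys s" "frag_keys t" "frag_keys u"
    and [simp]: "X = tensor_class R M N s" "Y = tensor_class R M N t" "Z = tensor_class R M N u"
    by (metis tensor_carrierE[OF factor_modules])
  have "frag_keys (s + t)"
    using k keys_add[of s t] by auto
  moreover have "frag_mult M N (s + t) u = frag_mult M N s u + frag_mult M N t u"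
    by (simp add: frag_mult_def frag_extend_add)
  ultimately show "(X \<oplus>\<^bsub>tensor R M N\<^esub> Y) \<otimes>\<^bsub>tensor R M N\<^esub> Z
      = X \<otimes>\<^bsub>tensor R M N\<^esub> Z \<oplus>\<^bsub>tensor R M N\<^esub> Y \<otimes>\<^bsub>tensor R M N\<^esub> Z"
    using k by (simp add: tensor_add[OF factor_modules] tensor_mult frag_mult_closed)
qed

lemma tensor_right_hom: "(\<lambda>y. pure_tensor R M N \<one>\<^bsub>M\<^esub> y) \<in> ring_hom N (tensor R M N)"
proof (rule ring_hom_memI)
  show "pure_tensor R M N \<one>\<^bsub>M\<^esub> y \<in> carrier (tensor R M N)" if "y \<in> carrier N" for y
    unfolding pure_tensor_def by (rule tensor_class_closed[OF factor_modules]) (use that in simp)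
  show "pure_tensor R M N \<one>\<^bsub>M\<^esub> (y \<otimes>\<^bsub>N\<^esub> y')
      = pure_tensor R M N \<one>\<^bsub>M\<^esub> y \<otimes>\<^bsub>tensor R M N\<^esub> pure_tensor R M N \<one>\<^bsub>M\<^esub> y'"
    if "y \<in> carrier N" "y' \<in> carrier N" for y y'
    unfolding pure_tensor_def using that by (subst tensor_mult) auto
  show "pure_tensor R M N \<one>\<^bsub>M\<^esub> (y \<oplus>\<^bsub>N\<^esub> y')
      = pure_tensor R M N \<one>\<^bsub>M\<^esub> y \<oplus>\<^bsub>tensor R M N\<^esub> pure_tensor R M N \<one>\<^bsub>M\<^esub> y'"
    if y: "y \<in> carrier N" "y' \<in> carrier N" for y y'
  proof -
    have "frag_keys (frag_of (\<one>\<^bsub>M\<^esub>, y) + frag_of (\<one>\<^bsub>M\<^esub>, y'))"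
      using y keys_add[of "frag_of (\<one>\<^bsub>M\<^esub>, y)" "frag_of (\<one>\<^bsub>M\<^esub>, y')"] by auto
    then show ?thesis
      unfolding pure_tensor_def
      using tensor_null_add_right[OF factor_modules, of "\<one>\<^bsub>M\<^esub>" y y'] y
      by (subst tensor_add[OF factor_modules]) (auto simp: tensor_class_eq_iff[OF factor_modules] diff_diff_eq)
  qed
  show "pure_tensor R M N \<one>\<^bsub>M\<^esub> \<one>\<^bsub>N\<^esub> = \<one>\<^bsub>tensor R M N\<^esub>"
    by (simp add: pure_tensor_def tensor_one)
qed

end

section \<open>Additive spans\<close>

inductive_set additive_span :: "('a, 'u) ring_scheme \<Rightarrow> 'a set \<Rightarrow> 'a set"
  for R and X where
  zero: "\<zero>\<^bsub>R\<^esub> \<in> additive_span R X"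
| base: "x \<in> X \<Longrightarrow> x \<in> additive_span R X"
| diff: "x \<in> additive_span R X \<Longrightarrow> y \<in> additive_span R X \<Longrightarrow> x \<ominus>\<^bsub>R\<^esub> y \<in> additive_span R X"

lemma additive_span_least:
  assumes "x \<in> additive_span R X" and "X \<subseteq> K" and "\<zero>\<^bsub>R\<^esub> \<in> K"
    and "\<And>x y. x \<in> K \<Longrightarrow> y \<in> K \<Longrightarrow> x \<ominus>\<^bsub>R\<^esub> y \<in> K"
  shows "x \<in> K"
  using assms(1) by (induction rule: additive_span.induct) (use assms in auto)

lemma (in abelian_group) add_diff_eq:
  assumes "a \<in> carrier G" "b \<in> carrier G" "c \<in> carrier G" "d \<in> carrier G"
  shows "(a \<oplus> b) \<ominus> (c \<oplus> d) = (a \<ominus> c) \<oplus> (b \<ominus> d)"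
  using assms by (simp add: a_minus_def minus_add a_ac)

lemma (in abelian_group) a_inv_zero: "\<ominus> \<zero> = \<zero>"
  by (rule minus_equality) simp_all

lemma (in abelian_group) minus_zero_right: "x \<in> carrier G \<Longrightarrow> x \<ominus> \<zero> = x"
  by (simp add: a_minus_def a_inv_zero)

context abelian_group
begin

lemma additive_span_in_carrier:
  assumes "X \<subseteq> carrier G" and "x \<in> additive_span G X"
  shows "x \<in> carrier G"
  using assms(2,1) by (rule additive_span_least) auto

lemma additive_span_add:
  assumes X: "X \<subseteq> carrier G" and x: "x \<in> additive_span G X" and y: "y \<in> additive_span G X"
  shows "x \<oplus> y \<in> additive_span G X"
proof -
  have "x \<ominus> (\<zero> \<ominus> y) \<in> additive_span G X"
    using x y by (intro additive_span.diff additive_span.zero)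
  then show ?thesis
    using additive_span_in_carrier[OF X x] additive_span_in_carrier[OF X y] by (simp add: a_minus_def)
qed

lemma additive_span_finsum:
  assumes X: "X \<subseteq> carrier G" and h: "\<And>i. i \<in> I \<Longrightarrow> h i \<in> additive_span G X"
  shows "(\<Oplus>i\<in>I. h i) \<in> additive_span G X"
  using h
proof (induction I rule: infinite_finite_induct)
  case (insert i I)
  then have "(\<Oplus>i\<in>insert i I. h i) = h i \<oplus> (\<Oplus>i\<in>I. h i)"
    using additive_span_in_carrier[OF X] by (intro finsum_insert) auto
  then show ?case
    using insert additive_span_add[OF X] by simp
qed (simp_all add: additive_span.zero)

end

lemma additive_span_mono:
  assumes "x \<in> additive_span R X" and "X \<subseteq> additive_span R Y"
  shows "x \<in> additive_span R Y"
  using assms by (rule additive_span_least) (auto intro: additive_span.intros)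

text \<open>
An additive map carries the span of \<open>X\<close> into any span that contains the images of \<open>X\<close>.
\<close>

lemma additive_span_map:
  assumes R: "abelian_group R" and S: "abelian_group S"
    and X: "X \<subseteq> carrier R"
    and h: "\<And>x. x \<in> carrier R \<Longrightarrow> h x \<in> carrier S"
      "\<And>x y. x \<in> carrier R \<Longrightarrow> y \<in> carrier R \<Longrightarrow> h (x \<oplus>\<^bsub>R\<^esub> y) = h x \<oplus>\<^bsub>S\<^esub> h y"
    and x: "x \<in> additive_span R X" and Y: "h ` X \<subseteq> additive_span S Y"
  shows "h x \<in> additive_span S Y"
proof -
  interpret R: abelian_group R by fact
  interpret S: abelian_group S by fact
  have h_diff: "h (x \<ominus>\<^bsub>R\<^esub> y) = h x \<ominus>\<^bsub>S\<^esub> h y" if "x \<in> carrier R" "y \<in> carrier R" for x y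
  proof -
    have "h x = h (x \<ominus>\<^bsub>R\<^esub> y) \<oplus>\<^bsub>S\<^esub> h y"
      using that h(2)[of "x \<ominus>\<^bsub>R\<^esub> y" y] by (simp add: a_minus_def R.a_assoc R.l_neg)
    then show ?thesis
      using that h(1) by (simp add: a_minus_def S.a_assoc S.r_neg)
  qed
  have h0: "h \<zero>\<^bsub>R\<^esub> = \<zero>\<^bsub>S\<^esub>"
    using h_diff[of "\<zero>\<^bsub>R\<^esub>" "\<zero>\<^bsub>R\<^esub>"] h(1)
    by (simp add: a_minus_def R.a_inv_zero S.r_neg)
  have "x \<in> {x \<in> carrier R. h x \<in> additive_span S Y}"
    using x by (rule additive_span_least)
      (use X Y h0 h_diff in \<open>auto intro: additive_span.intros\<close>)
  then show ?thesis by simp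
qed

section \<open>Relative Frobenius and F-finiteness\<close>

abbreviation frob_gens ::
  "nat \<Rightarrow> ('a, 'u) ring_scheme \<Rightarrow> ('b, 'v) ring_scheme \<Rightarrow> ('a \<Rightarrow> 'b) \<Rightarrow> 'b set \<Rightarrow> 'b set"
  where "frob_gens q A B f X \<equiv>
    {b [^]\<^bsub>B\<^esub> q \<otimes>\<^bsub>B\<^esub> f a \<otimes>\<^bsub>B\<^esub> x | b a x. b \<in> carrier B \<and> a \<in> carrier A \<and> x \<in> X}"

text \<open>
The submodule generated by \<open>X\<close> over the subring \<open>B\<^sup>q[f(A)]\<close> of \<open>B\<close>. Spelling it out as an additive span
avoids a separate treatment of that subring.
\<close>

definition frob_span ::
  "nat \<Rightarrow> ('a, 'u) ring_scheme \<Rightarrow> ('b, 'v) ring_scheme \<Rightarrow> ('a \<Rightarrow> 'b) \<Rightarrow> 'b set \<Rightarrow> 'b set"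
  where "frob_span q A B f X =
    additive_span B (frob_gens q A B f X)"

text \<open>
The standing situation for one algebra map \<open>f\<close>. It is used below for the maps \<open>f\<close>, \<open>g\<close> and \<open>g \<circ> f\<close>
of the theorem, with different exponents.
\<close>

locale frobenius_map =
  fixes p e :: nat and A :: "('a, 'u) ring_scheme" and B :: "('b, 'v) ring_scheme" and f :: "'a \<Rightarrow> 'b"
  assumes p: "Factorial_Ring.prime p" and FA: "Fp_algebra p A" and FB: "Fp_algebra p B"
    and f: "f \<in> ring_hom A B"
begin

abbreviation "q \<equiv> p ^ e"
abbreviation "T \<equiv> frob_tensor p e A B f"
abbreviation "\<rho> \<equiv> rel_frob p e A B f"

abbreviation (input) tensor_frag :: "('b \<times> 'a \<Rightarrow>\<^sub>0 int) \<Rightarrow> bool"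
  where "tensor_frag t \<equiv> Poly_Mapping.keys t \<subseteq> carrier B \<times> carrier A"

sublocale A: cring A using FA by (simp add: Fp_algebra_def)
sublocale B: cring B using FB by (simp add: Fp_algebra_def)

lemmas f_simps = ring_hom_closed[OF f] ring_hom_add[OF f] ring_hom_mult[OF f] ring_hom_one[OF f]
lemmas frob_A = frobenius_ring_hom[OF p FA, of e]
lemmas frob_B_add = frobenius_add[OF p FB, of _ _ e]

lemma q_pos: "q > 0"
  using p prime_gt_0_nat by simp

lemma f_pow: "a \<in> carrier A \<Longrightarrow> f (a [^]\<^bsub>A\<^esub> (n :: nat)) = f a [^]\<^bsub>B\<^esub> n"
  by (induction n) (simp_all add: f_simps)

lemma algebra_left: "algebra A (scalars_via f B)"
  by (rule algebra_scalars_via[OF A.cring_axioms B.cring_axioms f])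

lemma algebra_right: "algebra A (frob_factor p e A)"
  unfolding frob_factor_def by (rule algebra_scalars_via[OF A.cring_axioms A.cring_axioms frob_A])

lemmas module_left = algebra.axioms(1)[OF algebra_left]
lemmas module_right = algebra.axioms(1)[OF algebra_right]

lemma frob_factor_simps [simp]:
  "carrier (frob_factor p e A) = carrier A"
  "monoid.mult (frob_factor p e A) = monoid.mult A"
  "one (frob_factor p e A) = one A"
  "zero (frob_factor p e A) = zero A"
  "add (frob_factor p e A) = add A"
  "r \<odot>\<^bsub>frob_factor p e A\<^esub> s = r [^]\<^bsub>A\<^esub> q \<otimes>\<^bsub>A\<^esub> s"
  by (simp_all add: frob_factor_def)

abbreviation cls :: "('b \<times> 'a \<Rightarrow>\<^sub>0 int) \<Rightarrow> ('b \<times> 'a \<Rightarrow>\<^sub>0 int) set" where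
  "cls \<equiv> tensor_class A (scalars_via f B) (frob_factor p e A)"
abbreviation eval :: "('b \<times> 'a \<Rightarrow>\<^sub>0 int) \<Rightarrow> 'b" where
  "eval \<equiv> frag_eval B (\<lambda>(b, a). b [^]\<^bsub>B\<^esub> q \<otimes>\<^bsub>B\<^esub> f a)"

sublocale T: cring T
  unfolding frob_tensor_def by (rule tensor_cring[OF algebra_left algebra_right])

lemma frob_tensor_cases:
  assumes "X \<in> carrier T"
  obtains t where "tensor_frag t" "X = cls t"
  using tensor_carrierE[OF module_left module_right] assms by (auto simp: frob_tensor_def)

lemma cls_closed: "tensor_frag t \<Longrightarrow> cls t \<in> carrier T"
  using tensor_class_closed[OF module_left module_right] by (simp add: frob_tensor_def)

text \<open>
On representatives, \<open>\<Phi>\<^sub>e\<close> is the additive extension of \<open>(b, a) \<mapsto> b\<^sup>q f(a)\<close>. This map is additive in \<open>b\<close>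
since \<open>B\<close> has characteristic \<open>p\<close>, and balanced since \<open>(f(r) b)\<^sup>q f(a) = b\<^sup>q f(r\<^sup>q a)\<close>.
\<close>

lemma rel_frob_class:
  assumes "tensor_frag t"
  shows "\<rho> (cls t) = eval t"
proof -
  have "balanced_map A (scalars_via f B) (frob_factor p e A) B (\<lambda>b a. b [^]\<^bsub>B\<^esub> q \<otimes>\<^bsub>B\<^esub> f a)"
    by (auto simp: balanced_map_def f_simps f_pow B.l_distr B.r_distr frob_B_add
        B.nat_pow_distrib B.m_ac)
  from tensor_lift_class[OF module_left module_right B.is_abelian_group this] show ?thesis
    using assms by (simp add: rel_frob_def)
qed

lemma frob_term_closed: "z \<in> carrier B \<times> carrier A \<Longrightarrow> (\<lambda>(b, a). b [^]\<^bsub>B\<^esub> q \<otimes>\<^bsub>B\<^esub> f a) z \<in> carrier B"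
  by (auto simp: f_simps)

lemma eval_of: "b \<in> carrier B \<Longrightarrow> a \<in> carrier A \<Longrightarrow> eval (frag_of (b, a)) = b [^]\<^bsub>B\<^esub> q \<otimes>\<^bsub>B\<^esub> f a"
  using B.frag_eval_of[OF frob_term_closed, where z = "(b, a)" and S = "carrier B \<times> carrier A"] by simp

lemma eval_closed: "tensor_frag t \<Longrightarrow> eval t \<in> carrier B"
  by (rule B.frag_eval_closed[OF frob_term_closed])

lemma eval_add:
  "tensor_frag s \<Longrightarrow> tensor_frag t
    \<Longrightarrow> eval (s + t) = eval s \<oplus>\<^bsub>B\<^esub> eval t"
  by (rule B.frag_eval_add[OF frob_term_closed])

lemma eval_diff:
  "tensor_frag s \<Longrightarrow> tensor_frag t
    \<Longrightarrow> eval (s - t) = eval s \<ominus>\<^bsub>B\<^esub> eval t"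
  by (rule B.frag_eval_diff[OF frob_term_closed])

lemma eval_mult:
  assumes "tensor_frag s" "tensor_frag t"
  shows "eval (frag_mult (scalars_via f B) (frob_factor p e A) s t) = eval s \<otimes>\<^bsub>B\<^esub> eval t"
proof -
  let ?m = "frag_mult (scalars_via f B) (frob_factor p e A)"
  let ?P = "\<lambda>s t. tensor_frag s \<and>
    tensor_frag t \<and> eval (?m s t) = eval s \<otimes>\<^bsub>B\<^esub> eval t"
  have mc: "tensor_frag (?m s t)"
    if "tensor_frag s" "tensor_frag t" for s t
    using frag_mult_closed[OF algebra_left algebra_right, of s t] that by simp
  have e0: "eval 0 = \<zero>\<^bsub>B\<^esub>"
    by (simp add: frag_eval_def)
  have inner: "eval (?m (frag_of z) t) = eval (frag_of z) \<otimes>\<^bsub>B\<^esub> eval t"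
    if z: "z \<in> carrier B \<times> carrier A" for z
    using assms(2)
  proof (rule free_Abelian_group_induct)
    show "eval (?m (frag_of z) 0) = eval (frag_of z) \<otimes>\<^bsub>B\<^esub> eval 0"
      using z by (auto simp: e0 eval_of f_simps)
    show "eval (?m (frag_of z) (frag_of w)) = eval (frag_of z) \<otimes>\<^bsub>B\<^esub> eval (frag_of w)"
      if "w \<in> carrier B \<times> carrier A" for w
      using z that by (auto simp: eval_of f_simps B.nat_pow_distrib B.m_ac)
    fix a b assume a: "tensor_frag a"
      and b: "tensor_frag b"
      and IH: "eval (?m (frag_of z) a) = eval (frag_of z) \<otimes>\<^bsub>B\<^esub> eval a"
      "eval (?m (frag_of z) b) = eval (frag_of z) \<otimes>\<^bsub>B\<^esub> eval b"
    have kz: "tensor_frag (frag_of z)"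
      using z by simp
    show "eval (?m (frag_of z) (a - b)) = eval (frag_of z) \<otimes>\<^bsub>B\<^esub> eval (a - b)"
      unfolding frag_mult_diff_right eval_diff[OF mc[OF kz a] mc[OF kz b]] eval_diff[OF a b] IH
      using eval_closed[OF kz] eval_closed[OF a] eval_closed[OF b]
      by (simp add: a_minus_def B.r_distr B.r_minus)
  qed
  show ?thesis
    using assms(1)
  proof (rule free_Abelian_group_induct)
    show "eval (?m 0 t) = eval 0 \<otimes>\<^bsub>B\<^esub> eval t"
      using eval_closed[OF assms(2)] by (simp add: e0)
    fix a b assume a: "tensor_frag a"
      and b: "tensor_frag b"
      and IH: "eval (?m a t) = eval a \<otimes>\<^bsub>B\<^esub> eval t" "eval (?m b t) = eval b \<otimes>\<^bsub>B\<^esub> eval t"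
    show "eval (?m (a - b) t) = eval (a - b) \<otimes>\<^bsub>B\<^esub> eval t"
      unfolding frag_mult_diff_left eval_diff[OF mc[OF a assms(2)] mc[OF b assms(2)]] eval_diff[OF a b] IH
      using eval_closed[OF assms(2)] eval_closed[OF a] eval_closed[OF b]
      by (simp add: a_minus_def B.l_distr B.l_minus)
  qed (rule inner)
qed

lemma rel_frob_hom: "\<rho> \<in> ring_hom T B"
proof (rule ring_hom_memI)
  show "\<rho> X \<in> carrier B" if "X \<in> carrier T" for X
    using that by (elim frob_tensor_cases) (simp add: rel_frob_class eval_closed)
next
  fix X Y assume "X \<in> carrier T" "Y \<in> carrier T"
  then obtain s t where st: "tensor_frag s" "tensor_frag t"
    and [simp]: "X = cls s" "Y = cls t"
    by (metis frob_tensor_cases)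
  have "X \<otimes>\<^bsub>T\<^esub> Y = cls (frag_mult (scalars_via f B) (frob_factor p e A) s t)"
    using st by (simp add: frob_tensor_def tensor_mult[OF algebra_left algebra_right])
  moreover have "tensor_frag (frag_mult (scalars_via f B) (frob_factor p e A) s t)"
    using frag_mult_closed[OF algebra_left algebra_right, of s t] st by simp
  ultimately show "\<rho> (X \<otimes>\<^bsub>T\<^esub> Y) = \<rho> X \<otimes>\<^bsub>B\<^esub> \<rho> Y"
    using st by (simp add: rel_frob_class eval_mult)
  have "X \<oplus>\<^bsub>T\<^esub> Y = cls (s + t)"
    using st by (simp add: frob_tensor_def tensor_add[OF module_left module_right])
  moreover have "tensor_frag (s + t)"
    using st keys_add[of s t] by auto
  ultimately show "\<rho> (X \<oplus>\<^bsub>T\<^esub> Y) = \<rho> X \<oplus>\<^bsub>B\<^esub> \<rho> Y"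
    using st by (simp add: rel_frob_class eval_add)
next
  show "\<rho> \<one>\<^bsub>T\<^esub> = \<one>\<^bsub>B\<^esub>"
    by (simp add: frob_tensor_def tensor_one[OF algebra_left algebra_right] rel_frob_class eval_of f_simps)
qed

lemmas \<rho>_simps = ring_hom_closed[OF rel_frob_hom] ring_hom_add[OF rel_frob_hom] ring_hom_mult[OF rel_frob_hom]
  ring_hom_one[OF rel_frob_hom]

lemma rel_frob_pure:
  "b \<in> carrier B \<Longrightarrow> a \<in> carrier A \<Longrightarrow>
    \<rho> (pure_tensor A (scalars_via f B) (frob_factor p e A) b a) = b [^]\<^bsub>B\<^esub> q \<otimes>\<^bsub>B\<^esub> f a"
  by (simp add: pure_tensor_def rel_frob_class eval_of)

lemma pure_closed:
  "b \<in> carrier B \<Longrightarrow> a \<in> carrier A \<Longrightarrow> pure_tensor A (scalars_via f B) (frob_factor p e A) b a \<in> carrier T"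
  by (simp add: pure_tensor_def cls_closed)

lemma frob_gens_in_carrier: "X \<subseteq> carrier B \<Longrightarrow> frob_gens n A B f X \<subseteq> carrier B" for n :: nat
  by (auto simp: f_simps subset_eq)

lemma frob_span_closed: "X \<subseteq> carrier B \<Longrightarrow> x \<in> frob_span n A B f X \<Longrightarrow> x \<in> carrier B"
  unfolding frob_span_def by (rule B.additive_span_in_carrier[OF frob_gens_in_carrier])

lemma rel_frob_mult_frob_span:
  assumes s: "s \<in> carrier T" and x: "x \<in> X" and X: "X \<subseteq> carrier B"
  shows "\<rho> s \<otimes>\<^bsub>B\<^esub> x \<in> frob_span q A B f X"
proof -
  obtain t where t: "tensor_frag t" "s = cls t"
    using s by (rule frob_tensor_cases)
  have xB: "x \<in> carrier B" using x X by blast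
  have "eval t \<otimes>\<^bsub>B\<^esub> x \<in> frob_span q A B f X"
    using t(1)
  proof (rule free_Abelian_group_induct)
    show "eval 0 \<otimes>\<^bsub>B\<^esub> x \<in> frob_span q A B f X"
      using xB additive_span.zero by (simp add: frag_eval_def frob_span_def)
    show "eval (frag_of z) \<otimes>\<^bsub>B\<^esub> x \<in> frob_span q A B f X" if z': "z \<in> carrier B \<times> carrier A" for z
    proof -
      obtain b a where z: "z = (b, a)" "b \<in> carrier B" "a \<in> carrier A"
        using z' by auto
      show ?thesis
        unfolding z(1) eval_of[OF z(2,3)] frob_span_def
        by (rule additive_span.base) (use z x in blast)
    qed
    fix a b assume a: "tensor_frag a"
      and b: "tensor_frag b"
      and IH: "eval a \<otimes>\<^bsub>B\<^esub> x \<in> frob_span q A B f X" "eval b \<otimes>\<^bsub>B\<^esub> x \<in> frob_span q A B f X"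
    have "eval (a - b) \<otimes>\<^bsub>B\<^esub> x = eval a \<otimes>\<^bsub>B\<^esub> x \<ominus>\<^bsub>B\<^esub> eval b \<otimes>\<^bsub>B\<^esub> x"
      unfolding eval_diff[OF a b] using eval_closed[OF a] eval_closed[OF b] xB
      by (simp add: a_minus_def B.l_distr B.l_minus)
    then show "eval (a - b) \<otimes>\<^bsub>B\<^esub> x \<in> frob_span q A B f X"
      using IH by (simp add: frob_span_def additive_span.diff)
  qed
  then show ?thesis
    using t by (simp add: rel_frob_class)
qed

text \<open>
Finiteness of \<open>\<Phi>\<^sub>e\<close> depends only on its image, whose multiples of \<open>X\<close> span \<^const>\<open>frob_span\<close>. For the
converse, the coefficient of a generator \<open>b\<^sup>q f(a) x\<close> is \<open>b \<otimes> a\<close> at \<open>x\<close> and zero elsewhere, and linear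
combinations are closed under differences.
\<close>

lemma finite_rel_frob_iff:
  "finite_ring_map T B \<rho> \<longleftrightarrow> (\<exists>X. finite X \<and> X \<subseteq> carrier B \<and> carrier B \<subseteq> frob_span q A B f X)"
proof
  assume "finite_ring_map T B \<rho>"
  then obtain X where X: "finite X" "X \<subseteq> carrier B"
    and gen: "\<And>m. m \<in> carrier B \<Longrightarrow> \<exists>c\<in>X \<rightarrow> carrier T. m = (\<Oplus>\<^bsub>B\<^esub>x\<in>X. \<rho> (c x) \<otimes>\<^bsub>B\<^esub> x)"
    by (auto simp: finite_ring_map_def fin_gen_module_def finsum_scalars_via)
  have "m \<in> frob_span q A B f X" if mB: "m \<in> carrier B" for m
  proof -
    obtain c where c: "c \<in> X \<rightarrow> carrier T" and m: "m = (\<Oplus>\<^bsub>B\<^esub>x\<in>X. \<rho> (c x) \<otimes>\<^bsub>B\<^esub> x)"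
      using gen[OF mB] by (elim bexE)
    have "\<rho> (c x) \<otimes>\<^bsub>B\<^esub> x \<in> frob_span q A B f X" if "x \<in> X" for x
      by (rule rel_frob_mult_frob_span[OF _ that X(2)]) (use c that in auto)
    then have "(\<Oplus>\<^bsub>B\<^esub>x\<in>X. \<rho> (c x) \<otimes>\<^bsub>B\<^esub> x) \<in> frob_span q A B f X"
      unfolding frob_span_def by (rule B.additive_span_finsum[OF frob_gens_in_carrier[OF X(2)]])
    then show ?thesis
      by (simp only: m)
  qed
  with X show "\<exists>X. finite X \<and> X \<subseteq> carrier B \<and> carrier B \<subseteq> frob_span q A B f X"
    by blast
next
  assume "\<exists>X. finite X \<and> X \<subseteq> carrier B \<and> carrier B \<subseteq> frob_span q A B f X"
  then obtain X where X: "finite X" "X \<subseteq> carrier B" and span: "carrier B \<subseteq> frob_span q A B f X"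
    by blast
  let ?s = "\<lambda>c. \<Oplus>\<^bsub>B\<^esub>x\<in>X. \<rho> (c x) \<otimes>\<^bsub>B\<^esub> x"
  define K where "K = {m. \<exists>c\<in>X \<rightarrow> carrier T. m = ?s c}"
  have "m \<in> K" if "m \<in> carrier B" for m
  proof -
    have "m \<in> additive_span B (frob_gens q A B f X)"
      using span that by (auto simp: frob_span_def)
    then show ?thesis
    proof (rule additive_span_least)
      show "frob_gens q A B f X \<subseteq> K"
      proof clarify
        fix b a x assume *: "b \<in> carrier B" "a \<in> carrier A" "x \<in> X"
        define c where "c y = (if x = y then pure_tensor A (scalars_via f B) (frob_factor p e A) b a else \<zero>\<^bsub>T\<^esub>)" for y
        have \<rho>0: "\<rho> \<zero>\<^bsub>T\<^esub> = \<zero>\<^bsub>B\<^esub>"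
          by (rule ring_hom_zero[OF rel_frob_hom T.ring_axioms B.ring_axioms])
        have "?s c = (\<Oplus>\<^bsub>B\<^esub>y\<in>X. if x = y then b [^]\<^bsub>B\<^esub> q \<otimes>\<^bsub>B\<^esub> f a \<otimes>\<^bsub>B\<^esub> y else \<zero>\<^bsub>B\<^esub>)"
          by (rule B.finsum_cong') (use X * in \<open>auto simp: c_def rel_frob_pure f_simps \<rho>0 subset_eq\<close>)
        also have "\<dots> = b [^]\<^bsub>B\<^esub> q \<otimes>\<^bsub>B\<^esub> f a \<otimes>\<^bsub>B\<^esub> x"
          using X * by (subst B.finsum_singleton) (auto simp: f_simps)
        finally have "b [^]\<^bsub>B\<^esub> q \<otimes>\<^bsub>B\<^esub> f a \<otimes>\<^bsub>B\<^esub> x = ?s c" ..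
        moreover have "c \<in> X \<rightarrow> carrier T"
          using * by (auto simp: c_def pure_closed)
        ultimately show "b [^]\<^bsub>B\<^esub> q \<otimes>\<^bsub>B\<^esub> f a \<otimes>\<^bsub>B\<^esub> x \<in> K"
          by (auto simp: K_def)
      qed
    next
      have "?s (\<lambda>_. \<zero>\<^bsub>T\<^esub>) = \<zero>\<^bsub>B\<^esub>"
        using X ring_hom_zero[OF rel_frob_hom T.ring_axioms B.ring_axioms]
        by (intro B.add.finprod_one_eqI) auto
      moreover have "(\<lambda>_. \<zero>\<^bsub>T\<^esub>) \<in> X \<rightarrow> carrier T" by simp
      ultimately show "\<zero>\<^bsub>B\<^esub> \<in> K"
        unfolding K_def by (intro CollectI bexI[of _ "\<lambda>_. \<zero>\<^bsub>T\<^esub>"]) simp_all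
    next
      fix m n assume "m \<in> K" "n \<in> K"
      then obtain c d where cd: "c \<in> X \<rightarrow> carrier T" "d \<in> X \<rightarrow> carrier T" and [simp]: "m = ?s c" "n = ?s d"
        by (auto simp: K_def)
      define h where "h x = c x \<ominus>\<^bsub>T\<^esub> d x" for x
      have h: "h \<in> X \<rightarrow> carrier T"
        using cd by (simp add: h_def Pi_iff)
      have cl: "\<rho> (k x) \<otimes>\<^bsub>B\<^esub> x \<in> carrier B" if "k \<in> X \<rightarrow> carrier T" "x \<in> X" for k x
        using that X(2) by (simp add: \<rho>_simps Pi_iff subset_eq)
      have "?s c = (\<Oplus>\<^bsub>B\<^esub>x\<in>X. \<rho> (h x) \<otimes>\<^bsub>B\<^esub> x \<oplus>\<^bsub>B\<^esub> \<rho> (d x) \<otimes>\<^bsub>B\<^esub> x)"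
      proof (rule B.finsum_cong')
        fix x assume x: "x \<in> X"
        then have *: "c x \<in> carrier T" "d x \<in> carrier T" "x \<in> carrier B" "h x \<in> carrier T"
          using cd X(2) h by (simp_all add: Pi_iff subset_eq)
        have "\<rho> (c x) = \<rho> (h x) \<oplus>\<^bsub>B\<^esub> \<rho> (d x)"
        proof -
          have "c x = h x \<oplus>\<^bsub>T\<^esub> d x"
            using * by (simp add: h_def a_minus_def T.a_assoc T.l_neg)
          then show ?thesis
            using * by (simp add: \<rho>_simps(2))
        qed
        then show "\<rho> (c x) \<otimes>\<^bsub>B\<^esub> x = \<rho> (h x) \<otimes>\<^bsub>B\<^esub> x \<oplus>\<^bsub>B\<^esub> \<rho> (d x) \<otimes>\<^bsub>B\<^esub> x"
          using * by (simp add: B.l_distr \<rho>_simps)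
      qed (simp_all add: cl[OF h] cl[OF cd(2)])
      also have "\<dots> = ?s h \<oplus>\<^bsub>B\<^esub> ?s d"
        by (intro B.finsum_addf) (simp_all add: cl[OF h] cl[OF cd(2)])
      finally have sum: "?s c = ?s h \<oplus>\<^bsub>B\<^esub> ?s d" .
      have "?s h \<in> carrier B" "?s d \<in> carrier B"
        by (simp_all add: cl[OF h] cl[OF cd(2)])
      then have "m \<ominus>\<^bsub>B\<^esub> n = ?s h"
        by (simp add: sum a_minus_def B.a_assoc B.r_neg)
      with h show "m \<ominus>\<^bsub>B\<^esub> n \<in> K"
        unfolding K_def by (intro CollectI bexI[of _ h])
    qed
  qed
  then have "\<forall>m\<in>carrier B. \<exists>c\<in>X \<rightarrow> carrier T. m = ?s c"
    by (simp add: K_def)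
  with X show "finite_ring_map T B \<rho>"
    unfolding finite_ring_map_def fin_gen_module_def
    by (intro exI[of _ X]) (simp add: finsum_scalars_via)
qed

end

section \<open>Purity of the relative Frobenius\<close>

context frobenius_map
begin

text \<open>
In terms of tensor products: if \<open>\<Phi>\<^sub>e\<close> is pure, then the map \<open>c \<otimes> l \<mapsto> c\<^sup>q \<otimes> l\<close> from \<open>B \<otimes> L\<^sub>e\<close> to
\<open>B \<otimes> L\<close> is injective, where \<open>L\<^sub>e\<close> is \<open>L\<close> with \<open>r\<close> acting as \<open>r\<^sup>q\<close>. Indeed, this map factors as
\<open>c \<otimes> l \<mapsto> (c \<otimes> 1) \<otimes> l\<close> into \<open>(B\<^sup>(\<^sup>e\<^sup>) \<otimes> A) \<otimes> L\<close> followed by \<open>\<Phi>\<^sub>e \<otimes> 1\<close>, which is injective by purity,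
and the first map has the inverse \<open>(c \<otimes> b) \<otimes> l \<mapsto> c \<otimes> b l\<close>.
\<close>

lemma Dumitrescu_reflects_null:
  fixes L :: "('a, (nat \<Rightarrow> 'a) set) module"
  assumes D: "Dumitrescu p e A B f" and L: "module A L"
    and t: "Poly_Mapping.keys t \<subseteq> carrier B \<times> carrier L"
    and null: "frag_extend (\<lambda>(c, l). frag_of (c [^]\<^bsub>B\<^esub> q, l)) t \<in> tensor_null A (scalars_via f B) L"
  shows "t \<in> tensor_null A (scalars_via f B) (restrict_scalars (\<lambda>a. a [^]\<^bsub>A\<^esub> q) L)"
proof -
  let ?B = "scalars_via f B" and ?F = "frob_factor p e A"
  let ?L = "restrict_scalars (\<lambda>a. a [^]\<^bsub>A\<^esub> q) L"
  define i where "i = pure_tensor A ?B ?F \<one>\<^bsub>B\<^esub>"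
  define S where "S = scalars_via i T"
  have i_hom: "i \<in> ring_hom A T"
    using tensor_right_hom[OF algebra_left algebra_right]
    by (auto simp: i_def frob_tensor_def ring_hom_def)
  have S: "module A S"
    unfolding S_def by (rule module_scalars_via[OF A.cring_axioms T.cring_axioms i_hom])
  have [simp]: "carrier S = carrier T" "add S = add T" "r \<odot>\<^bsub>S\<^esub> s = i r \<otimes>\<^bsub>T\<^esub> s" for r s
    by (simp_all add: S_def)
  interpret L: module A L by fact
  have L': "module A ?L"
    by (rule module_restrict_scalars[OF A.cring_axioms L frob_A])
  \<comment> \<open>The image of \<open>t\<close> under \<open>c \<otimes> l \<mapsto> (c \<otimes> 1) \<otimes> l\<close>.\<close>
  define u where "u = frag_extend (\<lambda>(c, l). frag_of (cls (frag_of (c, \<one>\<^bsub>A\<^esub>)), l)) t"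
  have cls1: "cls (frag_of (c, \<one>\<^bsub>A\<^esub>)) \<in> carrier T" if "c \<in> carrier B" for c
    using that by (intro cls_closed) simp
  have u: "Poly_Mapping.keys u \<subseteq> carrier S \<times> carrier L"
    unfolding u_def by (rule keys_frag_extend_subset[OF t]) (auto simp: cls1)
  have u_null: "u \<in> tensor_null A S L"
  proof -
    let ?\<beta> = "\<lambda>s l. pure_tensor A ?B L (\<rho> s) l"
    let ?\<Lambda> = "tensor_lift (tensor A ?B L) ?\<beta>"
    have inj: "inj_on ?\<Lambda> (carrier (tensor A S L))"
      using D L unfolding Dumitrescu_def pure_map_def pure_on_def S_def i_def by blast
    have rho_i: "\<rho> (i r) = f r" if "r \<in> carrier A" for r
      using that by (simp add: i_def rel_frob_pure f_simps)
    have pure_eq: "pure_tensor A ?B L x y = tensor_class A ?B L (frag_of (x, y))" for x y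
      by (simp add: pure_tensor_def)
    have icl: "i r \<in> carrier T" if "r \<in> carrier A" for r
      using ring_hom_closed[OF i_hom] that .
    have sum_keys: "Poly_Mapping.keys (frag_of z + frag_of w) \<subseteq> carrier B \<times> carrier L"
      if "z \<in> carrier B \<times> carrier L" "w \<in> carrier B \<times> carrier L" for z w
      using that keys_add[of "frag_of z" "frag_of w"] by auto
    have bal: "balanced_map A S L (tensor A ?B L) ?\<beta>"
      unfolding balanced_map_def pure_eq
    proof (intro conjI ballI)
      show "tensor_class A ?B L (frag_of (\<rho> x, y)) \<in> carrier (tensor A ?B L)"
        if "x \<in> carrier S" "y \<in> carrier L" for x y
        using that by (intro tensor_class_closed[OF module_left L]) (simp add: \<rho>_simps)
      show "tensor_class A ?B L (frag_of (\<rho> (x \<oplus>\<^bsub>S\<^esub> x'), y))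
          = tensor_class A ?B L (frag_of (\<rho> x, y)) \<oplus>\<^bsub>tensor A ?B L\<^esub> tensor_class A ?B L (frag_of (\<rho> x', y))"
        if "x \<in> carrier S" "x' \<in> carrier S" "y \<in> carrier L" for x x' y
        using that tensor_null_add_left[OF module_left L, of "\<rho> x" "\<rho> x'" y]
        by (simp add: tensor_add[OF module_left L] \<rho>_simps tensor_class_eq_iff[OF module_left L] sum_keys
            diff_diff_eq)
      show "tensor_class A ?B L (frag_of (\<rho> x, y \<oplus>\<^bsub>L\<^esub> y'))
          = tensor_class A ?B L (frag_of (\<rho> x, y)) \<oplus>\<^bsub>tensor A ?B L\<^esub> tensor_class A ?B L (frag_of (\<rho> x, y'))"
        if "x \<in> carrier S" "y \<in> carrier L" "y' \<in> carrier L" for x y y'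
        using that tensor_null_add_right[OF module_left L, of "\<rho> x" y y']
        by (simp add: tensor_add[OF module_left L] \<rho>_simps tensor_class_eq_iff[OF module_left L] sum_keys
            diff_diff_eq)
      show "tensor_class A ?B L (frag_of (\<rho> (r \<odot>\<^bsub>S\<^esub> x), y)) = tensor_class A ?B L (frag_of (\<rho> x, r \<odot>\<^bsub>L\<^esub> y))"
        if "r \<in> carrier A" "x \<in> carrier S" "y \<in> carrier L" for r x y
        using that tensor_null_smult[OF module_left L, of r "\<rho> x" y]
        by (simp add: \<rho>_simps icl rho_i f_simps tensor_class_eq_iff[OF module_left L])
    qed
    have lift: "?\<Lambda> (tensor_class A S L s)
        = tensor_class A ?B L (frag_extend (\<lambda>(s, l). frag_of (\<rho> s, l)) s)"
      if s: "Poly_Mapping.keys s \<subseteq> carrier S \<times> carrier L" for s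
    proof -
      have "?\<Lambda> (tensor_class A S L s) = frag_eval (tensor A ?B L)
          (\<lambda>z. tensor_class A ?B L (case z of (s, l) \<Rightarrow> frag_of (\<rho> s, l))) s"
        unfolding tensor_lift_class[OF S L tensor_abelian_group[OF module_left L] bal s]
        by (simp add: pure_eq case_prod_beta')
      also have "\<dots> = tensor_class A ?B L (frag_extend (\<lambda>(s, l). frag_of (\<rho> s, l)) s)"
        by (rule frag_eval_tensor_class[OF module_left L _ s]) (auto simp: \<rho>_simps)
      finally show ?thesis .
    qed
    have "frag_extend (\<lambda>(s, l). frag_of (\<rho> s, l)) u
        = frag_extend (\<lambda>(c, l). frag_of (c [^]\<^bsub>B\<^esub> q, l)) t"
      unfolding u_def frag_extend_extend
    proof (rule frag_extend_eq)
      fix z assume "z \<in> Poly_Mapping.keys t"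
      then obtain c l where [simp]: "z = (c, l)" and c: "c \<in> carrier B"
        using t by auto
      have "\<rho> (cls (frag_of (c, \<one>\<^bsub>A\<^esub>))) = c [^]\<^bsub>B\<^esub> q"
        using c by (simp add: rel_frob_class eval_of f_simps)
      then show "frag_extend (\<lambda>(s, l). frag_of (\<rho> s, l)) (case z of (c, l) \<Rightarrow> frag_of (cls (frag_of (c, \<one>\<^bsub>A\<^esub>)), l))
          = (case z of (c, l) \<Rightarrow> frag_of (c [^]\<^bsub>B\<^esub> q, l))"
        by simp
    qed
    then have "?\<Lambda> (tensor_class A S L u) = ?\<Lambda> (tensor_class A S L 0)"
      using null tensor_null_in_free[OF module_left L null]
      by (simp add: lift[OF u] lift[of 0] tensor_class_eq_iff[OF module_left L])
    then have "tensor_class A S L u = tensor_class A S L 0"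
      using inj u by (elim inj_onD) (auto intro!: tensor_class_closed[OF S L])
    then show ?thesis
      using u by (simp add: tensor_class_eq_iff[OF S L])
  qed
  define K where "K = tensor_null A ?B ?L"
  have K0: "0 \<in> K" and Kd: "\<And>a b. a \<in> K \<Longrightarrow> b \<in> K \<Longrightarrow> a - b \<in> K"
    and Ka: "\<And>a b. a \<in> K \<Longrightarrow> b \<in> K \<Longrightarrow> a + b \<in> K"
    unfolding K_def using tensor_null_0[OF module_left L'] tensor_null_diff[OF module_left L'] tensor_null_add[OF module_left L'] by auto
  \<comment> \<open>The maps \<open>E l\<close> and \<open>h\<close> realise \<open>(c \<otimes> b) \<otimes> l \<mapsto> c \<otimes> b l\<close>, on representatives \<open>rep s\<close> of the
    left factor; up to null tensors the choice of a representative does not matter.\<close>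
  define E :: "(nat \<Rightarrow> 'a) set \<Rightarrow> ('b \<times> 'a \<Rightarrow>\<^sub>0 int) \<Rightarrow> ('b \<times> (nat \<Rightarrow> 'a) set \<Rightarrow>\<^sub>0 int)"
    where "E l = frag_extend (\<lambda>(c, b). frag_of (c, b \<odot>\<^bsub>L\<^esub> l))" for l
  have E_diff: "E l (r - r') = E l r - E l r'" and E_add: "E l (r + r') = E l r + E l r'" for l r r'
    by (simp_all add: E_def frag_extend_diff frag_extend_add)
  have E_null: "E l r \<in> K" if "r \<in> tensor_null A ?B ?F" "l \<in> carrier L" for l r
    unfolding E_def K_def
    by (rule tensor_null_map[OF module_left module_right module_left L' that(1)])
       (use that(2) in \<open>auto simp: L.smult_l_distr L.smult_assoc1\<close>)
  define rep where "rep s = (SOME r. r \<in> s)" for s :: "('b \<times> 'a \<Rightarrow>\<^sub>0 int) set"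
  have rep: "rep (cls r) - r \<in> tensor_null A ?B ?F" for r
  proof -
    have "r \<in> cls r"
      using mem_tensor_class[OF module_left module_right, of r r] tensor_null_0[OF module_left module_right] by simp
    then have "rep (cls r) \<in> cls r"
      unfolding rep_def by (rule someI)
    then show ?thesis
      using mem_tensor_class[OF module_left module_right] by blast
  qed
  have rep_free: "tensor_frag (rep s) \<and> cls (rep s) = s"
    if s: "s \<in> carrier T" for s
  proof -
    obtain r where r: "tensor_frag r" "s = cls r"
      using s by (rule frob_tensor_cases)
    have "rep s \<in> cls r"
      using rep[of r] r(2) mem_tensor_class[OF module_left module_right] by blast
    then show ?thesis
      using tensor_class_rep[OF module_left module_right, of r "rep s"] r by simp
  qed
  define h where "h z = (case z of (s, l) \<Rightarrow> E l (rep s))" for z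
  have "frag_extend h u \<in> K"
  proof (rule tensor_null_extend[OF S L u_null K0 Kd], simp_all add: h_def)
    fix s s' l assume s: "s \<in> carrier T" "s' \<in> carrier T" and l: "l \<in> carrier L"
    have "s \<oplus>\<^bsub>T\<^esub> s' = cls (rep s + rep s')"
      using tensor_add[OF module_left module_right, of "rep s" "rep s'"] rep_free[OF s(1)] rep_free[OF s(2)]
      by (simp add: frob_tensor_def)
    then have "rep (s \<oplus>\<^bsub>T\<^esub> s') - (rep s + rep s') \<in> tensor_null A ?B ?F"
      using rep by simp
    from E_null[OF this l]
    show "E l (rep (s \<oplus>\<^bsub>T\<^esub> s')) - E l (rep s) - E l (rep s') \<in> K"
      by (simp add: E_diff E_add diff_diff_eq)
  next
    fix s l l' assume s: "s \<in> carrier T" and l: "l \<in> carrier L" "l' \<in> carrier L"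
    have *: "E (l \<oplus>\<^bsub>L\<^esub> l') r - E l r - E l' r
        = frag_extend (\<lambda>(c, b). frag_of (c, b \<odot>\<^bsub>L\<^esub> (l \<oplus>\<^bsub>L\<^esub> l')) - frag_of (c, b \<odot>\<^bsub>L\<^esub> l) - frag_of (c, b \<odot>\<^bsub>L\<^esub> l')) r" for r
      by (simp add: E_def frag_extend_pointwise_diff case_prod_beta')
    show "E (l \<oplus>\<^bsub>L\<^esub> l') (rep s) - E l (rep s) - E l' (rep s) \<in> K"
      unfolding *
      by (rule frag_extend_mem[OF conjunct1[OF rep_free[OF s]] _ K0 Kd])
         (use l tensor_null_add_right[OF module_left L'] in \<open>auto simp: L.smult_r_distr K_def\<close>)
  next
    fix r s l assume r: "r \<in> carrier A" and s: "s \<in> carrier T" and l: "l \<in> carrier L"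
    let ?m = "frag_mult ?B ?F (frag_of (\<one>\<^bsub>B\<^esub>, r)) (rep s)"
    have "i r \<otimes>\<^bsub>T\<^esub> s = cls ?m"
      using tensor_mult[OF algebra_left algebra_right, of "frag_of (\<one>\<^bsub>B\<^esub>, r)" "rep s"] rep_free[OF s] r
      by (simp add: frob_tensor_def i_def pure_tensor_def)
    then have "rep (i r \<otimes>\<^bsub>T\<^esub> s) - ?m \<in> tensor_null A ?B ?F"
      using rep by simp
    from E_null[OF this l] have "E l (rep (i r \<otimes>\<^bsub>T\<^esub> s)) - E l ?m \<in> K"
      by (simp add: E_diff)
    moreover have "E l ?m = E (r \<odot>\<^bsub>L\<^esub> l) (rep s)"
    proof -
      have "E l ?m = frag_extend (\<lambda>(c, b). frag_of (\<one>\<^bsub>B\<^esub> \<otimes>\<^bsub>B\<^esub> c, (r \<otimes>\<^bsub>A\<^esub> b) \<odot>\<^bsub>L\<^esub> l)) (rep s)"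
        by (simp add: E_def frag_mult_def frag_extend_extend case_prod_beta')
      also have "\<dots> = E (r \<odot>\<^bsub>L\<^esub> l) (rep s)"
        unfolding E_def
        by (rule frag_extend_eq)
           (use conjunct1[OF rep_free[OF s]] r l L.smult_assoc1 A.m_comm in \<open>fastforce simp: L.smult_assoc1[symmetric]\<close>)
      finally show ?thesis .
    qed
    ultimately show "E l (rep (i r \<otimes>\<^bsub>T\<^esub> s)) - E (r \<odot>\<^bsub>L\<^esub> l) (rep s) \<in> K"
      by simp
  qed
  moreover have "frag_extend h u - t \<in> K"
  proof -
    have "frag_extend h u - t = frag_extend (\<lambda>(c, l). h (cls (frag_of (c, \<one>\<^bsub>A\<^esub>)), l) - frag_of (c, l)) t"
      using frag_expansion[of t]
      by (simp add: u_def frag_extend_extend case_prod_beta' frag_extend_pointwise_diff)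
    also have "\<dots> \<in> K"
    proof (rule frag_extend_mem[OF t _ K0 Kd], clarify)
      fix c l assume "c \<in> carrier B" and l: "l \<in> carrier L"
      have "E l (rep (cls (frag_of (c, \<one>\<^bsub>A\<^esub>))) - frag_of (c, \<one>\<^bsub>A\<^esub>)) \<in> K"
        by (rule E_null[OF rep l])
      then show "h (cls (frag_of (c, \<one>\<^bsub>A\<^esub>)), l) - frag_of (c, l) \<in> K"
        using l by (simp add: h_def E_diff) (simp add: E_def)
    qed
    finally show ?thesis .
  qed
  ultimately have "frag_extend h u - (frag_extend h u - t) \<in> K"
    by (rule Kd)
  then show ?thesis
    by (simp add: K_def)
qed

end

section \<open>Quotients and change of type\<close>

text \<open>
The module structure transported along \<open>\<pi>\<close>. When the fibres of \<open>\<pi>\<close> are the cosets of a submodule \<open>W\<close>,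
this is the quotient by \<open>W\<close>, and with \<open>W = 0\<close> an isomorphic copy. The target type is free, so that
quotients and copies can be placed in the one type over which \<^const>\<open>pure_map\<close> quantifies.
\<close>

definition image_module ::
  "('m \<Rightarrow> 'k) \<Rightarrow> ('r, 'm, 'v) module_scheme \<Rightarrow> ('r, 'k) module"
  where "image_module \<pi> M =
    \<lparr>carrier = \<pi> ` carrier M, monoid.mult = undefined, one = undefined, zero = \<pi> \<zero>\<^bsub>M\<^esub>,
     add = (\<lambda>x y. \<pi> (inv_into (carrier M) \<pi> x \<oplus>\<^bsub>M\<^esub> inv_into (carrier M) \<pi> y)),
     smult = (\<lambda>r x. \<pi> (r \<odot>\<^bsub>M\<^esub> inv_into (carrier M) \<pi> x))\<rparr>"

context
  fixes R :: "('r, 'u) ring_scheme" and M :: "('r, 'm, 'v) module_scheme" and W :: "'m set"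
    and \<pi> :: "'m \<Rightarrow> 'k"
  assumes M: "module R M" and W: "submodule W R M"
    and fibres: "\<forall>x\<in>carrier M. \<forall>y\<in>carrier M. \<pi> x = \<pi> y \<longleftrightarrow> x \<ominus>\<^bsub>M\<^esub> y \<in> W"
begin

interpretation M: module R M by (rule M)

lemma image_module_simps:
  "carrier (image_module \<pi> M) = \<pi> ` carrier M"
  "\<zero>\<^bsub>image_module \<pi> M\<^esub> = \<pi> \<zero>\<^bsub>M\<^esub>"
  "x \<in> carrier M \<Longrightarrow> y \<in> carrier M \<Longrightarrow> \<pi> x \<oplus>\<^bsub>image_module \<pi> M\<^esub> \<pi> y = \<pi> (x \<oplus>\<^bsub>M\<^esub> y)"
  "r \<in> carrier R \<Longrightarrow> x \<in> carrier M \<Longrightarrow> r \<odot>\<^bsub>image_module \<pi> M\<^esub> \<pi> x = \<pi> (r \<odot>\<^bsub>M\<^esub> x)"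
proof -
  let ?s = "inv_into (carrier M) \<pi>"
  note WE = M.submoduleE[OF W]
  have fib: "\<pi> x = \<pi> y \<longleftrightarrow> x \<ominus>\<^bsub>M\<^esub> y \<in> W" if "x \<in> carrier M" "y \<in> carrier M" for x y
    using fibres that by blast
  have s: "?s (\<pi> x) \<in> carrier M" "?s (\<pi> x) \<ominus>\<^bsub>M\<^esub> x \<in> W" if "x \<in> carrier M" for x
  proof -
    show 1: "?s (\<pi> x) \<in> carrier M"
      using that by (auto intro: inv_into_into)
    have "\<pi> (?s (\<pi> x)) = \<pi> x"
      using that by (intro f_inv_into_f) auto
    then show "?s (\<pi> x) \<ominus>\<^bsub>M\<^esub> x \<in> W"
      using fib[OF 1 that] by simp
  qed
  show "carrier (image_module \<pi> M) = \<pi> ` carrier M" "\<zero>\<^bsub>image_module \<pi> M\<^esub> = \<pi> \<zero>\<^bsub>M\<^esub>"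
    by (simp_all add: image_module_def)
  show "\<pi> x \<oplus>\<^bsub>image_module \<pi> M\<^esub> \<pi> y = \<pi> (x \<oplus>\<^bsub>M\<^esub> y)" if "x \<in> carrier M" "y \<in> carrier M"
  proof -
    have "(?s (\<pi> x) \<oplus>\<^bsub>M\<^esub> ?s (\<pi> y)) \<ominus>\<^bsub>M\<^esub> (x \<oplus>\<^bsub>M\<^esub> y) \<in> W"
      using s[OF that(1)] s[OF that(2)] that WE(5) by (simp add: M.add_diff_eq)
    then show ?thesis
      using s[OF that(1)] s[OF that(2)] that by (simp add: image_module_def fib)
  qed
  show "r \<odot>\<^bsub>image_module \<pi> M\<^esub> \<pi> x = \<pi> (r \<odot>\<^bsub>M\<^esub> x)" if "r \<in> carrier R" "x \<in> carrier M"
  proof -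
    have "r \<odot>\<^bsub>M\<^esub> ?s (\<pi> x) \<ominus>\<^bsub>M\<^esub> r \<odot>\<^bsub>M\<^esub> x = r \<odot>\<^bsub>M\<^esub> (?s (\<pi> x) \<ominus>\<^bsub>M\<^esub> x)"
      using s[OF that(2)] that by (simp add: a_minus_def M.smult_r_distr M.smult_r_minus)
    then have "r \<odot>\<^bsub>M\<^esub> ?s (\<pi> x) \<ominus>\<^bsub>M\<^esub> r \<odot>\<^bsub>M\<^esub> x \<in> W"
      using s[OF that(2)] that WE(4) by simp
    then show ?thesis
      using s[OF that(2)] that by (simp add: image_module_def fib)
  qed
qed

lemma image_module_module: "module R (image_module \<pi> M)"
proof -
  have "abelian_group (image_module \<pi> M)"
  proof (rule abelian_groupI)
    fix X assume "X \<in> carrier (image_module \<pi> M)"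
    then obtain x where x: "x \<in> carrier M" "X = \<pi> x"
      by (auto simp: image_module_simps)
    then show "\<exists>Y\<in>carrier (image_module \<pi> M). Y \<oplus>\<^bsub>image_module \<pi> M\<^esub> X = \<zero>\<^bsub>image_module \<pi> M\<^esub>"
      by (intro bexI[of _ "\<pi> (\<ominus>\<^bsub>M\<^esub> x)"]) (auto simp: image_module_simps M.l_neg)
  qed (auto simp: image_module_simps M.a_ac)
  then show ?thesis
    by (rule moduleI[OF M.R.cring_axioms])
       (auto simp: image_module_simps M.smult_l_distr M.smult_r_distr M.smult_assoc1)
qed

end

lemma (in module) zero_submodule: "submodule {\<zero>\<^bsub>M\<^esub>} R M"
  by (rule submoduleI) (auto simp: M.add.inv_one)

lemma (in module) submodule_diff:
  assumes "submodule W R M" "x \<in> W" "y \<in> W"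
  shows "x \<ominus>\<^bsub>M\<^esub> y \<in> W"
  using submoduleE(3,5)[OF assms(1)] assms(2,3) by (simp add: a_minus_def)

lemma (in module) submodule_zero: "submodule W R M \<Longrightarrow> \<zero>\<^bsub>M\<^esub> \<in> W"
  using subgroup.one_closed[OF submodule.axioms(1)] by fastforce

context frobenius_map
begin

text \<open>
Injectivity of \<open>\<Phi>\<^sub>e\<close>, which is purity tested on \<open>L = A\<close>: there, \<open>c\<^sup>q \<otimes> a = c\<^sup>q f(a) \<otimes> 1\<close>, so an element
with value zero under \<open>\<Phi>\<^sub>e\<close> becomes null in \<open>B \<otimes> L\<close>, and \<open>Dumitrescu_reflects_null\<close> applies.
\<close>

lemma Dumitrescu_null_if_eval_zero:
  assumes D: "Dumitrescu p e A B f" and t: "tensor_frag t"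
    and zero: "eval t = \<zero>\<^bsub>B\<^esub>"
  shows "t \<in> tensor_null A (scalars_via f B) (frob_factor p e A)"
proof -
  let ?B = "scalars_via f B" and ?F = "frob_factor p e A"
  define M where "M = scalars_via id A"
  \<comment> \<open>A copy of \<open>A\<close> in the type over which purity quantifies.\<close>
  define j :: "'a \<Rightarrow> (nat \<Rightarrow> 'a) set" where "j a = {\<lambda>_. a}" for a
  define L where "L = image_module j M"
  have j_inj: "j a = j b \<longleftrightarrow> a = b" for a b
    by (auto simp: j_def fun_eq_iff)
  have M: "module A M"
    unfolding M_def by (rule module_scalars_via[OF A.cring_axioms A.cring_axioms]) (auto simp: ring_hom_def)
  interpret M: module A M by fact
  have Ms [simp]: "carrier M = carrier A" "zero M = zero A" "add M = add A" "r \<odot>\<^bsub>M\<^esub> x = r \<otimes>\<^bsub>A\<^esub> x" for r x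
    by (simp_all add: M_def)
  have minus: "x \<ominus>\<^bsub>M\<^esub> y = x \<ominus>\<^bsub>A\<^esub> y" for x y
    by (simp add: a_minus_def a_inv_def m_inv_def)
  have fib: "\<forall>x\<in>carrier M. \<forall>y\<in>carrier M. j x = j y \<longleftrightarrow> x \<ominus>\<^bsub>M\<^esub> y \<in> {\<zero>\<^bsub>M\<^esub>}"
    by (auto simp: j_inj minus)
  note Lsimps = image_module_simps[OF M M.zero_submodule fib, folded L_def]
  have L: "module A L"
    unfolding L_def by (rule image_module_module[OF M M.zero_submodule fib])
  interpret L: module A L by fact
  let ?L = "restrict_scalars (\<lambda>a. a [^]\<^bsub>A\<^esub> q) L"
  have L': "module A ?L"
    by (rule module_restrict_scalars[OF A.cring_axioms L frob_A])
  define t' where "t' = frag_extend (\<lambda>(c, a). frag_of (c, j a)) t"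
  have t': "Poly_Mapping.keys t' \<subseteq> carrier B \<times> carrier L"
    unfolding t'_def by (rule keys_frag_extend_subset[OF t]) (auto simp: Lsimps)
  define u where "u s = frag_extend (\<lambda>(c, a). frag_of (c [^]\<^bsub>B\<^esub> q, j a)) s" for s
  define N where "N = tensor_null A ?B L"
  note Nnull = tensor_null_0[OF module_left L, folded N_def] tensor_null_diff[OF module_left L, folded N_def]
    tensor_null_add[OF module_left L, folded N_def] tensor_null_uminus[OF module_left L, folded N_def]
  have j1: "j \<one>\<^bsub>A\<^esub> \<in> carrier L"
    by (simp add: Lsimps)
  have addl: "frag_of (x \<oplus>\<^bsub>B\<^esub> y, j \<one>\<^bsub>A\<^esub>) - frag_of (x, j \<one>\<^bsub>A\<^esub>) - frag_of (y, j \<one>\<^bsub>A\<^esub>) \<in> N"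
    if "x \<in> carrier B" "y \<in> carrier B" for x y
    using tensor_null_add_left[OF module_left L, of x y "j \<one>\<^bsub>A\<^esub>"] that j1 by (simp add: N_def)
  have null0: "frag_of (\<zero>\<^bsub>B\<^esub>, j \<one>\<^bsub>A\<^esub>) \<in> N"
    using Nnull(4)[OF addl[of "\<zero>\<^bsub>B\<^esub>" "\<zero>\<^bsub>B\<^esub>"]] by simp
  have "u t - frag_of (eval t, j \<one>\<^bsub>A\<^esub>) \<in> N"
    using t
  proof (rule free_Abelian_group_induct)
    show "u 0 - frag_of (eval 0, j \<one>\<^bsub>A\<^esub>) \<in> N"
      using Nnull(4)[OF null0] by (simp add: u_def frag_eval_def)
  next
    fix z assume "z \<in> carrier B \<times> carrier A"
    then obtain c a where [simp]: "z = (c, a)" and ca: "c \<in> carrier B" "a \<in> carrier A"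
      by auto
    have "a \<odot>\<^bsub>L\<^esub> j \<one>\<^bsub>A\<^esub> = j a"
      using ca by (simp add: Lsimps)
    then have "frag_of (f a \<otimes>\<^bsub>B\<^esub> c [^]\<^bsub>B\<^esub> q, j \<one>\<^bsub>A\<^esub>) - frag_of (c [^]\<^bsub>B\<^esub> q, j a) \<in> N"
      using tensor_null_smult[OF module_left L, of a "c [^]\<^bsub>B\<^esub> q" "j \<one>\<^bsub>A\<^esub>"] ca j1 by (simp add: N_def)
    from Nnull(4)[OF this] show "u (frag_of z) - frag_of (eval (frag_of z), j \<one>\<^bsub>A\<^esub>) \<in> N"
      using ca by (simp add: u_def eval_of B.m_comm f_simps)
  next
    fix a b assume a: "tensor_frag a"
      and b: "tensor_frag b"
      and IH: "u a - frag_of (eval a, j \<one>\<^bsub>A\<^esub>) \<in> N" "u b - frag_of (eval b, j \<one>\<^bsub>A\<^esub>) \<in> N"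
    have "eval a = eval (a - b) \<oplus>\<^bsub>B\<^esub> eval b"
      using eval_closed[OF a] eval_closed[OF b] by (simp add: eval_diff[OF a b] a_minus_def B.a_assoc B.l_neg)
    then have "frag_of (eval a, j \<one>\<^bsub>A\<^esub>) - frag_of (eval (a - b), j \<one>\<^bsub>A\<^esub>) - frag_of (eval b, j \<one>\<^bsub>A\<^esub>) \<in> N"
      using addl[of "eval (a - b)" "eval b"] eval_closed[OF a] eval_closed[OF b]
      by (simp add: eval_diff[OF a b])
    from Nnull(3)[OF Nnull(2)[OF IH] this]
    show "u (a - b) - frag_of (eval (a - b), j \<one>\<^bsub>A\<^esub>) \<in> N"
      by (simp add: u_def frag_extend_diff algebra_simps)
  qed
  then have "u t \<in> N"
    using Nnull(3)[OF _ null0] zero by fastforce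
  moreover have "frag_extend (\<lambda>(c, l). frag_of (c [^]\<^bsub>B\<^esub> q, l)) t' = u t"
    by (simp add: t'_def u_def frag_extend_extend case_prod_beta')
  ultimately have t'_null: "t' \<in> tensor_null A ?B ?L"
    using Dumitrescu_reflects_null[OF D L t'] by (simp add: N_def)
  define v where "v l = the_elem ((\<lambda>h. h 0) ` l)" for l :: "(nat \<Rightarrow> 'a) set"
  have v [simp]: "v (j a) = a" for a
    by (simp add: v_def j_def)
  have "frag_extend (\<lambda>(c, l). frag_of (c, v l)) t' \<in> tensor_null A ?B ?F"
    by (rule tensor_null_map[OF module_left L' module_left module_right t'_null]) (auto simp: Lsimps)
  moreover have "frag_extend (\<lambda>(c, l). frag_of (c, v l)) t' = t"
    using frag_expansion[of t]
    by (simp add: t'_def frag_extend_extend case_prod_beta')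
  ultimately show ?thesis by simp
qed

end

section \<open>Submodules avoiding a vector\<close>

text \<open>
Zorn's lemma gives a submodule \<open>W\<close> maximal among those without \<open>x\<close>. For \<open>y \<notin> W\<close>, the larger submodule
\<open>W + R y\<close> must contain \<open>x\<close>.
\<close>

lemma (in module) submodule_avoiding:
  assumes N: "submodule N R M" and x: "x \<in> carrier M" "x \<notin> N"
  obtains W where "submodule W R M" "N \<subseteq> W" "x \<notin> W"
    "\<And>y. y \<in> carrier M \<Longrightarrow> y \<notin> W \<Longrightarrow> \<exists>r\<in>carrier R. \<exists>w\<in>W. x = w \<oplus>\<^bsub>M\<^esub> r \<odot>\<^bsub>M\<^esub> y"
proof -
  define \<A> where "\<A> = {W. submodule W R M \<and> N \<subseteq> W \<and> x \<notin> W}"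
  have "\<exists>W\<in>\<A>. \<forall>X\<in>\<A>. W \<subseteq> X \<longrightarrow> X = W"
  proof (rule subset_Zorn_nonempty)
    show "\<A> \<noteq> {}"
    proof -
      have "N \<in> \<A>" using N x by (simp add: \<A>_def)
      then show ?thesis by auto
    qed
    fix \<C> assume ne: "\<C> \<noteq> {}" and ch: "subset.chain \<A> \<C>"
    then have sub: "\<And>W. W \<in> \<C> \<Longrightarrow> submodule W R M"
      and C: "\<And>W. W \<in> \<C> \<Longrightarrow> N \<subseteq> W \<and> x \<notin> W"
      by (auto simp: subset.chain_def \<A>_def)
    have "submodule (\<Union>\<C>) R M"
    proof (rule submoduleI)
      show "\<Union>\<C> \<subseteq> carrier M"
        using submoduleE(1)[OF sub] by (rule Union_least)
      show "\<zero>\<^bsub>M\<^esub> \<in> \<Union>\<C>"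
      proof -
        obtain W where "W \<in> \<C>" using ne by auto
        then show ?thesis by (rule UnionI) (rule submodule_zero[OF sub], fact)
      qed
      show "\<ominus>\<^bsub>M\<^esub> a \<in> \<Union>\<C>" if "a \<in> \<Union>\<C>" for a
        using that by (elim UnionE) (rule UnionI, assumption, rule submoduleE(3)[OF sub])
      show "r \<odot>\<^bsub>M\<^esub> a \<in> \<Union>\<C>" if "r \<in> carrier R" "a \<in> \<Union>\<C>" for r a
        using that(2) by (elim UnionE) (rule UnionI, assumption, rule submoduleE(4)[OF sub], assumption, rule that(1))
      fix a b assume "a \<in> \<Union>\<C>" "b \<in> \<Union>\<C>"
      then obtain V W where VW: "V \<in> \<C>" "W \<in> \<C>" "a \<in> V" "b \<in> W"
        by blast
      then have "V \<subseteq> W \<or> W \<subseteq> V"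
        using ch by (auto simp: subset_chain_def)
      then show "a \<oplus>\<^bsub>M\<^esub> b \<in> \<Union>\<C>"
        using VW submoduleE(5)[OF sub[OF VW(1)], of a b] submoduleE(5)[OF sub[OF VW(2)], of a b] by auto
    qed
    moreover have "N \<subseteq> \<Union>\<C>" "x \<notin> \<Union>\<C>"
      using C ne by auto
    ultimately show "\<Union>\<C> \<in> \<A>"
      by (simp add: \<A>_def)
  qed
  then obtain W where W\<A>: "W \<in> \<A>" and W_max: "\<forall>X\<in>\<A>. W \<subseteq> X \<longrightarrow> X = W"
    by (rule bexE)
  have W: "submodule W R M" "N \<subseteq> W" "x \<notin> W"
    using W\<A> by (simp_all add: \<A>_def)
  have max: "X = W" if "submodule X R M" "x \<notin> X" "W \<subseteq> X" for X
    using that W(2) W_max by (simp add: \<A>_def)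
  note WE = submoduleE[OF W(1)]
  have "\<exists>r\<in>carrier R. \<exists>w\<in>W. x = w \<oplus>\<^bsub>M\<^esub> r \<odot>\<^bsub>M\<^esub> y" if y: "y \<in> carrier M" "y \<notin> W" for y
  proof -
    define X where "X = {w \<oplus>\<^bsub>M\<^esub> r \<odot>\<^bsub>M\<^esub> y | w r. w \<in> W \<and> r \<in> carrier R}"
    have wM: "w \<in> carrier M" if "w \<in> W" for w
      using WE(1) that by blast
    have XI: "z \<in> X" if "z = w \<oplus>\<^bsub>M\<^esub> r \<odot>\<^bsub>M\<^esub> y" "w \<in> W" "r \<in> carrier R" for z w r
      using that unfolding X_def by blast
    have "submodule X R M"
    proof (rule submoduleI)
      show "X \<subseteq> carrier M"
        using wM y by (auto simp: X_def)
      show "\<zero>\<^bsub>M\<^esub> \<in> X"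
        by (rule XI[of _ "\<zero>\<^bsub>M\<^esub>" "\<zero>"]) (use y submodule_zero[OF W(1)] in auto)
    next
      fix a assume "a \<in> X"
      then obtain w r where a: "a = w \<oplus>\<^bsub>M\<^esub> r \<odot>\<^bsub>M\<^esub> y" "w \<in> W" "r \<in> carrier R"
        by (auto simp: X_def)
      then show "\<ominus>\<^bsub>M\<^esub> a \<in> X"
        by (intro XI[of _ "\<ominus>\<^bsub>M\<^esub> w" "\<ominus> r"]) (use y wM WE(3) in \<open>auto simp: M.minus_add smult_l_minus\<close>)
      show "s \<odot>\<^bsub>M\<^esub> a \<in> X" if "s \<in> carrier R" for s
        by (rule XI[of _ "s \<odot>\<^bsub>M\<^esub> w" "s \<otimes> r"])
           (use a that y wM WE(4) in \<open>auto simp: smult_r_distr smult_assoc1\<close>)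
      fix b assume "b \<in> X"
      then obtain v s where b: "b = v \<oplus>\<^bsub>M\<^esub> s \<odot>\<^bsub>M\<^esub> y" "v \<in> W" "s \<in> carrier R"
        by (auto simp: X_def)
      show "a \<oplus>\<^bsub>M\<^esub> b \<in> X"
        by (rule XI[of _ "w \<oplus>\<^bsub>M\<^esub> v" "r \<oplus> s"])
           (use a b y wM WE(5) in \<open>auto simp: smult_l_distr M.a_ac\<close>)
    qed
    moreover have "W \<subseteq> X"
    proof
      fix w assume "w \<in> W"
      then show "w \<in> X"
        by (intro XI[of _ w \<zero>]) (use y wM in auto)
    qed
    moreover have "y \<in> X"
      by (rule XI[of _ "\<zero>\<^bsub>M\<^esub>" \<one>]) (use y submodule_zero[OF W(1)] in auto)
    ultimately have "x \<in> X"
      using max[of X] y by auto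
    then show ?thesis
      by (auto simp: X_def)
  qed
  then show ?thesis
    by (rule that[OF W])
qed

lemma (in cring) maximalideal_inverse:
  assumes m: "maximalideal m R" and r: "r \<in> carrier R" "r \<notin> m"
  obtains s where "s \<in> carrier R" "\<one> \<ominus> s \<otimes> r \<in> m"
proof -
  interpret m: maximalideal m R by fact
  have id: "ideal (m <+> PIdl r) R"
    by (rule add_ideals[OF m.ideal_axioms cgenideal_ideal[OF r(1)]])
  have memI: "a \<oplus> s \<otimes> r \<in> m <+> PIdl r" if "a \<in> m" "s \<in> carrier R" for a s
    using that by (auto simp: set_add_def' cgenideal_def)
  have "m \<subseteq> m <+> PIdl r"
  proof
    fix a assume a: "a \<in> m"
    then show "a \<in> m <+> PIdl r"
      using memI[OF a zero_closed] r m.a_subset by (auto simp: subset_eq)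
  qed
  moreover have "r \<in> m <+> PIdl r"
    using memI[of \<zero> \<one>] r by simp
  moreover have "m <+> PIdl r \<subseteq> carrier R"
    using ideal.Icarr[OF id] by (rule subsetI)
  ultimately have "m <+> PIdl r = carrier R"
    using m.I_maximal[OF id] r by auto
  then have "\<one> \<in> m <+> PIdl r" by simp
  then obtain a s where a: "a \<in> m" "s \<in> carrier R" "\<one> = a \<oplus> s \<otimes> r"
    by (auto simp: set_add_def' cgenideal_def)
  have "a \<in> carrier R"
    using a m.a_subset by blast
  then have "\<one> \<ominus> s \<otimes> r = a"
    using r a by (simp add: a_minus_def a_assoc r_neg)
  with a show ?thesis
    by (intro that[of s]) simp_all
qed

section \<open>Purity at a maximal ideal\<close>

context frobenius_map
begin

text \<open>
A vector \<open>x \<noteq> 0\<close> over the field \<open>A/m\<close> has a linear functional \<open>\<kappa>\<close> with \<open>\<kappa>(x) = 1\<close>, and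
\<open>c \<otimes> y \<mapsto> c f(\<kappa>(y)) + P\<close> is a well-defined map to \<open>B/P\<close>. The kernel of \<open>\<kappa>\<close> is obtained as a maximal
subspace without \<open>x\<close>, which avoids choosing a basis.
\<close>

lemma vector_space_tensor_nonzero:
  assumes L: "module A L" and m: "maximalideal m A"
    and kill: "\<And>t l. t \<in> m \<Longrightarrow> l \<in> carrier L \<Longrightarrow> t \<odot>\<^bsub>L\<^esub> l = \<zero>\<^bsub>L\<^esub>"
    and P: "primeideal P B" and Pm: "\<And>a. a \<in> carrier A \<Longrightarrow> f a \<in> P \<longleftrightarrow> a \<in> m"
    and x: "x \<in> carrier L" and null: "frag_of (\<one>\<^bsub>B\<^esub>, x) \<in> tensor_null A (scalars_via f B) L"
  shows "x = \<zero>\<^bsub>L\<^esub>"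
proof (rule ccontr)
  assume x0: "x \<noteq> \<zero>\<^bsub>L\<^esub>"
  interpret L: module A L by fact
  interpret m: maximalideal m A by fact
  interpret P: primeideal P B by fact
  have m_in: "t \<in> carrier A" if "t \<in> m" for t
    using that m.a_subset by auto
  have P_in: "t \<in> carrier B" if "t \<in> P" for t
    using that P.a_subset by auto
  obtain W where W: "submodule W A L" "x \<notin> W"
    and Wx: "\<And>y. y \<in> carrier L \<Longrightarrow> y \<notin> W \<Longrightarrow> \<exists>r\<in>carrier A. \<exists>w\<in>W. x = w \<oplus>\<^bsub>L\<^esub> r \<odot>\<^bsub>L\<^esub> y"
    using L.submodule_avoiding[OF L.zero_submodule x] x0 by auto
  note WE = L.submoduleE[OF W(1)]
  have W_in: "w \<in> carrier L" if "w \<in> W" for w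
    using that WE(1) by auto
  have W0: "\<zero>\<^bsub>L\<^esub> \<in> W"
    by (rule L.submodule_zero[OF W(1)])
  have one: "s \<odot>\<^bsub>L\<^esub> (r \<odot>\<^bsub>L\<^esub> y) = y"
    if s: "s \<in> carrier A" "\<one>\<^bsub>A\<^esub> \<ominus>\<^bsub>A\<^esub> s \<otimes>\<^bsub>A\<^esub> r \<in> m" and r: "r \<in> carrier A" and y: "y \<in> carrier L" for s r y
  proof -
    let ?a = "\<one>\<^bsub>A\<^esub> \<ominus>\<^bsub>A\<^esub> s \<otimes>\<^bsub>A\<^esub> r"
    have "\<one>\<^bsub>A\<^esub> = ?a \<oplus>\<^bsub>A\<^esub> s \<otimes>\<^bsub>A\<^esub> r"
      using s r by (simp add: a_minus_def A.a_assoc A.l_neg)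
    then have "y = (?a \<oplus>\<^bsub>A\<^esub> s \<otimes>\<^bsub>A\<^esub> r) \<odot>\<^bsub>L\<^esub> y"
      using y by simp
    also have "\<dots> = s \<odot>\<^bsub>L\<^esub> (r \<odot>\<^bsub>L\<^esub> y)"
      using kill[OF s(2) y] m_in[OF s(2)] s r y by (simp add: L.smult_l_distr L.smult_assoc1)
    finally show ?thesis ..
  qed
  \<comment> \<open>Modulo \<open>W\<close> every vector is a multiple of \<open>x\<close>, by a scalar that is unique modulo \<open>m\<close>.\<close>
  have ex: "\<exists>b\<in>carrier A. y \<ominus>\<^bsub>L\<^esub> b \<odot>\<^bsub>L\<^esub> x \<in> W" if y: "y \<in> carrier L" for y
  proof (cases "y \<in> W")
    case True
    then show ?thesis
      using y x by (intro bexI[of _ "\<zero>\<^bsub>A\<^esub>"]) (simp_all add: L.minus_zero_right)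
  next
    case False
    then obtain r w where r: "r \<in> carrier A" and w: "w \<in> W" and xw: "x = w \<oplus>\<^bsub>L\<^esub> r \<odot>\<^bsub>L\<^esub> y"
      using Wx[OF y] by auto
    have "r \<notin> m"
      using kill[OF _ y, of r] xw w W(2) W_in[OF w] by auto
    then obtain s where s: "s \<in> carrier A" "\<one>\<^bsub>A\<^esub> \<ominus>\<^bsub>A\<^esub> s \<otimes>\<^bsub>A\<^esub> r \<in> m"
      using A.maximalideal_inverse[OF m r] by auto
    have "s \<odot>\<^bsub>L\<^esub> x = s \<odot>\<^bsub>L\<^esub> w \<oplus>\<^bsub>L\<^esub> y"
      unfolding xw using one[OF s r y] s r y W_in[OF w] by (simp add: L.smult_r_distr)
    then have "y \<ominus>\<^bsub>L\<^esub> s \<odot>\<^bsub>L\<^esub> x = \<ominus>\<^bsub>L\<^esub> (s \<odot>\<^bsub>L\<^esub> w)"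
      using s y W_in[OF w] by (simp add: a_minus_def L.minus_add L.a_ac L.r_neg L.r_neg1 L.r_neg2)
    then show ?thesis
      using WE(3)[OF WE(4)[OF s(1) w]] s(1) by (intro bexI[of _ s]) simp_all
  qed
  have uniq: "b \<in> m" if b: "b \<in> carrier A" "b \<odot>\<^bsub>L\<^esub> x \<in> W" for b
  proof (rule ccontr)
    assume "b \<notin> m"
    then obtain s where s: "s \<in> carrier A" "\<one>\<^bsub>A\<^esub> \<ominus>\<^bsub>A\<^esub> s \<otimes>\<^bsub>A\<^esub> b \<in> m"
      using A.maximalideal_inverse[OF m b(1)] by auto
    then have "x \<in> W"
      using one[OF s b(1) x] WE(4)[OF s(1) b(2)] by simp
    then show False using W(2) by simp
  qed
  obtain \<kappa> where \<kappa>: "\<kappa> y \<in> carrier A" "y \<ominus>\<^bsub>L\<^esub> \<kappa> y \<odot>\<^bsub>L\<^esub> x \<in> W" if "y \<in> carrier L" for y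
    using ex by (metis (no_types, lifting))
  have \<kappa>_add: "\<kappa> (y \<oplus>\<^bsub>L\<^esub> z) \<ominus>\<^bsub>A\<^esub> (\<kappa> y \<oplus>\<^bsub>A\<^esub> \<kappa> z) \<in> m" if y: "y \<in> carrier L" and z: "z \<in> carrier L" for y z
  proof (rule uniq)
    note cl = \<kappa>(1)[OF y] \<kappa>(1)[OF z] \<kappa>(1)[OF L.a_closed[OF y z]]
    show "\<kappa> (y \<oplus>\<^bsub>L\<^esub> z) \<ominus>\<^bsub>A\<^esub> (\<kappa> y \<oplus>\<^bsub>A\<^esub> \<kappa> z) \<in> carrier A"
      using cl by simp
    have "((y \<ominus>\<^bsub>L\<^esub> \<kappa> y \<odot>\<^bsub>L\<^esub> x) \<oplus>\<^bsub>L\<^esub> (z \<ominus>\<^bsub>L\<^esub> \<kappa> z \<odot>\<^bsub>L\<^esub> x)) \<ominus>\<^bsub>L\<^esub> (y \<oplus>\<^bsub>L\<^esub> z \<ominus>\<^bsub>L\<^esub> \<kappa> (y \<oplus>\<^bsub>L\<^esub> z) \<odot>\<^bsub>L\<^esub> x) \<in> W"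
      using \<kappa>(2)[OF y] \<kappa>(2)[OF z] \<kappa>(2)[OF L.a_closed[OF y z]] L.submodule_diff[OF W(1)] WE(5) by simp
    also have "((y \<ominus>\<^bsub>L\<^esub> \<kappa> y \<odot>\<^bsub>L\<^esub> x) \<oplus>\<^bsub>L\<^esub> (z \<ominus>\<^bsub>L\<^esub> \<kappa> z \<odot>\<^bsub>L\<^esub> x)) \<ominus>\<^bsub>L\<^esub> (y \<oplus>\<^bsub>L\<^esub> z \<ominus>\<^bsub>L\<^esub> \<kappa> (y \<oplus>\<^bsub>L\<^esub> z) \<odot>\<^bsub>L\<^esub> x)
        = (\<kappa> (y \<oplus>\<^bsub>L\<^esub> z) \<ominus>\<^bsub>A\<^esub> (\<kappa> y \<oplus>\<^bsub>A\<^esub> \<kappa> z)) \<odot>\<^bsub>L\<^esub> x"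
    proof -
      have e1: "(y \<ominus>\<^bsub>L\<^esub> \<kappa> y \<odot>\<^bsub>L\<^esub> x) \<oplus>\<^bsub>L\<^esub> (z \<ominus>\<^bsub>L\<^esub> \<kappa> z \<odot>\<^bsub>L\<^esub> x) = (y \<oplus>\<^bsub>L\<^esub> z) \<ominus>\<^bsub>L\<^esub> (\<kappa> y \<odot>\<^bsub>L\<^esub> x \<oplus>\<^bsub>L\<^esub> \<kappa> z \<odot>\<^bsub>L\<^esub> x)"
        using cl x y z by (simp add: L.add_diff_eq)
      have e2: "(u \<ominus>\<^bsub>L\<^esub> v) \<ominus>\<^bsub>L\<^esub> (u \<ominus>\<^bsub>L\<^esub> w) = w \<ominus>\<^bsub>L\<^esub> v"
        if "u \<in> carrier L" "v \<in> carrier L" "w \<in> carrier L" for u v w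
        using that by (simp add: a_minus_def L.minus_add L.a_ac L.r_neg L.r_neg1 L.r_neg2)
      have e3: "\<kappa> (y \<oplus>\<^bsub>L\<^esub> z) \<odot>\<^bsub>L\<^esub> x \<ominus>\<^bsub>L\<^esub> (\<kappa> y \<odot>\<^bsub>L\<^esub> x \<oplus>\<^bsub>L\<^esub> \<kappa> z \<odot>\<^bsub>L\<^esub> x)
          = (\<kappa> (y \<oplus>\<^bsub>L\<^esub> z) \<ominus>\<^bsub>A\<^esub> (\<kappa> y \<oplus>\<^bsub>A\<^esub> \<kappa> z)) \<odot>\<^bsub>L\<^esub> x"
        using cl x
        by (simp add: a_minus_def L.smult_l_distr L.smult_l_minus A.minus_add L.minus_add)
      show ?thesis
        unfolding e1 e3[symmetric] using cl x y z by (intro e2) auto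
    qed
    finally show "(\<kappa> (y \<oplus>\<^bsub>L\<^esub> z) \<ominus>\<^bsub>A\<^esub> (\<kappa> y \<oplus>\<^bsub>A\<^esub> \<kappa> z)) \<odot>\<^bsub>L\<^esub> x \<in> W" .
  qed
  have \<kappa>_smult: "r \<otimes>\<^bsub>A\<^esub> \<kappa> y \<ominus>\<^bsub>A\<^esub> \<kappa> (r \<odot>\<^bsub>L\<^esub> y) \<in> m" if r: "r \<in> carrier A" and y: "y \<in> carrier L" for r y
  proof (rule uniq)
    note cl = \<kappa>(1)[OF y] \<kappa>(1)[OF L.smult_closed[OF r y]]
    show "r \<otimes>\<^bsub>A\<^esub> \<kappa> y \<ominus>\<^bsub>A\<^esub> \<kappa> (r \<odot>\<^bsub>L\<^esub> y) \<in> carrier A"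
      using cl r by simp
    have "(r \<odot>\<^bsub>L\<^esub> y \<ominus>\<^bsub>L\<^esub> \<kappa> (r \<odot>\<^bsub>L\<^esub> y) \<odot>\<^bsub>L\<^esub> x) \<ominus>\<^bsub>L\<^esub> r \<odot>\<^bsub>L\<^esub> (y \<ominus>\<^bsub>L\<^esub> \<kappa> y \<odot>\<^bsub>L\<^esub> x) \<in> W"
      using \<kappa>(2)[OF L.smult_closed[OF r y]] WE(4)[OF r \<kappa>(2)[OF y]] by (rule L.submodule_diff[OF W(1)])
    also have "(r \<odot>\<^bsub>L\<^esub> y \<ominus>\<^bsub>L\<^esub> \<kappa> (r \<odot>\<^bsub>L\<^esub> y) \<odot>\<^bsub>L\<^esub> x) \<ominus>\<^bsub>L\<^esub> r \<odot>\<^bsub>L\<^esub> (y \<ominus>\<^bsub>L\<^esub> \<kappa> y \<odot>\<^bsub>L\<^esub> x)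
        = (r \<otimes>\<^bsub>A\<^esub> \<kappa> y \<ominus>\<^bsub>A\<^esub> \<kappa> (r \<odot>\<^bsub>L\<^esub> y)) \<odot>\<^bsub>L\<^esub> x"
    proof -
      have e1: "r \<odot>\<^bsub>L\<^esub> (y \<ominus>\<^bsub>L\<^esub> \<kappa> y \<odot>\<^bsub>L\<^esub> x) = r \<odot>\<^bsub>L\<^esub> y \<ominus>\<^bsub>L\<^esub> (r \<otimes>\<^bsub>A\<^esub> \<kappa> y) \<odot>\<^bsub>L\<^esub> x"
        using cl r x y by (simp add: a_minus_def L.smult_r_distr L.smult_r_minus L.smult_assoc1)
      have e2: "(u \<ominus>\<^bsub>L\<^esub> v) \<ominus>\<^bsub>L\<^esub> (u \<ominus>\<^bsub>L\<^esub> w) = w \<ominus>\<^bsub>L\<^esub> v"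
        if "u \<in> carrier L" "v \<in> carrier L" "w \<in> carrier L" for u v w
        using that by (simp add: a_minus_def L.minus_add L.a_ac L.r_neg L.r_neg1 L.r_neg2)
      have e3: "(r \<otimes>\<^bsub>A\<^esub> \<kappa> y) \<odot>\<^bsub>L\<^esub> x \<ominus>\<^bsub>L\<^esub> \<kappa> (r \<odot>\<^bsub>L\<^esub> y) \<odot>\<^bsub>L\<^esub> x
          = (r \<otimes>\<^bsub>A\<^esub> \<kappa> y \<ominus>\<^bsub>A\<^esub> \<kappa> (r \<odot>\<^bsub>L\<^esub> y)) \<odot>\<^bsub>L\<^esub> x"
        using cl r x y by (simp add: a_minus_def L.smult_l_distr L.smult_l_minus)
      show ?thesis
        unfolding e1 e3[symmetric] using cl r x y by (intro e2) auto
    qed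
    finally show "(r \<otimes>\<^bsub>A\<^esub> \<kappa> y \<ominus>\<^bsub>A\<^esub> \<kappa> (r \<odot>\<^bsub>L\<^esub> y)) \<odot>\<^bsub>L\<^esub> x \<in> W" .
  qed
  have f_diff: "f (a \<ominus>\<^bsub>A\<^esub> b) = f a \<ominus>\<^bsub>B\<^esub> f b" if "a \<in> carrier A" "b \<in> carrier A" for a b
    using that ring_hom_cring.hom_a_inv[OF ring_hom_cring.intro[OF A.cring_axioms B.cring_axioms ring_hom_cring_axioms.intro[OF f]]]
    by (simp add: a_minus_def f_simps)
  have P_diff: "a \<ominus>\<^bsub>B\<^esub> b \<in> P" if "a \<in> P" "b \<in> P" for a b
    using that by (simp add: a_minus_def)
  \<comment> \<open>The balanced map \<open>(c, y) \<mapsto> c f(\<kappa>(y)) + P\<close> sends \<open>(1, x)\<close> to \<open>1 + P \<noteq> 0\<close>.\<close>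
  define h where "h z = (case z of (c, y) \<Rightarrow> c \<otimes>\<^bsub>B\<^esub> f (\<kappa> y))" for z
  have h: "h (c, y) \<in> carrier B" if "c \<in> carrier B" "y \<in> carrier L" for c y
    using that \<kappa>(1) by (simp add: h_def f_simps)
  have "frag_eval B h (frag_of (\<one>\<^bsub>B\<^esub>, x)) \<in> P"
  proof (rule tensor_null_eval[OF module_left L B.is_abelian_group _ _ P_diff _ _ _ null])
    show "h z \<in> carrier B" if "z \<in> carrier (scalars_via f B) \<times> carrier L" for z
      using that h by auto
    show "\<zero>\<^bsub>B\<^esub> \<in> P" by simp
  next
    fix c c' y assume c: "c \<in> carrier (scalars_via f B)" "c' \<in> carrier (scalars_via f B)" and y: "y \<in> carrier L"
    have "f (\<kappa> y) \<in> carrier B"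
      using \<kappa>(1)[OF y] by (simp add: f_simps)
    then have "h (c \<oplus>\<^bsub>B\<^esub> c', y) \<ominus>\<^bsub>B\<^esub> h (c, y) \<ominus>\<^bsub>B\<^esub> h (c', y) = \<zero>\<^bsub>B\<^esub>"
      using c B.r_neg[of "c \<otimes>\<^bsub>B\<^esub> f (\<kappa> y) \<oplus>\<^bsub>B\<^esub> c' \<otimes>\<^bsub>B\<^esub> f (\<kappa> y)"]
      by (simp add: h_def a_minus_def B.l_distr B.minus_add B.a_assoc)
    then show "h (c \<oplus>\<^bsub>scalars_via f B\<^esub> c', y) \<ominus>\<^bsub>B\<^esub> h (c, y) \<ominus>\<^bsub>B\<^esub> h (c', y) \<in> P"
      by (simp del: B.minus_closed)
  next
    fix c y z assume "c \<in> carrier (scalars_via f B)" and y: "y \<in> carrier L" and z: "z \<in> carrier L"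
    then have c: "c \<in> carrier B" by simp
    note cl = \<kappa>(1)[OF y] \<kappa>(1)[OF z] \<kappa>(1)[OF L.a_closed[OF y z]]
    have "c \<otimes>\<^bsub>B\<^esub> f (\<kappa> (y \<oplus>\<^bsub>L\<^esub> z) \<ominus>\<^bsub>A\<^esub> (\<kappa> y \<oplus>\<^bsub>A\<^esub> \<kappa> z)) \<in> P"
      using \<kappa>_add[OF y z] m_in Pm c by (intro P.I_l_closed) auto
    also have "c \<otimes>\<^bsub>B\<^esub> f (\<kappa> (y \<oplus>\<^bsub>L\<^esub> z) \<ominus>\<^bsub>A\<^esub> (\<kappa> y \<oplus>\<^bsub>A\<^esub> \<kappa> z)) = h (c, y \<oplus>\<^bsub>L\<^esub> z) \<ominus>\<^bsub>B\<^esub> h (c, y) \<ominus>\<^bsub>B\<^esub> h (c, z)"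
      using c cl by (simp add: f_diff f_simps h_def)
        (simp add: a_minus_def B.r_distr B.r_minus B.minus_add B.a_assoc f_simps)
    finally show "h (c, y \<oplus>\<^bsub>L\<^esub> z) \<ominus>\<^bsub>B\<^esub> h (c, y) \<ominus>\<^bsub>B\<^esub> h (c, z) \<in> P" .
  next
    fix r c y assume r: "r \<in> carrier A" and "c \<in> carrier (scalars_via f B)" and y: "y \<in> carrier L"
    then have c: "c \<in> carrier B" by simp
    note cl = \<kappa>(1)[OF y] \<kappa>(1)[OF L.smult_closed[OF r y]]
    have "c \<otimes>\<^bsub>B\<^esub> f (r \<otimes>\<^bsub>A\<^esub> \<kappa> y \<ominus>\<^bsub>A\<^esub> \<kappa> (r \<odot>\<^bsub>L\<^esub> y)) \<in> P"
      using \<kappa>_smult[OF r y] m_in Pm c by (intro P.I_l_closed) auto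
    also have "c \<otimes>\<^bsub>B\<^esub> f (r \<otimes>\<^bsub>A\<^esub> \<kappa> y \<ominus>\<^bsub>A\<^esub> \<kappa> (r \<odot>\<^bsub>L\<^esub> y)) = h (r \<odot>\<^bsub>scalars_via f B\<^esub> c, y) \<ominus>\<^bsub>B\<^esub> h (c, r \<odot>\<^bsub>L\<^esub> y)"
      using c r cl by (simp add: f_diff f_simps h_def)
        (simp add: a_minus_def B.r_distr B.r_minus B.m_ac f_simps)
    finally show "h (r \<odot>\<^bsub>scalars_via f B\<^esub> c, y) \<ominus>\<^bsub>B\<^esub> h (c, r \<odot>\<^bsub>L\<^esub> y) \<in> P" .
  qed
  moreover have "frag_eval B h (frag_of (\<one>\<^bsub>B\<^esub>, x)) = h (\<one>\<^bsub>B\<^esub>, x)"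
    by (rule B.frag_eval_of[where S = "carrier B \<times> carrier L"]) (use h x in auto)
  ultimately have "f (\<kappa> x) \<in> P"
    using \<kappa>(1)[OF x] by (simp add: h_def f_simps)
  then have lm: "\<kappa> x \<in> m"
    using Pm \<kappa>(1)[OF x] by simp
  have "x \<ominus>\<^bsub>L\<^esub> \<kappa> x \<odot>\<^bsub>L\<^esub> x = x"
    using kill[OF lm x] x by (simp add: L.minus_zero_right)
  then show False
    using \<kappa>(2)[OF x] W(2) by simp
qed

text \<open>
Passing from \<open>L\<close> to the module on which \<open>r\<close> acts as \<open>r\<^sup>q\<close> lowers the exponent \<open>j\<close> by one and, by
purity of \<open>\<Phi>\<^sub>e\<close>, keeps the hypothesis \<open>1 \<otimes> x = 0\<close>. At \<open>j = 0\<close> the module is a vector space over \<open>A/m\<close>.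
\<close>

lemma torsion_tensor_nonzero:
  fixes L :: "('a, (nat \<Rightarrow> 'a) set) module"
  assumes D: "Dumitrescu p e A B f"
    and m: "maximalideal m A"
    and P: "primeideal P B" and Pm: "\<And>a. a \<in> carrier A \<Longrightarrow> f a \<in> P \<longleftrightarrow> a \<in> m"
  shows "module A L \<Longrightarrow> (\<And>t l. t \<in> m \<Longrightarrow> l \<in> carrier L \<Longrightarrow> t [^]\<^bsub>A\<^esub> (q ^ j) \<odot>\<^bsub>L\<^esub> l = \<zero>\<^bsub>L\<^esub>) \<Longrightarrow>
    x \<in> carrier L \<Longrightarrow> frag_of (\<one>\<^bsub>B\<^esub>, x) \<in> tensor_null A (scalars_via f B) L \<Longrightarrow> x = \<zero>\<^bsub>L\<^esub>"
proof (induction j arbitrary: L)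
  case (0 L)
  have "t \<odot>\<^bsub>L\<^esub> l = \<zero>\<^bsub>L\<^esub>" if "t \<in> m" "l \<in> carrier L" for t l
  proof -
    have "t \<in> carrier A"
      using that(1) m by (meson additive_subgroup.a_Hcarr ideal.axioms(1) maximalideal.axioms(1))
    then show ?thesis
      using 0(2)[OF that] by simp
  qed
  from vector_space_tensor_nonzero[OF 0(1) m this P Pm 0(3,4)] show ?case by simp
next
  case (Suc j L)
  let ?L = "restrict_scalars (\<lambda>a. a [^]\<^bsub>A\<^esub> q) L"
  have L': "module A ?L"
    by (rule module_restrict_scalars[OF A.cring_axioms Suc.prems(1) frob_A])
  have "x = \<zero>\<^bsub>?L\<^esub>"
  proof (rule Suc.IH[OF L'])
    fix t l assume t: "t \<in> m" and l: "l \<in> carrier ?L"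
    have "t \<in> carrier A"
      using t m by (meson additive_subgroup.a_Hcarr ideal.axioms(1) maximalideal.axioms(1))
    then have "(t [^]\<^bsub>A\<^esub> (q ^ j)) [^]\<^bsub>A\<^esub> q = t [^]\<^bsub>A\<^esub> (q ^ Suc j)"
      by (simp add: A.nat_pow_pow mult.commute)
    then show "t [^]\<^bsub>A\<^esub> (q ^ j) \<odot>\<^bsub>?L\<^esub> l = \<zero>\<^bsub>?L\<^esub>"
      using Suc.prems(2)[OF t] l by simp
  next
    show "x \<in> carrier ?L"
      using Suc.prems(3) by simp
    show "frag_of (\<one>\<^bsub>B\<^esub>, x) \<in> tensor_null A (scalars_via f B) ?L"
      by (rule Dumitrescu_reflects_null[OF D Suc.prems(1)]) (use Suc.prems(3,4) in simp_all)
  qed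
  then show ?case by simp
qed

end

section \<open>Essential extensions of a residue field\<close>

context module
begin

lemma annihilator_ideal:
  assumes "y \<in> carrier M"
  shows "ideal {r \<in> carrier R. r \<odot>\<^bsub>M\<^esub> y = \<zero>\<^bsub>M\<^esub>} R"
proof (rule idealI)
  show "subgroup {r \<in> carrier R. r \<odot>\<^bsub>M\<^esub> y = \<zero>\<^bsub>M\<^esub>} (add_monoid R)"
  proof (rule R.add.subgroupI)
    show "{r \<in> carrier R. r \<odot>\<^bsub>M\<^esub> y = \<zero>\<^bsub>M\<^esub>} \<noteq> {}"
    proof -
      have "\<zero> \<in> {r \<in> carrier R. r \<odot>\<^bsub>M\<^esub> y = \<zero>\<^bsub>M\<^esub>}"
        using assms by simp
      then show ?thesis by auto
    qed
    show "\<ominus> r \<in> {r \<in> carrier R. r \<odot>\<^bsub>M\<^esub> y = \<zero>\<^bsub>M\<^esub>}"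
      if "r \<in> {r \<in> carrier R. r \<odot>\<^bsub>M\<^esub> y = \<zero>\<^bsub>M\<^esub>}" for r
      using that assms by (simp add: smult_l_minus M.a_inv_zero)
  qed (use assms in \<open>auto simp: smult_l_distr\<close>)
next
  fix a r assume "a \<in> {r \<in> carrier R. r \<odot>\<^bsub>M\<^esub> y = \<zero>\<^bsub>M\<^esub>}" and r: "r \<in> carrier R"
  then have a: "a \<in> carrier R" "a \<odot>\<^bsub>M\<^esub> y = \<zero>\<^bsub>M\<^esub>" by auto
  show ra: "r \<otimes> a \<in> {r \<in> carrier R. r \<odot>\<^bsub>M\<^esub> y = \<zero>\<^bsub>M\<^esub>}"
    using a r assms by (simp add: smult_assoc1)
  then show "a \<otimes> r \<in> {r \<in> carrier R. r \<odot>\<^bsub>M\<^esub> y = \<zero>\<^bsub>M\<^esub>}"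
    using a r by (simp add: R.m_comm)
qed (rule R.ring_axioms)

context
  fixes x
  assumes x: "x \<in> carrier M" "x \<noteq> \<zero>\<^bsub>M\<^esub>"
    and ess: "\<And>y. y \<in> carrier M \<Longrightarrow> y \<noteq> \<zero>\<^bsub>M\<^esub> \<Longrightarrow> \<exists>r\<in>carrier R. r \<odot>\<^bsub>M\<^esub> y = x"
begin

text \<open>
For \<open>r\<close> outside the annihilator, \<open>x = s r x\<close> for some \<open>s\<close>, so \<open>1 - s r\<close> annihilates \<open>x\<close> and \<open>r\<close> is
invertible modulo the annihilator.
\<close>

lemma annihilator_maximal: "maximalideal {r \<in> carrier R. r \<odot>\<^bsub>M\<^esub> x = \<zero>\<^bsub>M\<^esub>} R"
proof (rule maximalidealI[OF annihilator_ideal[OF x(1)]])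
  have "\<one> \<notin> {r \<in> carrier R. r \<odot>\<^bsub>M\<^esub> x = \<zero>\<^bsub>M\<^esub>}"
    using x by simp
  then show "carrier R \<noteq> {r \<in> carrier R. r \<odot>\<^bsub>M\<^esub> x = \<zero>\<^bsub>M\<^esub>}"
    using R.one_closed by metis
next
  fix J assume J: "ideal J R" and sub: "{r \<in> carrier R. r \<odot>\<^bsub>M\<^esub> x = \<zero>\<^bsub>M\<^esub>} \<subseteq> J" and JR: "J \<subseteq> carrier R"
  interpret J: ideal J R by fact
  show "J = {r \<in> carrier R. r \<odot>\<^bsub>M\<^esub> x = \<zero>\<^bsub>M\<^esub>} \<or> J = carrier R"
  proof (cases "J \<subseteq> {r \<in> carrier R. r \<odot>\<^bsub>M\<^esub> x = \<zero>\<^bsub>M\<^esub>}")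
    case False
    then obtain r where "r \<in> J" "r \<notin> {r \<in> carrier R. r \<odot>\<^bsub>M\<^esub> x = \<zero>\<^bsub>M\<^esub>}"
      unfolding subset_eq by auto
    then have r: "r \<in> J" "r \<in> carrier R" "r \<odot>\<^bsub>M\<^esub> x \<noteq> \<zero>\<^bsub>M\<^esub>"
      using subsetD[OF JR] by simp_all
    have "\<exists>s\<in>carrier R. s \<odot>\<^bsub>M\<^esub> (r \<odot>\<^bsub>M\<^esub> x) = x"
      by (rule ess) (use r x in simp_all)
    then obtain s where s: "s \<in> carrier R" "s \<odot>\<^bsub>M\<^esub> (r \<odot>\<^bsub>M\<^esub> x) = x"
      by (rule bexE)
    have "(\<one> \<ominus> s \<otimes> r) \<odot>\<^bsub>M\<^esub> x = \<zero>\<^bsub>M\<^esub>"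
      using r s x by (simp add: a_minus_def smult_l_distr smult_l_minus smult_assoc1 M.r_neg)
    then have "\<one> \<ominus> s \<otimes> r \<in> J"
      using r s by (intro subsetD[OF sub]) simp
    then have "(\<one> \<ominus> s \<otimes> r) \<oplus> s \<otimes> r \<in> J"
      by (rule J.a_closed) (rule J.I_l_closed[OF r(1) s(1)])
    then have "\<one> \<in> J"
      using r s by (simp add: a_minus_def R.a_assoc R.l_neg)
    then show ?thesis
      by (rule disjI2[OF J.one_imp_carrier])
  next
    case True
    then show ?thesis
      using sub by (intro disjI1 equalityI)
  qed
qed

text \<open>
The annihilators of \<open>t\<^sup>n y\<close> increase with \<open>n\<close> and become stationary, say at \<open>N\<close>. If \<open>t\<^sup>N y\<close> were nonzero,
then \<open>x = r t\<^sup>N y\<close> for some \<open>r\<close>; now \<open>t x = 0\<close> puts \<open>r\<close> into the annihilator of \<open>t\<^bsup>N+1\<^esup> y\<close>, hence into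
that of \<open>t\<^sup>N y\<close>, and \<open>x = 0\<close>.
\<close>

lemma power_torsion:
  assumes noeth: "noetherian_ring R" and t: "t \<in> carrier R" "t \<odot>\<^bsub>M\<^esub> x = \<zero>\<^bsub>M\<^esub>" and y: "y \<in> carrier M"
  shows "\<exists>n :: nat. t [^] n \<odot>\<^bsub>M\<^esub> y = \<zero>\<^bsub>M\<^esub>"
proof -
  interpret noetherian_ring R by fact
  define J where "J n = {r \<in> carrier R. r \<odot>\<^bsub>M\<^esub> (t [^] (n :: nat) \<odot>\<^bsub>M\<^esub> y) = \<zero>\<^bsub>M\<^esub>}" for n
  have ideal: "ideal (J n) R" for n
    unfolding J_def by (rule annihilator_ideal) (use t y in simp)
  have swap: "r \<odot>\<^bsub>M\<^esub> (t [^] Suc n \<odot>\<^bsub>M\<^esub> y) = t \<odot>\<^bsub>M\<^esub> (r \<odot>\<^bsub>M\<^esub> (t [^] n \<odot>\<^bsub>M\<^esub> y))"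
    if "r \<in> carrier R" for r n
    using that t(1) y by (simp add: smult_assoc1[symmetric] R.m_ac)
  have step: "J n \<subseteq> J (Suc n)" for n
  proof
    fix r assume "r \<in> J n"
    then have r: "r \<in> carrier R" "r \<odot>\<^bsub>M\<^esub> (t [^] n \<odot>\<^bsub>M\<^esub> y) = \<zero>\<^bsub>M\<^esub>"
      by (auto simp: J_def)
    show "r \<in> J (Suc n)"
      using r t swap[OF r(1), of n] by (simp add: J_def del: nat_pow_Suc)
  qed
  have mono: "J i \<subseteq> J j" if "i \<le> j" for i j
    using step that by (rule lift_Suc_mono_le)
  have "\<Union>(range J) \<in> range J"
  proof (rule ideal_chain_is_trivial)
    show "subset.chain {I. ideal I R} (range J)"
      unfolding subset_chain_def
    proof (intro conjI ballI)
      show "range J \<subseteq> {I. ideal I R}"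
        using ideal by auto
      fix I I' assume "I \<in> range J" "I' \<in> range J"
      then obtain i j where "I = J i" "I' = J j" by auto
      then show "I \<subseteq> I' \<or> I' \<subseteq> I"
        using mono[of i j] mono[of j i] linear[of i j] by auto
    qed
  qed auto
  then obtain N where N: "\<Union>(range J) = J N" by auto
  show ?thesis
  proof (rule exI[of _ N], rule ccontr)
    assume "t [^] N \<odot>\<^bsub>M\<^esub> y \<noteq> \<zero>\<^bsub>M\<^esub>"
    then have "\<exists>r\<in>carrier R. r \<odot>\<^bsub>M\<^esub> (t [^] N \<odot>\<^bsub>M\<^esub> y) = x"
      using t y by (intro ess) simp_all
    then obtain r where r: "r \<in> carrier R" "r \<odot>\<^bsub>M\<^esub> (t [^] N \<odot>\<^bsub>M\<^esub> y) = x"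
      by (rule bexE)
    have "r \<in> J (Suc N)"
      using r t swap[OF r(1), of N] by (simp add: J_def del: nat_pow_Suc)
    then have "r \<in> J N"
      using N by auto
    then show False
      using r x by (simp add: J_def)
  qed
qed

end

end

section \<open>Purity over a Noetherian ring\<close>

text \<open>
Tensor products commute with increasing unions: a null tensor is a combination of finitely many
relations, and these involve finitely many elements of \<open>N\<close>.
\<close>

lemma tensor_null_directed_union:
  assumes M: "module R M" and N: "module R N"
    and F: "\<And>j :: nat. submodule (F j) R N" and mono: "\<And>i j. i \<le> j \<Longrightarrow> F i \<subseteq> F j"
    and cover: "\<And>y. y \<in> carrier N \<Longrightarrow> \<exists>j. y \<in> F j"
    and t: "t \<in> tensor_null R M N"
  shows "\<exists>j. t \<in> tensor_null R M (N\<lparr>carrier := F j\<rparr>)"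
proof -
  interpret N: module R N by fact
  define K where "K = {t. \<exists>j. t \<in> tensor_null R M (N\<lparr>carrier := F j\<rparr>)}"
  have Nj: "module R (N\<lparr>carrier := F j\<rparr>)" for j
    using submodule.submodule_is_module[OF F N] .
  have up: "t \<in> tensor_null R M (N\<lparr>carrier := F j\<rparr>)"
    if "t \<in> tensor_null R M (N\<lparr>carrier := F i\<rparr>)" "i \<le> j" for t i j
  proof -
    have "frag_extend (\<lambda>(x, y). frag_of (id x, id y)) t \<in> tensor_null R M (N\<lparr>carrier := F j\<rparr>)"
      by (rule tensor_null_map[OF M Nj M Nj that(1)]) (use mono[OF that(2)] in auto)
    then show ?thesis
      using frag_expansion[of t] by (simp add: case_prod_beta')
  qed
  have "t \<in> K"
  proof (rule tensor_null_least[OF M N t])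
    show "0 \<in> K"
      using tensor_null_0[OF M Nj] by (auto simp: K_def)
    show "a - b \<in> K" if "a \<in> K" "b \<in> K" for a b
    proof -
      obtain i j where "a \<in> tensor_null R M (N\<lparr>carrier := F i\<rparr>)" "b \<in> tensor_null R M (N\<lparr>carrier := F j\<rparr>)"
        using \<open>a \<in> K\<close> \<open>b \<in> K\<close> by (auto simp: K_def)
      then have "a - b \<in> tensor_null R M (N\<lparr>carrier := F (max i j)\<rparr>)"
        by (rule tensor_null_diff[OF M Nj up[OF _ max.cobounded1] up[OF _ max.cobounded2]])
      then show ?thesis by (auto simp: K_def)
    qed
    show "tensor_relations R M N \<subseteq> K"
      unfolding tensor_relations_def
    proof (intro Un_least; clarify)
      fix x x' y assume xy: "x \<in> carrier M" "x' \<in> carrier M" "y \<in> carrier N"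
      obtain j where "y \<in> F j" using cover[OF xy(3)] ..
      then have "frag_of (x \<oplus>\<^bsub>M\<^esub> x', y) - frag_of (x, y) - frag_of (x', y) \<in> tensor_null R M (N\<lparr>carrier := F j\<rparr>)"
        using tensor_null_add_left[OF M Nj, of x x' y j] xy by simp
      then show "frag_of (x \<oplus>\<^bsub>M\<^esub> x', y) - frag_of (x, y) - frag_of (x', y) \<in> K"
        unfolding K_def by (intro CollectI exI)
    next
      fix x y y' assume xy: "x \<in> carrier M" "y \<in> carrier N" "y' \<in> carrier N"
      obtain i where i: "y \<in> F i" using cover[OF xy(2)] ..
      obtain j where j: "y' \<in> F j" using cover[OF xy(3)] ..
      have "y \<in> F (max i j)" "y' \<in> F (max i j)"
        using subsetD[OF mono[OF max.cobounded1] i] subsetD[OF mono[OF max.cobounded2] j] .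
      then have "frag_of (x, y \<oplus>\<^bsub>N\<^esub> y') - frag_of (x, y) - frag_of (x, y') \<in> tensor_null R M (N\<lparr>carrier := F (max i j)\<rparr>)"
        using tensor_null_add_right[OF M Nj, of x y "max i j" y'] xy by simp
      then show "frag_of (x, y \<oplus>\<^bsub>N\<^esub> y') - frag_of (x, y) - frag_of (x, y') \<in> K"
        unfolding K_def by (intro CollectI exI)
    next
      fix r x y assume xy: "r \<in> carrier R" "x \<in> carrier M" "y \<in> carrier N"
      obtain j where "y \<in> F j" using cover[OF xy(3)] ..
      then have "frag_of (r \<odot>\<^bsub>M\<^esub> x, y) - frag_of (x, r \<odot>\<^bsub>N\<^esub> y) \<in> tensor_null R M (N\<lparr>carrier := F j\<rparr>)"
        using tensor_null_smult[OF M Nj, of r x y j] xy by simp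
      then show "frag_of (r \<odot>\<^bsub>M\<^esub> x, y) - frag_of (x, r \<odot>\<^bsub>N\<^esub> y) \<in> K"
        unfolding K_def by (intro CollectI exI)
    qed
  qed
  then show ?thesis by (simp add: K_def)
qed

text \<open>
The ideal \<open>m\<close> has finitely many generators, so one exponent \<open>q ^ j\<close> kills \<open>y\<close> for all of them. It then
works for all of \<open>m\<close>, since \<open>t \<mapsto> t ^ (q ^ j)\<close> is additive in characteristic \<open>p\<close>.
\<close>

lemma (in frobenius_map) frob_torsion_uniform:
  assumes noeth: "noetherian_ring A" and e: "e > 0" and m: "ideal m A" and L: "module A L"
    and tors: "\<And>t. t \<in> m \<Longrightarrow> \<exists>n :: nat. t [^]\<^bsub>A\<^esub> n \<odot>\<^bsub>L\<^esub> y = \<zero>\<^bsub>L\<^esub>" and y: "y \<in> carrier L"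
  shows "\<exists>j. \<forall>t\<in>m. t [^]\<^bsub>A\<^esub> (q ^ j) \<odot>\<^bsub>L\<^esub> y = \<zero>\<^bsub>L\<^esub>"
proof -
  interpret noetherian_ring A by fact
  interpret L: module A L by fact
  obtain S where S: "S \<subseteq> carrier A" "finite S" "m = Idl\<^bsub>A\<^esub> S"
    using finetely_gen[OF m] by auto
  have Sm: "S \<subseteq> m"
    using A.genideal_self[OF S(1)] S(3) by simp
  then have "\<forall>t\<in>S. \<exists>n :: nat. t [^]\<^bsub>A\<^esub> n \<odot>\<^bsub>L\<^esub> y = \<zero>\<^bsub>L\<^esub>"
    using tors by auto
  then obtain n :: "'a \<Rightarrow> nat" where n: "\<forall>t\<in>S. t [^]\<^bsub>A\<^esub> n t \<odot>\<^bsub>L\<^esub> y = \<zero>\<^bsub>L\<^esub>"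
    by (auto dest: bchoice)
  \<comment> \<open>Any \<open>j \<ge> n t\<close> will do, because \<open>j \<le> 2 ^ j \<le> q ^ j\<close>; this is where \<open>e > 0\<close> enters.\<close>
  define j where "j = Max (insert 0 (n ` S))"
  have nj: "n t \<le> q ^ j" if "t \<in> S" for t
  proof -
    have "n t \<le> j"
      unfolding j_def using S(2) that by (intro Max_ge) auto
    also have "j \<le> 2 ^ j"
      using less_exp[of j] by simp
    also have "\<dots> \<le> q ^ j"
    proof (rule power_mono)
      have "2 \<le> p" using p prime_ge_2_nat by simp
      then show "2 \<le> q" using e self_le_power[of p e] by simp
    qed simp
    finally show ?thesis .
  qed
  define J where "J = {t \<in> carrier A. t [^]\<^bsub>A\<^esub> (q ^ j) \<odot>\<^bsub>L\<^esub> y = \<zero>\<^bsub>L\<^esub>}"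
  have SJ: "S \<subseteq> J"
  proof
    fix t assume t: "t \<in> S"
    then have tA: "t \<in> carrier A" using S(1) by auto
    have "t [^]\<^bsub>A\<^esub> (q ^ j) = t [^]\<^bsub>A\<^esub> (q ^ j - n t) \<otimes>\<^bsub>A\<^esub> t [^]\<^bsub>A\<^esub> n t"
      using nj[OF t] tA by (simp add: A.nat_pow_mult)
    then show "t \<in> J"
      using n t tA y by (simp add: J_def L.smult_assoc1)
  qed
  have qj: "q ^ j = p ^ (e * j)"
    by (simp add: power_mult)
  have q0: "q ^ j \<noteq> 0"
    using zero_less_power[OF q_pos, of j] by linarith
  have "ideal J A"
  proof -
    have add: "a \<oplus>\<^bsub>A\<^esub> b \<in> J" if "a \<in> J" "b \<in> J" for a b
      using that y by (simp add: J_def qj frobenius_add[OF p FA] L.smult_l_distr)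
    have mult: "r \<otimes>\<^bsub>A\<^esub> a \<in> J" if "a \<in> J" "r \<in> carrier A" for r a
      using that y by (simp add: J_def A.nat_pow_distrib L.smult_assoc1)
    have "subgroup J (add_monoid A)"
    proof (rule A.add.subgroupI)
      show "J \<subseteq> carrier A" by (auto simp: J_def)
      have "\<zero>\<^bsub>A\<^esub> \<in> J"
        using y q0 by (simp add: J_def A.nat_pow_zero)
      then show "J \<noteq> {}" by auto
      show "\<ominus>\<^bsub>A\<^esub> a \<in> J" if "a \<in> J" for a
      proof -
        have "\<ominus>\<^bsub>A\<^esub> a = (\<ominus>\<^bsub>A\<^esub> \<one>\<^bsub>A\<^esub>) \<otimes>\<^bsub>A\<^esub> a"
          using that by (simp add: J_def A.l_minus)
        then show ?thesis using mult[OF that, of "\<ominus>\<^bsub>A\<^esub> \<one>\<^bsub>A\<^esub>"] by simp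
      qed
    qed (use add in auto)
    moreover have "a \<otimes>\<^bsub>A\<^esub> r \<in> J" if "a \<in> J" "r \<in> carrier A" for r a
      using mult[OF that] that A.m_comm by (simp add: J_def)
    ultimately show ?thesis
      using mult by (intro idealI A.ring_axioms) auto
  qed
  then have "m \<subseteq> J"
    unfolding S(3) using SJ by (rule A.genideal_minimal)
  then show ?thesis
    by (auto simp: J_def)
qed

text \<open>
Purity of \<open>f\<close>: the hypothesis says that \<open>1 \<otimes> x\<close> vanishes in \<open>B \<otimes> M/N\<close>. If \<open>x \<notin> N\<close>, let \<open>L\<close> be the
quotient of \<open>M\<close> by a submodule containing \<open>N\<close> and maximal among those without \<open>x\<close>. The image of \<open>x\<close> lies
in every nonzero submodule of \<open>L\<close>, so \<open>L\<close> is the union of submodules to which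
\<open>torsion_tensor_nonzero\<close> applies, and \<open>1 \<otimes> x\<close> would vanish over one of them.
\<close>

lemma (in frobenius_map) mem_submodule_if_tensor:
  fixes M :: "('a, 'a) module"
  assumes D: "Dumitrescu p e A B f" and e: "e > 0" and noeth: "noetherian_ring A"
    and Max: "Max_spec A \<subseteq> Spec_map A f ` Spec B"
    and M: "module A M" and N: "submodule N A M" and x: "x \<in> carrier M"
    and s: "Poly_Mapping.keys s \<subseteq> carrier B \<times> N"
    and null: "frag_of (\<one>\<^bsub>B\<^esub>, x) - s \<in> tensor_null A (scalars_via f B) M"
  shows "x \<in> N"
proof (rule ccontr)
  assume "x \<notin> N"
  interpret M: module A M by fact
  obtain W where W: "submodule W A M" "N \<subseteq> W" "x \<notin> W"
    and Wx: "\<And>y. y \<in> carrier M \<Longrightarrow> y \<notin> W \<Longrightarrow> \<exists>r\<in>carrier A. \<exists>w\<in>W. x = w \<oplus>\<^bsub>M\<^esub> r \<odot>\<^bsub>M\<^esub> y"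
    by (rule M.submodule_avoiding[OF N x \<open>x \<notin> N\<close>]) (rule that; assumption)
  note WE = M.submoduleE[OF W(1)]
  have W_in: "w \<in> carrier M" if "w \<in> W" for w
    using that WE(1) by auto
  \<comment> \<open>The coset of \<open>y\<close> modulo \<open>W\<close>, coded as a set of constant sequences.\<close>
  define \<pi> :: "'a \<Rightarrow> (nat \<Rightarrow> 'a) set" where "\<pi> y = (\<lambda>z _. z) ` {z \<in> carrier M. z \<ominus>\<^bsub>M\<^esub> y \<in> W}" for y
  have fib: "\<forall>y\<in>carrier M. \<forall>z\<in>carrier M. \<pi> y = \<pi> z \<longleftrightarrow> y \<ominus>\<^bsub>M\<^esub> z \<in> W"
  proof (intro ballI)
    fix y z assume y: "y \<in> carrier M" and z: "z \<in> carrier M"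
    have "inj (\<lambda>z (_ :: nat). z :: 'a)"
      by (auto simp: inj_def fun_eq_iff)
    then have "\<pi> y = \<pi> z \<longleftrightarrow> {v \<in> carrier M. v \<ominus>\<^bsub>M\<^esub> y \<in> W} = {v \<in> carrier M. v \<ominus>\<^bsub>M\<^esub> z \<in> W}"
      unfolding \<pi>_def by (rule inj_image_eq_iff)
    also have "\<dots> \<longleftrightarrow> y \<ominus>\<^bsub>M\<^esub> z \<in> W"
    proof
      assume eq: "{v \<in> carrier M. v \<ominus>\<^bsub>M\<^esub> y \<in> W} = {v \<in> carrier M. v \<ominus>\<^bsub>M\<^esub> z \<in> W}"
      have "y \<ominus>\<^bsub>M\<^esub> y \<in> W"
        using y M.submodule_zero[OF W(1)] by (simp add: a_minus_def M.r_neg)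
      then have "y \<in> {v \<in> carrier M. v \<ominus>\<^bsub>M\<^esub> z \<in> W}"
        using y unfolding eq[symmetric] by simp
      then show "y \<ominus>\<^bsub>M\<^esub> z \<in> W" by simp
    next
      assume yz: "y \<ominus>\<^bsub>M\<^esub> z \<in> W"
      have e1: "v \<ominus>\<^bsub>M\<^esub> z = (v \<ominus>\<^bsub>M\<^esub> y) \<oplus>\<^bsub>M\<^esub> (y \<ominus>\<^bsub>M\<^esub> z)" if "v \<in> carrier M" for v
        using that y z by (simp add: a_minus_def M.a_ac M.r_neg M.r_neg1 M.r_neg2)
      have cancel: "(u \<oplus>\<^bsub>M\<^esub> w) \<ominus>\<^bsub>M\<^esub> w = u" if "u \<in> carrier M" "w \<in> carrier M" for u w
        using that by (simp add: a_minus_def M.a_assoc M.r_neg)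
      have "v \<ominus>\<^bsub>M\<^esub> y \<in> W \<longleftrightarrow> v \<ominus>\<^bsub>M\<^esub> z \<in> W" if v: "v \<in> carrier M" for v
      proof
        assume "v \<ominus>\<^bsub>M\<^esub> y \<in> W"
        then show "v \<ominus>\<^bsub>M\<^esub> z \<in> W"
          unfolding e1[OF v] using yz by (rule WE(5))
      next
        assume "v \<ominus>\<^bsub>M\<^esub> z \<in> W"
        then have "((v \<ominus>\<^bsub>M\<^esub> y) \<oplus>\<^bsub>M\<^esub> (y \<ominus>\<^bsub>M\<^esub> z)) \<ominus>\<^bsub>M\<^esub> (y \<ominus>\<^bsub>M\<^esub> z) \<in> W"
          unfolding e1[OF v] using yz by (rule M.submodule_diff[OF W(1)])
        then show "v \<ominus>\<^bsub>M\<^esub> y \<in> W"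
          using cancel[of "v \<ominus>\<^bsub>M\<^esub> y" "y \<ominus>\<^bsub>M\<^esub> z"] v y z by simp
      qed
      then show "{v \<in> carrier M. v \<ominus>\<^bsub>M\<^esub> y \<in> W} = {v \<in> carrier M. v \<ominus>\<^bsub>M\<^esub> z \<in> W}"
        by auto
    qed
    finally show "\<pi> y = \<pi> z \<longleftrightarrow> y \<ominus>\<^bsub>M\<^esub> z \<in> W" .
  qed
  define L where "L = image_module \<pi> M"
  note Lsimps = image_module_simps[OF M W(1) fib, folded L_def]
  have L: "module A L"
    unfolding L_def by (rule image_module_module[OF M W(1) fib])
  interpret L: module A L by fact
  have \<pi>0: "\<pi> w = \<zero>\<^bsub>L\<^esub> \<longleftrightarrow> w \<in> W" if "w \<in> carrier M" for w
    using fib that M.minus_zero_right[OF that] by (simp add: Lsimps)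
  have xL: "\<pi> x \<in> carrier L" "\<pi> x \<noteq> \<zero>\<^bsub>L\<^esub>"
    using x W(3) \<pi>0[OF x] by (simp_all add: Lsimps)
  have ess: "\<exists>r\<in>carrier A. r \<odot>\<^bsub>L\<^esub> y = \<pi> x" if y: "y \<in> carrier L" "y \<noteq> \<zero>\<^bsub>L\<^esub>" for y
  proof -
    obtain z where z: "z \<in> carrier M" "y = \<pi> z"
      using y(1) by (auto simp: Lsimps)
    then have "z \<notin> W" using y(2) \<pi>0 by simp
    then obtain r w where r: "r \<in> carrier A" and w: "w \<in> W" and xw: "x = w \<oplus>\<^bsub>M\<^esub> r \<odot>\<^bsub>M\<^esub> z"
      using Wx[OF z(1)] by auto
    have "\<pi> x = \<pi> w \<oplus>\<^bsub>L\<^esub> r \<odot>\<^bsub>L\<^esub> y"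
      unfolding xw z(2) using r z W_in[OF w] by (simp add: Lsimps)
    also have "\<dots> = r \<odot>\<^bsub>L\<^esub> y"
      using \<pi>0[OF W_in[OF w]] w r y by simp
    finally show ?thesis
      using r by (intro bexI[of _ r]) simp_all
  qed
  define m where "m = {r \<in> carrier A. r \<odot>\<^bsub>L\<^esub> \<pi> x = \<zero>\<^bsub>L\<^esub>}"
  have m: "maximalideal m A"
    unfolding m_def by (rule L.annihilator_maximal[OF xL ess])
  have m_in: "t \<in> carrier A" "t \<odot>\<^bsub>L\<^esub> \<pi> x = \<zero>\<^bsub>L\<^esub>" if "t \<in> m" for t
    using that by (simp_all add: m_def)
  obtain P where P: "primeideal P B" "m = Spec_map A f P"
    using Max m by (auto simp: Max_spec_def Spec_def)
  have Pm: "f a \<in> P \<longleftrightarrow> a \<in> m" if "a \<in> carrier A" for a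
    using that by (simp add: P(2) Spec_map_def)
  define F where "F j = {y \<in> carrier L. \<forall>t\<in>m. t [^]\<^bsub>A\<^esub> (q ^ j) \<odot>\<^bsub>L\<^esub> y = \<zero>\<^bsub>L\<^esub>}" for j
  have F: "submodule (F j) A L" for j
  proof (rule L.submoduleI)
    show "\<ominus>\<^bsub>L\<^esub> a \<in> F j" if "a \<in> F j" for a
      using that m_in by (simp add: F_def L.smult_r_minus L.a_inv_zero)
    show "r \<odot>\<^bsub>L\<^esub> a \<in> F j" if r: "r \<in> carrier A" and a: "a \<in> F j" for r a
    proof -
      have "t [^]\<^bsub>A\<^esub> (q ^ j) \<odot>\<^bsub>L\<^esub> (r \<odot>\<^bsub>L\<^esub> a) = r \<odot>\<^bsub>L\<^esub> (t [^]\<^bsub>A\<^esub> (q ^ j) \<odot>\<^bsub>L\<^esub> a)" if "t \<in> m" for t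
        using r a m_in(1)[OF that] A.m_comm by (simp add: F_def L.smult_assoc1[symmetric])
      then show ?thesis
        using r a by (simp add: F_def)
    qed
  qed (use m_in in \<open>auto simp: F_def L.smult_r_distr\<close>)
  have F_step: "F j \<subseteq> F (Suc j)" for j
  proof
    fix y assume y: "y \<in> F j"
    have "t [^]\<^bsub>A\<^esub> (q ^ Suc j) \<odot>\<^bsub>L\<^esub> y = \<zero>\<^bsub>L\<^esub>" if t: "t \<in> m" for t
    proof -
      have "q ^ j \<le> q ^ Suc j"
        using q_pos by (intro power_increasing) auto
      then have "q ^ Suc j = (q ^ Suc j - q ^ j) + q ^ j"
        by simp
      then have "t [^]\<^bsub>A\<^esub> (q ^ Suc j) = t [^]\<^bsub>A\<^esub> (q ^ Suc j - q ^ j) \<otimes>\<^bsub>A\<^esub> t [^]\<^bsub>A\<^esub> (q ^ j)"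
        using A.nat_pow_mult[OF m_in(1)[OF t]] by metis
      then show ?thesis
        using y t m_in(1)[OF t] by (simp add: F_def L.smult_assoc1)
    qed
    then show "y \<in> F (Suc j)"
      using y by (simp add: F_def)
  qed
  have cover: "\<exists>j. y \<in> F j" if y: "y \<in> carrier L" for y
  proof -
    have "\<exists>j. \<forall>t\<in>m. t [^]\<^bsub>A\<^esub> (q ^ j) \<odot>\<^bsub>L\<^esub> y = \<zero>\<^bsub>L\<^esub>"
      by (rule frob_torsion_uniform[OF noeth e maximalideal.axioms(1)[OF m] L _ y])
         (rule L.power_torsion[OF xL ess noeth m_in y])
    then show ?thesis
      using y by (simp add: F_def)
  qed
  have null': "frag_of (\<one>\<^bsub>B\<^esub>, \<pi> x) \<in> tensor_null A (scalars_via f B) L"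
  proof -
    let ?h = "\<lambda>(c, y). frag_of (id c, \<pi> y)"
    have "frag_extend ?h (frag_of (\<one>\<^bsub>B\<^esub>, x) - s) \<in> tensor_null A (scalars_via f B) L"
      by (rule tensor_null_map[OF module_left M module_left L null]) (auto simp: Lsimps)
    moreover have "frag_extend ?h s \<in> tensor_null A (scalars_via f B) L"
    proof (rule frag_extend_mem[OF s _ tensor_null_0[OF module_left L] tensor_null_diff[OF module_left L]], clarify)
      fix c n assume "c \<in> carrier B" and n: "n \<in> N"
      moreover have "\<pi> n = \<zero>\<^bsub>L\<^esub>"
        using \<pi>0[OF W_in] n W(2) by auto
      ultimately show "frag_of (id c, \<pi> n) \<in> tensor_null A (scalars_via f B) L"
        using tensor_null_zero_right[OF module_left L, of c] by simp
    qed
    ultimately have "frag_extend ?h (frag_of (\<one>\<^bsub>B\<^esub>, x) - s) + frag_extend ?h s \<in> tensor_null A (scalars_via f B) L"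
      by (rule tensor_null_add[OF module_left L])
    then show ?thesis
      by (simp add: frag_extend_diff)
  qed
  obtain j where j: "frag_of (\<one>\<^bsub>B\<^esub>, \<pi> x) \<in> tensor_null A (scalars_via f B) (L\<lparr>carrier := F j\<rparr>)"
    using tensor_null_directed_union[OF module_left L F _ cover null'] lift_Suc_mono_le[of F, OF F_step] by metis
  have Lj: "module A (L\<lparr>carrier := F j\<rparr>)"
    by (rule submodule.submodule_is_module[OF F L])
  have "\<pi> x = \<zero>\<^bsub>L\<lparr>carrier := F j\<rparr>\<^esub>"
  proof (rule torsion_tensor_nonzero[OF D m P(1) Pm Lj])
    show "\<pi> x \<in> carrier (L\<lparr>carrier := F j\<rparr>)"
      using tensor_null_in_free[OF module_left Lj j] by (simp add: keys_frag_of)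
  qed (use j in \<open>auto simp: F_def\<close>)
  then show False
    using xL(2) by simp
qed

section \<open>Submodules of finitely generated modules over a Noetherian ring\<close>

abbreviation module_span :: "('r, 'u) ring_scheme \<Rightarrow> ('r, 'm, 'v) module_scheme \<Rightarrow> 'm set \<Rightarrow> 'm set"
  where "module_span R M X \<equiv> additive_span M {r \<odot>\<^bsub>M\<^esub> x | r x. r \<in> carrier R \<and> x \<in> X}"

context module
begin

lemma module_span_gens: "X \<subseteq> carrier M \<Longrightarrow> {r \<odot>\<^bsub>M\<^esub> x | r x. r \<in> carrier R \<and> x \<in> X} \<subseteq> carrier M"
  by auto

lemma module_span_in_carrier: "X \<subseteq> carrier M \<Longrightarrow> v \<in> module_span R M X \<Longrightarrow> v \<in> carrier M"
  by (rule M.additive_span_in_carrier[OF module_span_gens])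

lemma module_span_submodule:
  assumes X: "X \<subseteq> carrier M"
  shows "submodule (module_span R M X) R M"
proof (rule submoduleI)
  show "module_span R M X \<subseteq> carrier M"
    using module_span_in_carrier[OF X] by (rule subsetI)
  show "\<zero>\<^bsub>M\<^esub> \<in> module_span R M X"
    by (rule additive_span.zero)
  show "\<ominus>\<^bsub>M\<^esub> a \<in> module_span R M X" if "a \<in> module_span R M X" for a
    using additive_span.diff[OF additive_span.zero that] module_span_in_carrier[OF X that]
    by (simp add: a_minus_def)
  show "a \<oplus>\<^bsub>M\<^esub> b \<in> module_span R M X" if "a \<in> module_span R M X" "b \<in> module_span R M X" for a b
    by (rule M.additive_span_add[OF module_span_gens[OF X] that])
  show "s \<odot>\<^bsub>M\<^esub> a \<in> module_span R M X" if s: "s \<in> carrier R" and a: "a \<in> module_span R M X" for s a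
  proof (rule additive_span_map[OF M.abelian_group_axioms M.abelian_group_axioms module_span_gens[OF X] _ _ a])
    show "(\<lambda>v. s \<odot>\<^bsub>M\<^esub> v) ` {r \<odot>\<^bsub>M\<^esub> x | r x. r \<in> carrier R \<and> x \<in> X} \<subseteq> module_span R M X"
    proof clarify
      fix r x assume r: "r \<in> carrier R" and x: "x \<in> X"
      then have "s \<odot>\<^bsub>M\<^esub> (r \<odot>\<^bsub>M\<^esub> x) = (s \<otimes> r) \<odot>\<^bsub>M\<^esub> x"
        using s X by (simp add: smult_assoc1 subset_eq)
      moreover have "s \<otimes> r \<in> carrier R" using s r by simp
      ultimately show "s \<odot>\<^bsub>M\<^esub> (r \<odot>\<^bsub>M\<^esub> x) \<in> module_span R M X"
        using x by (intro additive_span.base) auto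
    qed
  qed (use s in \<open>simp_all add: smult_r_distr\<close>)
qed

lemma module_span_least:
  assumes W: "submodule W R M" and X: "X \<subseteq> W" and v: "v \<in> module_span R M X"
  shows "v \<in> W"
  using v
proof (rule additive_span_least)
  show "{r \<odot>\<^bsub>M\<^esub> x | r x. r \<in> carrier R \<and> x \<in> X} \<subseteq> W"
    using X submoduleE(4)[OF W] by auto
qed (rule submodule_zero[OF W], rule submodule_diff[OF W])

text \<open>
A combination of \<open>x\<close> and the members of \<open>X\<close> has a coefficient at \<open>x\<close>.
\<close>

lemma module_span_insert:
  assumes X: "X \<subseteq> carrier M" and x: "x \<in> carrier M" and v: "v \<in> module_span R M (insert x X)"
  shows "\<exists>r\<in>carrier R. v \<ominus>\<^bsub>M\<^esub> r \<odot>\<^bsub>M\<^esub> x \<in> module_span R M X"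
proof -
  let ?S = "module_span R M X"
  note S = module_span_submodule[OF X]
  have S0: "\<zero>\<^bsub>M\<^esub> \<in> ?S" by (rule additive_span.zero)
  define K where "K = {v \<in> carrier M. \<exists>r\<in>carrier R. v \<ominus>\<^bsub>M\<^esub> r \<odot>\<^bsub>M\<^esub> x \<in> ?S}"
  have KI: "v \<in> K" if "v \<in> carrier M" "r \<in> carrier R" "v \<ominus>\<^bsub>M\<^esub> r \<odot>\<^bsub>M\<^esub> x \<in> ?S" for v r
    using that unfolding K_def by (intro CollectI conjI bexI[of _ r])
  have "v \<in> K"
    using v
  proof (rule additive_span_least)
    show "{r \<odot>\<^bsub>M\<^esub> y | r y. r \<in> carrier R \<and> y \<in> insert x X} \<subseteq> K"
    proof clarify
      fix r y assume r: "r \<in> carrier R" and y: "y \<in> insert x X"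
      show "r \<odot>\<^bsub>M\<^esub> y \<in> K"
      proof (cases "y = x")
        case True
        then show ?thesis
          using r x S0 by (intro KI[of _ r]) (simp_all add: a_minus_def M.r_neg)
      next
        case False
        then have y: "y \<in> X" "y \<in> carrier M" using y X by auto
        moreover have "r \<odot>\<^bsub>M\<^esub> y \<in> ?S"
          using r y by (intro additive_span.base) auto
        ultimately show ?thesis
          using r x by (intro KI[of _ \<zero>]) (simp_all add: M.minus_zero_right)
      qed
    qed
    show "\<zero>\<^bsub>M\<^esub> \<in> K"
      using S0 x by (intro KI[of _ \<zero>]) (simp_all add: M.minus_zero_right)
    fix u w assume "u \<in> K" "w \<in> K"
    then obtain r s where rs: "u \<in> carrier M" "w \<in> carrier M" "r \<in> carrier R" "s \<in> carrier R"
      "u \<ominus>\<^bsub>M\<^esub> r \<odot>\<^bsub>M\<^esub> x \<in> ?S" "w \<ominus>\<^bsub>M\<^esub> s \<odot>\<^bsub>M\<^esub> x \<in> ?S"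
      by (auto simp: K_def)
    have "(u \<ominus>\<^bsub>M\<^esub> w) \<ominus>\<^bsub>M\<^esub> (r \<ominus> s) \<odot>\<^bsub>M\<^esub> x = (u \<ominus>\<^bsub>M\<^esub> r \<odot>\<^bsub>M\<^esub> x) \<ominus>\<^bsub>M\<^esub> (w \<ominus>\<^bsub>M\<^esub> s \<odot>\<^bsub>M\<^esub> x)"
      using rs x by (simp add: a_minus_def smult_l_distr smult_l_minus M.minus_add M.a_ac)
    then have "(u \<ominus>\<^bsub>M\<^esub> w) \<ominus>\<^bsub>M\<^esub> (r \<ominus> s) \<odot>\<^bsub>M\<^esub> x \<in> ?S"
      using additive_span.diff[OF rs(5,6)] by simp
    then show "u \<ominus>\<^bsub>M\<^esub> w \<in> K"
      using rs by (intro KI[of _ "r \<ominus> s"]) simp_all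
  qed
  then show ?thesis by (simp add: K_def)
qed

text \<open>
As in the proof of Hilbert's basis theorem: when \<open>x\<close> is added to the generators, the coefficients at \<open>x\<close> of
the elements of \<open>V\<close> form an ideal. Lifts to \<open>V\<close> of finitely many generators of that ideal, together with
generators of the part of \<open>V\<close> in the span of \<open>X\<close>, generate \<open>V\<close>.
\<close>

lemma submodule_finitely_generated:
  assumes noeth: "noetherian_ring R"
  shows "finite X \<Longrightarrow> X \<subseteq> carrier M \<Longrightarrow> submodule V R M \<Longrightarrow> V \<subseteq> module_span R M X \<Longrightarrow>
    \<exists>Y. finite Y \<and> Y \<subseteq> V \<and> V \<subseteq> module_span R M Y"
proof (induction X arbitrary: V rule: finite_induct)
  case (empty V)
  have "v = \<zero>\<^bsub>M\<^esub>" if "v \<in> V" for v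
    using module_span_least[OF zero_submodule, of "{}" v] empty.prems(3) that by auto
  then have "V \<subseteq> module_span R M {}"
    using additive_span.zero by auto
  then show ?case by (intro exI[of _ "{}"]) simp
next
  case (insert x X V)
  interpret noetherian_ring R by (rule noeth)
  have X: "X \<subseteq> carrier M" "x \<in> carrier M" using insert.prems by auto
  note V = insert.prems(2)
  note VE = submoduleE[OF V]
  have V_in: "v \<in> carrier M" if "v \<in> V" for v using that VE(1) by auto
  let ?S = "module_span R M X"
  note S = module_span_submodule[OF X(1)]
  note SE = submoduleE[OF S]
  \<comment> \<open>The possible coefficients at \<open>x\<close> of the members of \<open>U\<close>.\<close>
  define lead where "lead U = {r \<in> carrier R. \<exists>v\<in>U. v \<ominus>\<^bsub>M\<^esub> r \<odot>\<^bsub>M\<^esub> x \<in> ?S}" for U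
  have lead_ideal: "ideal (lead U) R" if U: "submodule U R M" for U
  proof -
    note UE = submoduleE[OF U]
    have U_in: "u \<in> carrier M" if "u \<in> U" for u using that UE(1) by auto
    have I: "r \<in> lead U" if "r \<in> carrier R" "u \<in> U" "u \<ominus>\<^bsub>M\<^esub> r \<odot>\<^bsub>M\<^esub> x \<in> ?S" for r u
      using that unfolding lead_def by (intro CollectI conjI bexI[of _ u])
    have add: "r \<oplus> s \<in> lead U" if rs: "r \<in> lead U" "s \<in> lead U" for r s
    proof -
      obtain u w where uw: "u \<in> U" "w \<in> U" "u \<ominus>\<^bsub>M\<^esub> r \<odot>\<^bsub>M\<^esub> x \<in> ?S" "w \<ominus>\<^bsub>M\<^esub> s \<odot>\<^bsub>M\<^esub> x \<in> ?S"
        and rsR: "r \<in> carrier R" "s \<in> carrier R"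
        using rs by (auto simp: lead_def)
      have "(u \<oplus>\<^bsub>M\<^esub> w) \<ominus>\<^bsub>M\<^esub> (r \<oplus> s) \<odot>\<^bsub>M\<^esub> x = (u \<ominus>\<^bsub>M\<^esub> r \<odot>\<^bsub>M\<^esub> x) \<oplus>\<^bsub>M\<^esub> (w \<ominus>\<^bsub>M\<^esub> s \<odot>\<^bsub>M\<^esub> x)"
        using rsR X(2) U_in[OF uw(1)] U_in[OF uw(2)] by (simp add: smult_l_distr M.add_diff_eq)
      then have "(u \<oplus>\<^bsub>M\<^esub> w) \<ominus>\<^bsub>M\<^esub> (r \<oplus> s) \<odot>\<^bsub>M\<^esub> x \<in> ?S"
        using SE(5)[OF uw(3,4)] by simp
      then show ?thesis
        using rsR UE(5)[OF uw(1,2)] by (intro I[of _ "u \<oplus>\<^bsub>M\<^esub> w"]) simp_all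
    qed
    have mult: "t \<otimes> r \<in> lead U" if r: "r \<in> lead U" and t: "t \<in> carrier R" for r t
    proof -
      obtain u where u: "u \<in> U" "u \<ominus>\<^bsub>M\<^esub> r \<odot>\<^bsub>M\<^esub> x \<in> ?S" and rR: "r \<in> carrier R"
        using r by (auto simp: lead_def)
      have "t \<odot>\<^bsub>M\<^esub> u \<ominus>\<^bsub>M\<^esub> (t \<otimes> r) \<odot>\<^bsub>M\<^esub> x = t \<odot>\<^bsub>M\<^esub> (u \<ominus>\<^bsub>M\<^esub> r \<odot>\<^bsub>M\<^esub> x)"
        using t rR X(2) U_in[OF u(1)] by (simp add: a_minus_def smult_r_distr smult_r_minus smult_assoc1)
      then have "t \<odot>\<^bsub>M\<^esub> u \<ominus>\<^bsub>M\<^esub> (t \<otimes> r) \<odot>\<^bsub>M\<^esub> x \<in> ?S"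
        using SE(4)[OF t u(2)] by simp
      then show ?thesis
        using t rR UE(4)[OF t u(1)] by (intro I[of _ "t \<odot>\<^bsub>M\<^esub> u"]) simp_all
    qed
    have sub: "lead U \<subseteq> carrier R" by (auto simp: lead_def)
    have "subgroup (lead U) (add_monoid R)"
    proof (rule R.add.subgroupI)
      have "\<zero> \<in> lead U"
        using X(2) submodule_zero[OF U] additive_span.zero
        by (intro I[of _ "\<zero>\<^bsub>M\<^esub>"]) (simp_all add: a_minus_def M.a_inv_zero)
      then show "lead U \<noteq> {}" by auto
      show "\<ominus> r \<in> lead U" if r: "r \<in> lead U" for r
      proof -
        have rR: "r \<in> carrier R" using r sub by auto
        then have "\<ominus> r = (\<ominus> \<one>) \<otimes> r" by (simp add: R.l_minus)
        then show ?thesis using mult[OF r, of "\<ominus> \<one>"] by simp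
      qed
    qed (use add sub in auto)
    moreover have "r \<otimes> t \<in> lead U" if "r \<in> lead U" "t \<in> carrier R" for r t
      using mult[OF that] that sub R.m_comm[of r t] by auto
    ultimately show ?thesis
      using mult by (intro idealI R.ring_axioms) auto
  qed
  obtain G where G: "G \<subseteq> carrier R" "finite G" "lead V = Idl G"
    using finetely_gen[OF lead_ideal[OF V]] by auto
  have "\<forall>a\<in>G. \<exists>v. v \<in> V \<and> v \<ominus>\<^bsub>M\<^esub> a \<odot>\<^bsub>M\<^esub> x \<in> ?S"
    using genideal_self[OF G(1)] G(3) unfolding lead_def by auto
  then obtain w where w: "\<forall>a\<in>G. w a \<in> V \<and> w a \<ominus>\<^bsub>M\<^esub> a \<odot>\<^bsub>M\<^esub> x \<in> ?S"
    by (rule bchoice[THEN exE])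
  have wV: "w ` G \<subseteq> V" using w by auto
  then have wM: "w ` G \<subseteq> carrier M" using VE(1) by (rule subset_trans)
  let ?U = "module_span R M (w ` G)"
  note U = module_span_submodule[OF wM]
  have "G \<subseteq> lead ?U"
  proof
    fix a assume a: "a \<in> G"
    have "w a \<in> ?U"
    proof -
      have "\<one> \<odot>\<^bsub>M\<^esub> w a \<in> ?U" using a by (intro additive_span.base) auto
      moreover have "w a \<in> carrier M" using wM a by auto
      ultimately show ?thesis by simp
    qed
    then show "a \<in> lead ?U"
      using w G(1) a unfolding lead_def by auto
  qed
  then have lead_U: "lead V \<subseteq> lead ?U"
    unfolding G(3) by (rule genideal_minimal[OF lead_ideal[OF U]])
  define V' where "V' = V \<inter> ?S"
  have V': "submodule V' R M"
  proof (rule submoduleI)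
    show "V' \<subseteq> carrier M" using VE(1) by (auto simp: V'_def)
    show "\<zero>\<^bsub>M\<^esub> \<in> V'" using submodule_zero[OF V] submodule_zero[OF S] by (simp add: V'_def)
  qed (use VE(3-5) SE(3-5) in \<open>simp_all add: V'_def\<close>)
  obtain Y' where Y': "finite Y'" "Y' \<subseteq> V'" "V' \<subseteq> module_span R M Y'"
    using insert.IH[OF X(1) V'] by (auto simp: V'_def)
  let ?Y = "Y' \<union> w ` G"
  have YV: "?Y \<subseteq> V"
    using Y'(2) wV by (auto simp: V'_def)
  then have YM: "?Y \<subseteq> carrier M" using VE(1) by (rule subset_trans)
  have mono: "v \<in> module_span R M ?Y" if "v \<in> module_span R M Z" "Z \<subseteq> ?Y" for Z v
    by (rule additive_span_mono[OF that(1) subset_trans[OF _ subsetI[OF additive_span.base]]])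
       (use that(2) in blast)+
  have "V \<subseteq> module_span R M ?Y"
  proof
    fix v assume v: "v \<in> V"
    obtain r where r: "r \<in> carrier R" "v \<ominus>\<^bsub>M\<^esub> r \<odot>\<^bsub>M\<^esub> x \<in> ?S"
      using module_span_insert[OF X, of v] insert.prems(3) v by auto
    then have "r \<in> lead V" using v by (auto simp: lead_def)
    then obtain u where u: "u \<in> ?U" "u \<ominus>\<^bsub>M\<^esub> r \<odot>\<^bsub>M\<^esub> x \<in> ?S"
      using lead_U by (auto simp: lead_def)
    have uV: "u \<in> V" by (rule module_span_least[OF V wV u(1)])
    have "(v \<ominus>\<^bsub>M\<^esub> r \<odot>\<^bsub>M\<^esub> x) \<ominus>\<^bsub>M\<^esub> (u \<ominus>\<^bsub>M\<^esub> r \<odot>\<^bsub>M\<^esub> x) = v \<ominus>\<^bsub>M\<^esub> u"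
      using V_in[OF v] V_in[OF uV] r X(2)
      by (simp add: a_minus_def M.minus_add M.a_ac M.r_neg M.r_neg1 M.r_neg2)
    then have "v \<ominus>\<^bsub>M\<^esub> u \<in> ?S"
      using additive_span.diff[OF r(2) u(2)] by simp
    moreover have "v \<ominus>\<^bsub>M\<^esub> u \<in> V" by (rule submodule_diff[OF V v uV])
    ultimately have "v \<ominus>\<^bsub>M\<^esub> u \<in> module_span R M Y'"
      using Y'(3) by (auto simp: V'_def)
    then have "(v \<ominus>\<^bsub>M\<^esub> u) \<oplus>\<^bsub>M\<^esub> u \<in> module_span R M ?Y"
      using mono[OF _ Un_upper1] mono[OF u(1) Un_upper2]
      by (intro M.additive_span_add[OF module_span_gens[OF YM]])
    then show "v \<in> module_span R M ?Y"
      using V_in[OF v] V_in[OF uV] by (simp add: a_minus_def M.a_assoc M.l_neg)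
  qed
  then show ?case
    using Y'(1) G(2) YV by (intro exI[of _ ?Y]) simp
qed

end

section \<open>Descent of F-finiteness\<close>

context frobenius_map
begin

lemma frob_spanI:
  assumes "b \<in> carrier B" "a \<in> carrier A" "x \<in> X"
  shows "b [^]\<^bsub>B\<^esub> (n :: nat) \<otimes>\<^bsub>B\<^esub> f a \<otimes>\<^bsub>B\<^esub> x \<in> frob_span n A B f X"
  unfolding frob_span_def by (rule additive_span.base) (use assms in blast)

lemma frob_span_mono:
  assumes "y \<in> frob_span n A B f X" "X \<subseteq> Y"
  shows "y \<in> frob_span n A B f Y"
  using assms(1) unfolding frob_span_def
  by (rule additive_span_mono) (use assms(2) in \<open>blast intro: additive_span.base\<close>)

text \<open>
If \<open>X\<close> generates \<open>B\<close> over \<open>B\<^sup>p[A]\<close> and \<open>Y\<close> generates it over the subring of \<open>p ^ n\<close>-th powers and \<open>A\<close>, then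
taking \<open>p\<close>-th powers of the second representation and substituting them for the \<open>p\<close>-th powers in the first
shows that the products \<open>y\<^sup>p x\<close> generate \<open>B\<close> over the subring of \<open>p ^ (n + 1)\<close>-th powers and \<open>A\<close>.
\<close>

lemma frob_span_iterate:
  assumes X: "finite X" "X \<subseteq> carrier B" and span: "carrier B \<subseteq> frob_span p A B f X"
  shows "\<exists>Y. finite Y \<and> Y \<subseteq> carrier B \<and> carrier B \<subseteq> frob_span (p ^ n) A B f Y"
proof (induction n)
  case 0
  have "b \<in> frob_span (p ^ 0) A B f {\<one>\<^bsub>B\<^esub>}" if "b \<in> carrier B" for b
    using frob_spanI[OF that A.one_closed singletonI[of "\<one>\<^bsub>B\<^esub>"], of "p ^ 0"] that by (simp add: f_simps)
  then show ?case
    by (intro exI[of _ "{\<one>\<^bsub>B\<^esub>}"]) auto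
next
  case (Suc n)
  then obtain Y where Y: "finite Y" "Y \<subseteq> carrier B" and spanY: "carrier B \<subseteq> frob_span (p ^ n) A B f Y"
    by (elim exE conjE)
  define Z where "Z = (\<lambda>(y, x). y [^]\<^bsub>B\<^esub> p \<otimes>\<^bsub>B\<^esub> x) ` (Y \<times> X)"
  have Z: "finite Z" "Z \<subseteq> carrier B"
    using X Y by (auto simp: Z_def subset_eq)
  have p_add: "(u \<oplus>\<^bsub>B\<^esub> v) [^]\<^bsub>B\<^esub> p = u [^]\<^bsub>B\<^esub> p \<oplus>\<^bsub>B\<^esub> v [^]\<^bsub>B\<^esub> p" if "u \<in> carrier B" "v \<in> carrier B" for u v
    using frobenius_add[OF p FB that, of 1] by simp
  have gen: "u [^]\<^bsub>B\<^esub> p \<otimes>\<^bsub>B\<^esub> f a \<otimes>\<^bsub>B\<^esub> x \<in> frob_span (p ^ Suc n) A B f Z"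
    if u: "u \<in> carrier B" and a: "a \<in> carrier A" and x: "x \<in> X" for u a x
    unfolding frob_span_def
  proof (rule additive_span_map[where h = "\<lambda>v. v [^]\<^bsub>B\<^esub> p \<otimes>\<^bsub>B\<^esub> f a \<otimes>\<^bsub>B\<^esub> x",
        OF B.is_abelian_group B.is_abelian_group frob_gens_in_carrier[OF Y(2)]])
    have xB: "x \<in> carrier B" using x X by auto
    show "v [^]\<^bsub>B\<^esub> p \<otimes>\<^bsub>B\<^esub> f a \<otimes>\<^bsub>B\<^esub> x \<in> carrier B" if "v \<in> carrier B" for v
      using that a xB by (simp add: f_simps)
    show "(v \<oplus>\<^bsub>B\<^esub> w) [^]\<^bsub>B\<^esub> p \<otimes>\<^bsub>B\<^esub> f a \<otimes>\<^bsub>B\<^esub> x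
        = v [^]\<^bsub>B\<^esub> p \<otimes>\<^bsub>B\<^esub> f a \<otimes>\<^bsub>B\<^esub> x \<oplus>\<^bsub>B\<^esub> w [^]\<^bsub>B\<^esub> p \<otimes>\<^bsub>B\<^esub> f a \<otimes>\<^bsub>B\<^esub> x"
      if "v \<in> carrier B" "w \<in> carrier B" for v w
      using that a xB by (simp add: f_simps p_add B.l_distr)
    show "u \<in> additive_span B (frob_gens (p ^ n) A B f Y)"
      using subsetD[OF spanY u] by (simp add: frob_span_def)
    show "(\<lambda>v. v [^]\<^bsub>B\<^esub> p \<otimes>\<^bsub>B\<^esub> f a \<otimes>\<^bsub>B\<^esub> x) `
        frob_gens (p ^ n) A B f Y
      \<subseteq> additive_span B (frob_gens (p ^ Suc n) A B f Z)"
    proof clarify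
      fix b a' y assume b: "b \<in> carrier B" and a': "a' \<in> carrier A" and y: "y \<in> Y"
      have yB: "y \<in> carrier B" using y Y by auto
      have "(b [^]\<^bsub>B\<^esub> (p ^ n) \<otimes>\<^bsub>B\<^esub> f a' \<otimes>\<^bsub>B\<^esub> y) [^]\<^bsub>B\<^esub> p \<otimes>\<^bsub>B\<^esub> f a \<otimes>\<^bsub>B\<^esub> x
          = b [^]\<^bsub>B\<^esub> (p ^ Suc n) \<otimes>\<^bsub>B\<^esub> f (a' [^]\<^bsub>A\<^esub> p \<otimes>\<^bsub>A\<^esub> a) \<otimes>\<^bsub>B\<^esub> (y [^]\<^bsub>B\<^esub> p \<otimes>\<^bsub>B\<^esub> x)"
        using a a' b yB xB
        by (simp add: B.nat_pow_distrib B.nat_pow_pow f_simps f_pow B.m_ac mult.commute[of p])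
      also have "\<dots> \<in> frob_span (p ^ Suc n) A B f Z"
        using a a' b x y by (intro frob_spanI) (auto simp: Z_def)
      finally show "(b [^]\<^bsub>B\<^esub> (p ^ n) \<otimes>\<^bsub>B\<^esub> f a' \<otimes>\<^bsub>B\<^esub> y) [^]\<^bsub>B\<^esub> p \<otimes>\<^bsub>B\<^esub> f a \<otimes>\<^bsub>B\<^esub> x
          \<in> additive_span B (frob_gens (p ^ Suc n) A B f Z)"
        by (simp only: frob_span_def)
    qed
  qed
  have "carrier B \<subseteq> frob_span (p ^ Suc n) A B f Z"
  proof
    fix b assume "b \<in> carrier B"
    then have "b \<in> frob_span p A B f X" using span by auto
    then show "b \<in> frob_span (p ^ Suc n) A B f Z"
      unfolding frob_span_def
    proof (rule additive_span_mono)
      show "frob_gens p A B f X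
        \<subseteq> additive_span B (frob_gens (p ^ Suc n) A B f Z)"
        using gen unfolding frob_span_def by auto
    qed
  qed
  with Z show ?case by (intro exI[of _ Z]) simp
qed

end

theorem theorem19:
  fixes p e :: nat
    and A :: "('a, 'u) ring_scheme"
    and B :: "('b, 'v) ring_scheme"
    and C :: "('c, 'w) ring_scheme"
    and f :: "'a \<Rightarrow> 'b"
    and g :: "'b \<Rightarrow> 'c"
  assumes "Factorial_Ring.prime p"
    and "e > 0"
    and "Fp_algebra p A" and "Fp_algebra p B" and "Fp_algebra p C"
    and "f \<in> ring_hom A B" and "g \<in> ring_hom B C"
    and "Dumitrescu p e B C g"
    and "Max_spec B \<subseteq> Spec_map B g ` Spec C"
    and "F_finite p A C (g \<circ> f)"
    and "noetherian_ring B"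
    and "noetherian_ring (frob_tensor p e A C (g \<circ> f))"
  shows "F_finite p A B f"
proof -
  interpret A: cring A using \<open>Fp_algebra p A\<close> by (simp add: Fp_algebra_def)
  interpret B: cring B using \<open>Fp_algebra p B\<close> by (simp add: Fp_algebra_def)
  interpret C: cring C using \<open>Fp_algebra p C\<close> by (simp add: Fp_algebra_def)
  interpret AB: frobenius_map p 1 A B f
    by (rule frobenius_map.intro) fact+
  have gf: "g \<circ> f \<in> ring_hom A C"
    using ring_hom_trans[OF \<open>f \<in> ring_hom A B\<close> \<open>g \<in> ring_hom B C\<close>] .
  interpret AC1: frobenius_map p 1 A C "g \<circ> f"
    by (rule frobenius_map.intro) fact+
  interpret AC: frobenius_map p e A C "g \<circ> f"
    by (rule frobenius_map.intro) fact+
  interpret BC: frobenius_map p e B C g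
    by (rule frobenius_map.intro) fact+
  let ?q = "p ^ e"
  let ?S = "frob_span ?q A C (g \<circ> f)"
  let ?T = "frob_tensor p e A C (g \<circ> f)"
  let ?\<rho> = "rel_frob p e A C (g \<circ> f)"
  note f_simps = AB.f_simps and g_simps = BC.f_simps

  obtain X where X: "finite X" "X \<subseteq> carrier C" "carrier C \<subseteq> ?S X"
  proof -
    obtain X0 where "finite X0" "X0 \<subseteq> carrier C" "carrier C \<subseteq> frob_span p A C (g \<circ> f) X0"
      using \<open>F_finite p A C (g \<circ> f)\<close> AC1.finite_rel_frob_iff by (auto simp: F_finite_def)
    from AC.frob_span_iterate[OF this, of e] show ?thesis
      using that by auto
  qed

  \<comment> \<open>\<open>C\<close> as a module over the Noetherian ring \<open>T\<close>; its submodules are those over \<open>C\<^sup>q[A]\<close>.\<close>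
  define M where "M = scalars_via ?\<rho> C"
  have M: "module ?T M"
    unfolding M_def by (rule module_scalars_via[OF AC.T.cring_axioms C.cring_axioms AC.rel_frob_hom])
  interpret M: module ?T M by (rule M)
  have Ms [simp]: "carrier M = carrier C" "\<zero>\<^bsub>M\<^esub> = \<zero>\<^bsub>C\<^esub>" "add M = add C" "r \<odot>\<^bsub>M\<^esub> x = ?\<rho> r \<otimes>\<^bsub>C\<^esub> x" for r x
    by (simp_all add: M_def)
  have M_minus: "x \<ominus>\<^bsub>M\<^esub> y = x \<ominus>\<^bsub>C\<^esub> y" for x y
    by (simp add: a_minus_def a_inv_def m_inv_def)
  have span_M: "additive_span M S = additive_span C S" for S
  proof
    show "additive_span M S \<subseteq> additive_span C S"
      by (rule subsetI, erule additive_span_least)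
         (auto simp: M_minus intro: additive_span.intros additive_span.zero[of C, folded Ms])
    show "additive_span C S \<subseteq> additive_span M S"
      by (rule subsetI, erule additive_span_least)
         (auto simp: M_minus[symmetric] intro: additive_span.intros additive_span.zero[of M, unfolded Ms])
  qed
  have module_span_M: "module_span ?T M Y = ?S Y" if Y: "Y \<subseteq> carrier C" for Y
  proof
    show "module_span ?T M Y \<subseteq> ?S Y"
    proof
      fix v assume "v \<in> module_span ?T M Y"
      then show "v \<in> ?S Y"
        unfolding span_M frob_span_def
      proof (rule additive_span_mono)
        show "{r \<odot>\<^bsub>M\<^esub> x | r x. r \<in> carrier ?T \<and> x \<in> Y} \<subseteq> additive_span C
          (frob_gens ?q A C (g \<circ> f) Y)"
          using AC.rel_frob_mult_frob_span[OF _ _ Y] by (auto simp: frob_span_def)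
      qed
    qed
    show "?S Y \<subseteq> module_span ?T M Y"
    proof
      fix v assume "v \<in> ?S Y"
      then show "v \<in> module_span ?T M Y"
        unfolding span_M frob_span_def
      proof (rule additive_span_mono, clarify)
        fix b a x assume *: "b \<in> carrier C" "a \<in> carrier A" "x \<in> Y"
        have "b [^]\<^bsub>C\<^esub> ?q \<otimes>\<^bsub>C\<^esub> (g \<circ> f) a \<otimes>\<^bsub>C\<^esub> x
            = pure_tensor A (scalars_via (g \<circ> f) C) (frob_factor p e A) b a \<odot>\<^bsub>M\<^esub> x"
          using * AC.rel_frob_pure by simp
        also have "\<dots> \<in> additive_span C {r \<odot>\<^bsub>M\<^esub> x | r x. r \<in> carrier ?T \<and> x \<in> Y}"
          by (intro additive_span.base CollectI exI[of _ "pure_tensor A (scalars_via (g \<circ> f) C) (frob_factor p e A) b a"]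
              exI[of _ x]) (use * AC.pure_closed in simp)
        finally show "b [^]\<^bsub>C\<^esub> ?q \<otimes>\<^bsub>C\<^esub> (g \<circ> f) a \<otimes>\<^bsub>C\<^esub> x
          \<in> additive_span C {r \<odot>\<^bsub>M\<^esub> x | r x. r \<in> carrier ?T \<and> x \<in> Y}" .
      qed
    qed
  qed

  \<comment> \<open>The subring \<open>C\<^sup>q[B]\<close> of \<open>C\<close>.\<close>
  define V where "V = frob_span ?q B C g {\<one>\<^bsub>C\<^esub>}"
  have V_mem: "c [^]\<^bsub>C\<^esub> ?q \<otimes>\<^bsub>C\<^esub> g b \<in> V" if "c \<in> carrier C" "b \<in> carrier B" for c b
    using BC.frob_spanI[OF that singletonI[of "\<one>\<^bsub>C\<^esub>"], of ?q] that by (simp add: V_def g_simps)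
  have V_cases: "v \<in> K"
    if v: "v \<in> V" and K: "\<zero>\<^bsub>C\<^esub> \<in> K" "\<And>x y. x \<in> K \<Longrightarrow> y \<in> K \<Longrightarrow> x \<ominus>\<^bsub>C\<^esub> y \<in> K"
      and gen: "\<And>c b. c \<in> carrier C \<Longrightarrow> b \<in> carrier B \<Longrightarrow> c [^]\<^bsub>C\<^esub> ?q \<otimes>\<^bsub>C\<^esub> g b \<in> K" for v K
    using v unfolding V_def frob_span_def
    by (rule additive_span_least) (use K gen in \<open>auto simp: g_simps\<close>)
  have V_in: "v \<in> carrier C" if "v \<in> V" for v
    using BC.frob_span_closed[of "{\<one>\<^bsub>C\<^esub>}"] that by (simp add: V_def)
  have V_0: "\<zero>\<^bsub>C\<^esub> \<in> V" and V_diff: "\<And>x y. x \<in> V \<Longrightarrow> y \<in> V \<Longrightarrow> x \<ominus>\<^bsub>C\<^esub> y \<in> V"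
    unfolding V_def frob_span_def by (rule additive_span.zero, rule additive_span.diff)
  have V_smult: "?\<rho> r \<otimes>\<^bsub>C\<^esub> v \<in> V" if r: "r \<in> carrier ?T" and v: "v \<in> V" for r v
  proof -
    have rC: "?\<rho> r \<in> carrier C"
      using r by (rule AC.\<rho>_simps(1))
    have "v \<in> {v \<in> carrier C. ?\<rho> r \<otimes>\<^bsub>C\<^esub> v \<in> V}"
    proof (rule V_cases[OF v])
      show "\<zero>\<^bsub>C\<^esub> \<in> {v \<in> carrier C. ?\<rho> r \<otimes>\<^bsub>C\<^esub> v \<in> V}"
        using rC V_0 by simp
      show "x \<ominus>\<^bsub>C\<^esub> y \<in> {v \<in> carrier C. ?\<rho> r \<otimes>\<^bsub>C\<^esub> v \<in> V}"
        if "x \<in> {v \<in> carrier C. ?\<rho> r \<otimes>\<^bsub>C\<^esub> v \<in> V}" "y \<in> {v \<in> carrier C. ?\<rho> r \<otimes>\<^bsub>C\<^esub> v \<in> V}" for x y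
      proof -
        have "?\<rho> r \<otimes>\<^bsub>C\<^esub> (x \<ominus>\<^bsub>C\<^esub> y) = ?\<rho> r \<otimes>\<^bsub>C\<^esub> x \<ominus>\<^bsub>C\<^esub> ?\<rho> r \<otimes>\<^bsub>C\<^esub> y"
          using that rC by (simp add: a_minus_def C.r_distr C.r_minus)
        then show ?thesis using that V_diff by simp
      qed
      fix c b assume c: "c \<in> carrier C" and b: "b \<in> carrier B"
      define x where "x = c [^]\<^bsub>C\<^esub> ?q \<otimes>\<^bsub>C\<^esub> g b"
      have x: "x \<in> carrier C" using c b by (simp add: x_def g_simps)
      have "?\<rho> r \<otimes>\<^bsub>C\<^esub> x \<in> ?S {x}"
        by (rule AC.rel_frob_mult_frob_span[OF r]) (use x in simp_all)
      then have "?\<rho> r \<otimes>\<^bsub>C\<^esub> x \<in> V"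
        unfolding frob_span_def
      proof (rule additive_span_least)
        show "frob_gens ?q A C (g \<circ> f) {x} \<subseteq> V"
        proof clarify
          fix d a assume d: "d \<in> carrier C" and a: "a \<in> carrier A"
          have "d [^]\<^bsub>C\<^esub> ?q \<otimes>\<^bsub>C\<^esub> (g \<circ> f) a \<otimes>\<^bsub>C\<^esub> x = (d \<otimes>\<^bsub>C\<^esub> c) [^]\<^bsub>C\<^esub> ?q \<otimes>\<^bsub>C\<^esub> g (f a \<otimes>\<^bsub>B\<^esub> b)"
            using a b c d by (simp add: x_def C.nat_pow_distrib f_simps g_simps C.m_ac)
          then show "d [^]\<^bsub>C\<^esub> ?q \<otimes>\<^bsub>C\<^esub> (g \<circ> f) a \<otimes>\<^bsub>C\<^esub> x \<in> V"
            using V_mem[of "d \<otimes>\<^bsub>C\<^esub> c" "f a \<otimes>\<^bsub>B\<^esub> b"] a b c d by (simp add: f_simps)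
        qed
      qed (rule V_0, rule V_diff)
      then show "c [^]\<^bsub>C\<^esub> ?q \<otimes>\<^bsub>C\<^esub> g b \<in> {v \<in> carrier C. ?\<rho> r \<otimes>\<^bsub>C\<^esub> v \<in> V}"
        using x by (simp add: x_def)
    qed
    then show ?thesis by simp
  qed
  have V: "submodule V ?T M"
  proof (rule M.submoduleI)
    have uminus: "\<ominus>\<^bsub>C\<^esub> a \<in> V" if "a \<in> V" for a
      using V_diff[OF V_0 that] V_in[OF that] by (simp add: a_minus_def)
    show "\<ominus>\<^bsub>M\<^esub> a \<in> V" if "a \<in> V" for a
      using uminus[OF that] by (simp add: a_inv_def m_inv_def)
    show "a \<oplus>\<^bsub>M\<^esub> b \<in> V" if "a \<in> V" "b \<in> V" for a b
      using V_diff[OF that(1) uminus[OF that(2)]] V_in[OF that(1)] V_in[OF that(2)] by (simp add: a_minus_def)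
  qed (use V_in V_0 V_smult in auto)

  obtain Y where Y: "finite Y" "Y \<subseteq> V" "V \<subseteq> ?S Y"
  proof -
    have "V \<subseteq> module_span ?T M X"
      using V_in X(3) unfolding module_span_M[OF X(2)] by auto
    then have "\<exists>Y. finite Y \<and> Y \<subseteq> V \<and> V \<subseteq> module_span ?T M Y"
      by (intro M.submodule_finitely_generated[OF \<open>noetherian_ring ?T\<close> X(1) _ V]) (simp_all add: X(2))
    then obtain Y where Y: "finite Y" "Y \<subseteq> V" "V \<subseteq> module_span ?T M Y"
      by (elim exE conjE)
    have YC: "Y \<subseteq> carrier C"
      using Y(2) V_in by auto
    show ?thesis
      using Y unfolding module_span_M[OF YC] by (rule that)
  qed

  \<comment> \<open>Each generator is a sum of products \<open>c\<^sup>q g(b)\<close>; collect the finitely many \<open>b\<close>.\<close>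
  have "\<exists>Z. finite Z \<and> Z \<subseteq> carrier B \<and> v \<in> ?S (g ` Z)" if v: "v \<in> V" for v
  proof -
    have "v \<in> {v. \<exists>Z. finite Z \<and> Z \<subseteq> carrier B \<and> v \<in> ?S (g ` Z)}"
    proof (rule V_cases[OF v])
      show "\<zero>\<^bsub>C\<^esub> \<in> {v. \<exists>Z. finite Z \<and> Z \<subseteq> carrier B \<and> v \<in> ?S (g ` Z)}"
        by (intro CollectI exI[of _ "{}"]) (simp add: frob_span_def additive_span.zero)
    next
      fix x y
      assume "x \<in> {v. \<exists>Z. finite Z \<and> Z \<subseteq> carrier B \<and> v \<in> ?S (g ` Z)}"
        and "y \<in> {v. \<exists>Z. finite Z \<and> Z \<subseteq> carrier B \<and> v \<in> ?S (g ` Z)}"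
      then obtain Z Z' where Z: "finite Z" "Z \<subseteq> carrier B" "x \<in> ?S (g ` Z)"
        and Z': "finite Z'" "Z' \<subseteq> carrier B" "y \<in> ?S (g ` Z')"
        by auto
      have "x \<ominus>\<^bsub>C\<^esub> y \<in> ?S (g ` (Z \<union> Z'))"
        using AC.frob_span_mono[OF Z(3), of "g ` (Z \<union> Z')"] AC.frob_span_mono[OF Z'(3), of "g ` (Z \<union> Z')"]
        unfolding frob_span_def by (intro additive_span.diff) auto
      then show "x \<ominus>\<^bsub>C\<^esub> y \<in> {v. \<exists>Z. finite Z \<and> Z \<subseteq> carrier B \<and> v \<in> ?S (g ` Z)}"
        using Z Z' by (intro CollectI exI[of _ "Z \<union> Z'"]) simp
    next
      fix c b assume c: "c \<in> carrier C" and b: "b \<in> carrier B"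
      have "c [^]\<^bsub>C\<^esub> ?q \<otimes>\<^bsub>C\<^esub> g b \<in> ?S (g ` {b})"
        using AC.frob_spanI[OF c A.one_closed, of "g b" "g ` {b}" ?q] b c by (simp add: f_simps g_simps)
      then show "c [^]\<^bsub>C\<^esub> ?q \<otimes>\<^bsub>C\<^esub> g b \<in> {v. \<exists>Z. finite Z \<and> Z \<subseteq> carrier B \<and> v \<in> ?S (g ` Z)}"
        using b by (intro CollectI exI[of _ "{b}"]) simp
    qed
    then show ?thesis by simp
  qed
  then have "\<forall>y\<in>Y. \<exists>Z. finite Z \<and> Z \<subseteq> carrier B \<and> y \<in> ?S (g ` Z)"
    using Y(2) by auto
  then obtain \<zeta> where \<zeta>: "\<forall>y\<in>Y. finite (\<zeta> y) \<and> \<zeta> y \<subseteq> carrier B \<and> y \<in> ?S (g ` \<zeta> y)"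
    by (rule bchoice[THEN exE])
  define Z where "Z = (\<Union>y\<in>Y. \<zeta> y)"
  have Z: "finite Z" "Z \<subseteq> carrier B"
    using \<zeta> Y(1) by (auto simp: Z_def)
  have gZ: "g ` Z \<subseteq> carrier C"
    using Z by (auto simp: g_simps)
  have Y_Z: "Y \<subseteq> module_span ?T M (g ` Z)"
  proof
    fix y assume y: "y \<in> Y"
    have "y \<in> ?S (g ` Z)"
      by (rule AC.frob_span_mono[of _ _ "g ` \<zeta> y"]) (use \<zeta> y in \<open>auto simp: Z_def\<close>)
    then show "y \<in> module_span ?T M (g ` Z)"
      by (simp only: module_span_M[OF gZ])
  qed
  have V_Z: "v \<in> ?S (g ` Z)" if v: "v \<in> V" for v
  proof -
    have YC: "Y \<subseteq> carrier C" using Y(2) V_in by auto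
    have vY: "v \<in> module_span ?T M Y"
      using subsetD[OF Y(3) v] by (simp only: module_span_M[OF YC])
    have "g ` Z \<subseteq> carrier M" using gZ by simp
    then have "v \<in> module_span ?T M (g ` Z)"
      by (rule M.module_span_least[OF M.module_span_submodule Y_Z vY])
    then show ?thesis
      by (simp only: module_span_M[OF gZ])
  qed

  \<comment> \<open>It remains to show \<open>N = B\<close>. Here \<open>B\<close> acts on itself through \<open>q\<close>-th powers, and \<open>N\<close> is a submodule.\<close>
  define N where "N = frob_span ?q A B f Z"
  let ?F = "frob_factor p e B"
  interpret F: module B ?F by (rule BC.module_right)
  have F_minus: "\<ominus>\<^bsub>?F\<^esub> x = \<ominus>\<^bsub>B\<^esub> x" for x
    by (simp add: a_inv_def m_inv_def)
  note Ngens = AB.frob_gens_in_carrier[OF Z(2), of ?q]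
  have N_in: "n \<in> carrier B" if "n \<in> N" for n
    using that unfolding N_def by (rule AB.frob_span_closed[OF Z(2)])
  have N: "submodule N B ?F"
  proof (rule F.submoduleI)
    show "N \<subseteq> carrier ?F" using N_in by auto
    show "\<zero>\<^bsub>?F\<^esub> \<in> N" by (simp add: N_def frob_span_def additive_span.zero)
    show "\<ominus>\<^bsub>?F\<^esub> a \<in> N" if a: "a \<in> N" for a
    proof -
      have "\<zero>\<^bsub>B\<^esub> \<ominus>\<^bsub>B\<^esub> a \<in> N"
        using a unfolding N_def frob_span_def by (intro additive_span.diff additive_span.zero)
      then show ?thesis using N_in[OF a] by (simp add: F_minus a_minus_def)
    qed
    show "a \<oplus>\<^bsub>?F\<^esub> b \<in> N" if "a \<in> N" "b \<in> N" for a b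
      using B.additive_span_add[OF Ngens, of a b] that by (simp add: N_def frob_span_def)
    show "r \<odot>\<^bsub>?F\<^esub> a \<in> N" if r: "r \<in> carrier B" and a: "a \<in> N" for r a
    proof -
      have "r [^]\<^bsub>B\<^esub> ?q \<otimes>\<^bsub>B\<^esub> a \<in> additive_span B
          (frob_gens ?q A B f Z)"
      proof (rule additive_span_map[where h = "\<lambda>x. r [^]\<^bsub>B\<^esub> ?q \<otimes>\<^bsub>B\<^esub> x",
          OF B.is_abelian_group B.is_abelian_group Ngens])
        show "a \<in> additive_span B (frob_gens ?q A B f Z)"
          using a by (simp add: N_def frob_span_def)
        show "(\<lambda>x. r [^]\<^bsub>B\<^esub> ?q \<otimes>\<^bsub>B\<^esub> x) `
            frob_gens ?q A B f Z
          \<subseteq> additive_span B (frob_gens ?q A B f Z)"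
        proof clarify
          fix b a' z assume b: "b \<in> carrier B" and a': "a' \<in> carrier A" and z: "z \<in> Z"
          have "r [^]\<^bsub>B\<^esub> ?q \<otimes>\<^bsub>B\<^esub> (b [^]\<^bsub>B\<^esub> ?q \<otimes>\<^bsub>B\<^esub> f a' \<otimes>\<^bsub>B\<^esub> z) = (r \<otimes>\<^bsub>B\<^esub> b) [^]\<^bsub>B\<^esub> ?q \<otimes>\<^bsub>B\<^esub> f a' \<otimes>\<^bsub>B\<^esub> z"
            using r b a' subsetD[OF Z(2) z] by (simp add: B.nat_pow_distrib f_simps B.m_ac)
          also have "\<dots> \<in> frob_span ?q A B f Z"
            using r b a' z by (intro AB.frob_spanI) auto
          finally show "r [^]\<^bsub>B\<^esub> ?q \<otimes>\<^bsub>B\<^esub> (b [^]\<^bsub>B\<^esub> ?q \<otimes>\<^bsub>B\<^esub> f a' \<otimes>\<^bsub>B\<^esub> z) \<in> additive_span B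
              (frob_gens ?q A B f Z)"
            by (simp only: frob_span_def)
        qed
      qed (use r in \<open>simp_all add: B.r_distr\<close>)
      then show ?thesis by (simp add: N_def frob_span_def)
    qed
  qed

  have "b \<in> N" if b: "b \<in> carrier B" for b
  proof -
    \<comment> \<open>Values of \<open>\<Phi>\<^sub>e(B, C)\<close> on tensors \<open>\<Sum> c\<^sub>i \<otimes> n\<^sub>i\<close> with \<open>n\<^sub>i \<in> N\<close>; they include \<open>g(b)\<close>, as
      \<open>c\<^sup>q g(f(a)) g(z) = c\<^sup>q g(f(a) z)\<close> and \<open>f(a) z \<in> N\<close>.\<close>
    define K where "K = {v. \<exists>s. Poly_Mapping.keys s \<subseteq> carrier C \<times> N \<and> BC.eval s = v}"
    have CN: "carrier C \<times> N \<subseteq> carrier C \<times> carrier B"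
      using N_in by auto
    have "g b \<in> V"
      using V_mem[OF C.one_closed b] b by (simp add: g_simps)
    then have "g b \<in> ?S (g ` Z)"
      by (rule V_Z)
    then have "g b \<in> K"
      unfolding frob_span_def
    proof (rule additive_span_least)
      show "frob_gens ?q A C (g \<circ> f) (g ` Z) \<subseteq> K"
      proof clarify
        fix c a z assume c: "c \<in> carrier C" and a: "a \<in> carrier A" and z: "z \<in> Z"
        have zB: "z \<in> carrier B" using z Z by auto
        have n: "f a \<otimes>\<^bsub>B\<^esub> z \<in> N"
          using AB.frob_spanI[OF B.one_closed a z, of ?q] a zB by (simp add: N_def f_simps)
        have "BC.eval (frag_of (c, f a \<otimes>\<^bsub>B\<^esub> z)) = c [^]\<^bsub>C\<^esub> ?q \<otimes>\<^bsub>C\<^esub> (g \<circ> f) a \<otimes>\<^bsub>C\<^esub> g z"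
          using a c zB by (simp add: BC.eval_of f_simps g_simps C.m_assoc)
        then show "c [^]\<^bsub>C\<^esub> ?q \<otimes>\<^bsub>C\<^esub> (g \<circ> f) a \<otimes>\<^bsub>C\<^esub> g z \<in> K"
          unfolding K_def using c n by (intro CollectI exI[of _ "frag_of (c, f a \<otimes>\<^bsub>B\<^esub> z)"]) simp
      qed
      show "\<zero>\<^bsub>C\<^esub> \<in> K"
        unfolding K_def by (intro CollectI exI[of _ 0]) (simp add: frag_eval_def)
      fix x y assume "x \<in> K" "y \<in> K"
      then obtain s t where st: "Poly_Mapping.keys s \<subseteq> carrier C \<times> N" "Poly_Mapping.keys t \<subseteq> carrier C \<times> N"
        "BC.eval s = x" "BC.eval t = y"
        by (auto simp: K_def)
      have "Poly_Mapping.keys (s - t) \<subseteq> carrier C \<times> N"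
        using st(1,2) keys_diff[of s t] by auto
      moreover have "BC.eval (s - t) = x \<ominus>\<^bsub>C\<^esub> y"
        using BC.eval_diff[OF subset_trans[OF st(1) CN] subset_trans[OF st(2) CN]] st(3,4) by simp
      ultimately show "x \<ominus>\<^bsub>C\<^esub> y \<in> K"
        unfolding K_def by (intro CollectI exI[of _ "s - t"]) simp
    qed
    then obtain s where s: "Poly_Mapping.keys s \<subseteq> carrier C \<times> N" "BC.eval s = g b"
      by (auto simp: K_def)
    have sB: "Poly_Mapping.keys s \<subseteq> carrier C \<times> carrier B"
      using s(1) CN by (rule subset_trans)
    have oneb: "Poly_Mapping.keys (frag_of (\<one>\<^bsub>C\<^esub>, b)) \<subseteq> carrier C \<times> carrier B"
      using b by simp
    have "frag_of (\<one>\<^bsub>C\<^esub>, b) - s \<in> tensor_null B (scalars_via g C) ?F"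
    proof (rule BC.Dumitrescu_null_if_eval_zero[OF \<open>Dumitrescu p e B C g\<close>])
      show "Poly_Mapping.keys (frag_of (\<one>\<^bsub>C\<^esub>, b) - s) \<subseteq> carrier C \<times> carrier B"
        using keys_diff[of "frag_of (\<one>\<^bsub>C\<^esub>, b)" s] oneb sB by blast
      show "BC.eval (frag_of (\<one>\<^bsub>C\<^esub>, b) - s) = \<zero>\<^bsub>C\<^esub>"
        unfolding BC.eval_diff[OF oneb sB] s(2)
        using b by (simp add: BC.eval_of g_simps a_minus_def C.r_neg)
    qed
    then show "b \<in> N"
      by (intro BC.mem_submodule_if_tensor[OF \<open>Dumitrescu p e B C g\<close> \<open>e > 0\<close> \<open>noetherian_ring B\<close>
            \<open>Max_spec B \<subseteq> Spec_map B g ` Spec C\<close> BC.module_right N _ s(1)]) (simp add: b)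
  qed
  then have "b \<in> frob_span p A B f Z" if "b \<in> carrier B" for b
  proof -
    have "b \<in> frob_span ?q A B f Z" using \<open>b \<in> carrier B\<close> \<open>\<And>b. b \<in> carrier B \<Longrightarrow> b \<in> N\<close> by (simp add: N_def)
    then show ?thesis
      unfolding frob_span_def
    proof (rule additive_span_mono, clarify)
      fix b a z assume *: "b \<in> carrier B" "a \<in> carrier A" "z \<in> Z"
      \<comment> \<open>A \<open>q\<close>-th power is a \<open>p\<close>-th power, as \<open>e > 0\<close>.\<close>
      have "?q = p ^ (e - 1) * p"
        using \<open>e > 0\<close> power_minus_mult[of e p] by simp
      then have "b [^]\<^bsub>B\<^esub> ?q = (b [^]\<^bsub>B\<^esub> (p ^ (e - 1))) [^]\<^bsub>B\<^esub> p"
        using * by (simp add: B.nat_pow_pow)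
      then show "b [^]\<^bsub>B\<^esub> ?q \<otimes>\<^bsub>B\<^esub> f a \<otimes>\<^bsub>B\<^esub> z \<in> additive_span B
          (frob_gens p A B f Z)"
        using AB.frob_spanI[of "b [^]\<^bsub>B\<^esub> (p ^ (e - 1))" a z Z p] * by (simp add: frob_span_def)
    qed
  qed
  then have "finite_ring_map (frob_tensor p 1 A B f) B (rel_frob p 1 A B f)"
    unfolding AB.finite_rel_frob_iff using Z by (intro exI[of _ Z]) auto
  then show ?thesis
    by (simp add: F_finite_def)
qed

end
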